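(* Let $0<c<\infty$ and suppose that $d_1,d_2\to\infty$ with $p=p(d_1,d_2)$ such that $\lim_{d_1,d_2\to\infty}\frac{p}{d_1d_2}=c$. Let $W$ be the $d_1d_2\times d_1d_2$ Wishart matrix $W=\frac{1}{d_1d_2}(G_iG_j^* )_{i,j=1}^{d_1}$, with left partial transpose $W^{L}$, right partial transpose $W^{R}$, and full transpose $W^{\mathrm T}$. Then: (a) if $W$ is a complex Wishart matrix, the family $\{W,W^{L},W^{R},W^{\mathrm T}\}$ is asymptotically free; (b) if $W$ is a real Wishart matrix, the family $\{W,W^{R}\}$ is asymptotically free.
   Context: Wishart matrices: let $G_1,\dots,G_{d_1}$ be $d_2\times p$ random matrices, $G_i=(g^{(i)}_{jk})_{jk}$, where all the $g^{(i)}_{jk}$ are independent; in the complex case they are complex Gaussian with mean $0$ and $\mathrm E(|g^{(i)}_{jk}|^2)=1$; in the real case they are real Gaussian with mean $0$ and variance $1$. Put $W(i,j)=\frac1{d_2}G_iG_j^*$ (a $d_2\times d_2$ matrix) and $W=\frac1{d_1}(W(i,j))_{i,j=1}^{d_1}$, a $d_1\times d_1$ block matrix with $d_2\times d_2$ blocks. Define $W^{L}=\frac1{d_1}(W(j,i))_{ij}$ (left partial transpose), $W^{R}=\frac1{d_1}(W(i,j)^{\mathrm T})_{ij}$ (right partial transpose), $W^{\mathrm T}=\frac1{d_1}(W(j,i)^{\mathrm T})_{ij}$ (full transpose). In the real case $W=W^{\mathrm T}$ and $W^{L}=W^{R}$. Asymptotic freeness: let $\mathrm{tr}$ denote the normalized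 trace on $d_1d_2\times d_1d_2$ matrices. A family of random matrices is asymptotically free if all its joint moments with respect to $\mathrm E\circ\mathrm{tr}$ converge, so that it has a limit joint distribution in some non-commutative probability space, and the limit elements are free in that space (equivalently, all mixed free cumulants of the limit vanish). *)

theory Defs
  imports
    "HOL-Probability.Probability"
    "HOL-Library.Poly_Mapping"
    "Jordan_Normal_Form.Schur_Decomposition"
begin

section \<open>Wishart matrices and their partial transposes\<close>

text \<open>
  The array \<open>g\<close> lists the entries of the matrices \<open>G\<^sub>0, \<dots>, G\<^sub>d\<^sub>1\<^sub>-\<^sub>1\<close>: \<open>g i j k\<close> is the
  \<open>(j, k)\<close> entry of \<open>G\<^sub>i\<close>. All indices start at 0.
\<close>

definition gaussian_block :: "nat \<Rightarrow> nat \<Rightarrow> (nat \<Rightarrow> nat \<Rightarrow> nat \<Rightarrow> complex) \<Rightarrow> nat \<Rightarrow> complex mat" where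
  "gaussian_block d2 p g i = mat d2 p (\<lambda>(j, k). g i j k)"

definition wishart_block ::
    "nat \<Rightarrow> nat \<Rightarrow> (nat \<Rightarrow> nat \<Rightarrow> nat \<Rightarrow> complex) \<Rightarrow> nat \<Rightarrow> nat \<Rightarrow> complex mat" where
  "wishart_block d2 p g i j =
     (1 / of_nat d2) \<cdot>\<^sub>m (gaussian_block d2 p g i * mat_adjoint (gaussian_block d2 p g j))"

text \<open>
  The matrix with \<open>d1 \<times> d1\<close> blocks, whose block at \<open>(i, j)\<close> is the \<open>d2 \<times> d2\<close> matrix \<open>B i j\<close>.
\<close>

definition block_matrix :: "nat \<Rightarrow> nat \<Rightarrow> (nat \<Rightarrow> nat \<Rightarrow> 'a mat) \<Rightarrow> 'a mat" where
  "block_matrix d1 d2 B =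
     mat (d1 * d2) (d1 * d2) (\<lambda>(r, s). B (r div d2) (s div d2) $$ (r mod d2, s mod d2))"

definition wishart ::
    "nat \<Rightarrow> nat \<Rightarrow> nat \<Rightarrow> (nat \<Rightarrow> nat \<Rightarrow> nat \<Rightarrow> complex) \<Rightarrow> complex mat" where
  "wishart d1 d2 p g =
     (1 / of_nat d1) \<cdot>\<^sub>m block_matrix d1 d2 (\<lambda>i j. wishart_block d2 p g i j)"

definition wishart_left ::
    "nat \<Rightarrow> nat \<Rightarrow> nat \<Rightarrow> (nat \<Rightarrow> nat \<Rightarrow> nat \<Rightarrow> complex) \<Rightarrow> complex mat" where
  "wishart_left d1 d2 p g =
     (1 / of_nat d1) \<cdot>\<^sub>m block_matrix d1 d2 (\<lambda>i j. wishart_block d2 p g j i)"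

definition wishart_right ::
    "nat \<Rightarrow> nat \<Rightarrow> nat \<Rightarrow> (nat \<Rightarrow> nat \<Rightarrow> nat \<Rightarrow> complex) \<Rightarrow> complex mat" where
  "wishart_right d1 d2 p g =
     (1 / of_nat d1) \<cdot>\<^sub>m block_matrix d1 d2 (\<lambda>i j. transpose_mat (wishart_block d2 p g i j))"

definition wishart_transpose ::
    "nat \<Rightarrow> nat \<Rightarrow> nat \<Rightarrow> (nat \<Rightarrow> nat \<Rightarrow> nat \<Rightarrow> complex) \<Rightarrow> complex mat" where
  "wishart_transpose d1 d2 p g =
     (1 / of_nat d1) \<cdot>\<^sub>m block_matrix d1 d2 (\<lambda>i j. transpose_mat (wishart_block d2 p g j i))"


section \<open>Gaussian arrays\<close>

text \<open>
  Complex Gaussian variables are circular: real and imaginary part are independent and each has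
  half of the variance \<open>v = E |X - \<mu>|\<^sup>2\<close> (see \<open>complex_normal_mean\<close> and \<open>complex_normal_variance\<close>).
\<close>

definition complex_normal :: "'a measure \<Rightarrow> ('a \<Rightarrow> complex) \<Rightarrow> complex \<Rightarrow> real \<Rightarrow> bool" where
  "complex_normal M X \<mu> v \<longleftrightarrow>
     distributed M lborel (\<lambda>\<omega>. Re (X \<omega>)) (normal_density (Re \<mu>) (sqrt (v / 2))) \<and>
     distributed M lborel (\<lambda>\<omega>. Im (X \<omega>)) (normal_density (Im \<mu>) (sqrt (v / 2))) \<and>
     prob_space.indep_var M borel (\<lambda>\<omega>. Re (X \<omega>)) borel (\<lambda>\<omega>. Im (X \<omega>))"

definition complex_gaussian_array ::
    "'a measure \<Rightarrow> nat \<Rightarrow> nat \<Rightarrow> nat \<Rightarrow> (nat \<Rightarrow> nat \<Rightarrow> nat \<Rightarrow> 'a \<Rightarrow> complex) \<Rightarrow> bool" where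
  "complex_gaussian_array M d1 d2 p g \<longleftrightarrow>
     prob_space.indep_vars M (\<lambda>_. borel) (\<lambda>(i, j, k). g i j k) ({..<d1} \<times> {..<d2} \<times> {..<p}) \<and>
     (\<forall>i<d1. \<forall>j<d2. \<forall>k<p. complex_normal M (g i j k) 0 1)"

definition real_gaussian_array ::
    "'a measure \<Rightarrow> nat \<Rightarrow> nat \<Rightarrow> nat \<Rightarrow> (nat \<Rightarrow> nat \<Rightarrow> nat \<Rightarrow> 'a \<Rightarrow> real) \<Rightarrow> bool" where
  "real_gaussian_array M d1 d2 p g \<longleftrightarrow>
     prob_space.indep_vars M (\<lambda>_. borel) (\<lambda>(i, j, k). g i j k) ({..<d1} \<times> {..<d2} \<times> {..<p}) \<and>
     (\<forall>i<d1. \<forall>j<d2. \<forall>k<p. distributed M lborel (g i j k) (normal_density 0 1))"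

lemma (in prob_space) complex_normal_integrable:
  assumes "complex_normal M X \<mu> v" "v > 0"
  shows "integrable M X"
    and "integrable M (\<lambda>\<omega>. (Re (X \<omega>) - Re \<mu>)\<^sup>2)"
    and "integrable M (\<lambda>\<omega>. (Im (X \<omega>) - Im \<mu>)\<^sup>2)"
proof -
  have s: "sqrt (v / 2) > 0" using assms by simp
  note dR = assms(1)[unfolded complex_normal_def, THEN conjunct1]
  note dI = assms(1)[unfolded complex_normal_def, THEN conjunct2, THEN conjunct1]
  have iR: "integrable M (\<lambda>\<omega>. Re (X \<omega>))"
    using distributed_integrable[OF dR, of "\<lambda>x. x"] integrable_normal_moment_nz_1[OF s]
    by simp
  have iI: "integrable M (\<lambda>\<omega>. Im (X \<omega>))"
    using distributed_integrable[OF dI, of "\<lambda>x. x"] integrable_normal_moment_nz_1[OF s]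
    by simp
  have "integrable M (\<lambda>\<omega>. of_real (Re (X \<omega>)) + \<i> * of_real (Im (X \<omega>)))"
    using iR iI by (intro Bochner_Integration.integrable_add integrable_mult_right integrable_of_real) auto
  then show "integrable M X" by (simp add: complex_eq[symmetric])
  show "integrable M (\<lambda>\<omega>. (Re (X \<omega>) - Re \<mu>)\<^sup>2)"
    using distributed_integrable[OF dR, of "\<lambda>x. (x - Re \<mu>)\<^sup>2"] integrable_normal_moment[OF s, of "Re \<mu>" 2]
    by simp
  show "integrable M (\<lambda>\<omega>. (Im (X \<omega>) - Im \<mu>)\<^sup>2)"
    using distributed_integrable[OF dI, of "\<lambda>x. (x - Im \<mu>)\<^sup>2"] integrable_normal_moment[OF s, of "Im \<mu>" 2]
    by simp
qed

lemma (in prob_space) complex_normal_mean: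
  assumes "complex_normal M X \<mu> v" "v > 0"
  shows "expectation X = \<mu>"
proof -
  have s: "sqrt (v / 2) > 0" using assms by simp
  note i = complex_normal_integrable(1)[OF assms]
  have dR: "distributed M lborel (\<lambda>\<omega>. Re (X \<omega>)) (normal_density (Re \<mu>) (sqrt (v / 2)))"
    and dI: "distributed M lborel (\<lambda>\<omega>. Im (X \<omega>)) (normal_density (Im \<mu>) (sqrt (v / 2)))"
    using assms(1) by (auto simp: complex_normal_def)
  have "Re (expectation X) = Re \<mu>" "Im (expectation X) = Im \<mu>"
    using normal_distributed_expectation[OF s dR] normal_distributed_expectation[OF s dI] i
    by simp_all
  then show ?thesis by (rule complex_eqI)
qed

lemma (in prob_space) complex_normal_variance:
  assumes "complex_normal M X \<mu> v" "v > 0"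
  shows "expectation (\<lambda>\<omega>. (norm (X \<omega> - \<mu>))\<^sup>2) = v"
proof -
  have s: "sqrt (v / 2) > 0" using assms by simp
  have dR: "distributed M lborel (\<lambda>\<omega>. Re (X \<omega>)) (normal_density (Re \<mu>) (sqrt (v / 2)))"
    and dI: "distributed M lborel (\<lambda>\<omega>. Im (X \<omega>)) (normal_density (Im \<mu>) (sqrt (v / 2)))"
    using assms(1) by (auto simp: complex_normal_def)
  have "expectation (\<lambda>\<omega>. (norm (X \<omega> - \<mu>))\<^sup>2)
      = expectation (\<lambda>\<omega>. (Re (X \<omega>) - Re \<mu>)\<^sup>2 + (Im (X \<omega>) - Im \<mu>)\<^sup>2)"
    by (simp add: cmod_power2)
  also have "\<dots> = expectation (\<lambda>\<omega>. (Re (X \<omega>) - Re \<mu>)\<^sup>2) + expectation (\<lambda>\<omega>. (Im (X \<omega>) - Im \<mu>)\<^sup>2)"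
    using complex_normal_integrable[OF assms] by simp
  also have "\<dots> = v / 2 + v / 2"
    using normal_distributed_variance[OF s dR] normal_distributed_variance[OF s dI]
      normal_distributed_expectation[OF s dR] normal_distributed_expectation[OF s dI] assms(2)
    by simp
  finally show ?thesis by simp
qed


section \<open>Non-commutative probability spaces and freeness\<close>

locale nc_prob_space = vector_space smul
  for smul :: "complex \<Rightarrow> 'b::ring_1 \<Rightarrow> 'b" +
  fixes \<phi> :: "'b \<Rightarrow> complex"
  assumes scale_mult_left: "smul c x * y = smul c (x * y)"
    and scale_mult_right: "x * smul c y = smul c (x * y)"
    and state_add: "\<phi> (x + y) = \<phi> x + \<phi> y"
    and state_scale: "\<phi> (smul c x) = c * \<phi> x"
    and state_one: "\<phi> 1 = 1"

definition unital_subalgebra :: "(complex \<Rightarrow> 'b::ring_1 \<Rightarrow> 'b) \<Rightarrow> 'b set \<Rightarrow> bool" where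
  "unital_subalgebra smul A \<longleftrightarrow>
     1 \<in> A \<and> (\<forall>x\<in>A. \<forall>y\<in>A. x + y \<in> A) \<and> (\<forall>x\<in>A. \<forall>y\<in>A. x * y \<in> A) \<and> (\<forall>c. \<forall>x\<in>A. smul c x \<in> A)"

definition free_subalgebras :: "('b::ring_1 \<Rightarrow> complex) \<Rightarrow> 'i set \<Rightarrow> ('i \<Rightarrow> 'b set) \<Rightarrow> bool" where
  "free_subalgebras \<phi> I A \<longleftrightarrow>
     (\<forall>is xs. is \<noteq> [] \<longrightarrow> set is \<subseteq> I \<longrightarrow> successively (\<noteq>) is \<longrightarrow>
        list_all2 (\<lambda>i x. x \<in> A i \<and> \<phi> x = 0) is xs \<longrightarrow> \<phi> (prod_list xs) = 0)"

definition free_elements ::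
    "(complex \<Rightarrow> 'b::ring_1 \<Rightarrow> 'b) \<Rightarrow> ('b \<Rightarrow> complex) \<Rightarrow> 'i set \<Rightarrow> ('i \<Rightarrow> 'b) \<Rightarrow> bool" where
  "free_elements smul \<phi> I a \<longleftrightarrow>
     free_subalgebras \<phi> I (\<lambda>i. unital_subalgebra smul hull {a i})"


section \<open>The free algebra\<close>

text \<open>
  The free unital algebra \<open>\<complex>\<langle>X\<^sub>i\<rangle>\<close> is the monoid algebra of the free monoid, whose operation is
  written additively because the product of \<^typ>\<open>'a \<Rightarrow>\<^sub>0 'b\<close> is convolution over an additive monoid.
\<close>

datatype 'i free_monoid = Word (letters: "'i list")

instantiation free_monoid :: (type) monoid_add
begin

definition zero_free_monoid :: "'a free_monoid" where
  "0 = Word []"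

definition plus_free_monoid :: "'a free_monoid \<Rightarrow> 'a free_monoid \<Rightarrow> 'a free_monoid" where
  "u + v = Word (letters u @ letters v)"

instance
  by standard (auto simp: zero_free_monoid_def plus_free_monoid_def)

end

lemma letters_zero [simp]: "letters 0 = []"
  by (simp add: zero_free_monoid_def)

lemma letters_plus [simp]: "letters (u + v) = letters u @ letters v"
  by (simp add: plus_free_monoid_def)

lemma poly_mapping_induct_single [case_names single sum]:
  fixes P :: "('a \<Rightarrow>\<^sub>0 'b::comm_monoid_add) \<Rightarrow> bool"
  assumes single: "\<And>w c. P (Poly_Mapping.single w c)"
    and sum: "\<And>f g. P f \<Longrightarrow> P g \<Longrightarrow> P (f + g)"
  shows "P x"
proof -
  have x: "x = (\<Sum>w\<in>Poly_Mapping.keys x. Poly_Mapping.single w (Poly_Mapping.lookup x w))"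
    by (rule poly_mapping_eqI)
      (auto simp: lookup_sum lookup_single when_def in_keys_iff)
  have "P (\<Sum>w\<in>S. Poly_Mapping.single w (Poly_Mapping.lookup x w))" if "finite S" for S
    using that
  proof (induction S)
    case empty
    show ?case using single[of undefined 0] by simp
  next
    case (insert w S)
    then show ?case by (simp add: single sum)
  qed
  from this[OF finite_keys[of x]] show ?thesis by (simp only: x[symmetric])
qed

type_synonym 'i free_algebra = "'i free_monoid \<Rightarrow>\<^sub>0 complex"

definition scale_fa :: "complex \<Rightarrow> 'i free_algebra \<Rightarrow> 'i free_algebra" where
  "scale_fa c x = Poly_Mapping.single 0 c * x"

definition gen_fa :: "'i \<Rightarrow> 'i free_algebra" where
  "gen_fa i = Poly_Mapping.single (Word [i]) 1"


section \<open>Asymptotic freeness\<close>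

definition normalized_trace :: "complex mat \<Rightarrow> complex" where
  "normalized_trace A = (\<Sum>i<dim_row A. A $$ (i, i)) / of_nat (dim_row A)"

definition mat_prod_list :: "nat \<Rightarrow> complex mat list \<Rightarrow> complex mat" where
  "mat_prod_list n As = foldr (*) As (1\<^sub>m n)"

text \<open>
  \<open>Xs\<close> is a finite list of sequences of random matrices, indexed by \<open>N\<close> (\<open>N\<close> tends to infinity along
  the filter \<open>F\<close>); the \<open>N\<close>th matrices have size \<open>n N\<close> and live on the probability space \<open>M N\<close>.
  Words in these matrices are lists of positions in \<open>Xs\<close>. Integrability is part of the definition,
  as otherwise the Bochner integral would be 0 by convention.
\<close>

definition limit_distribution ::
    "'n filter \<Rightarrow> ('n \<Rightarrow> 'a measure) \<Rightarrow> ('n \<Rightarrow> nat) \<Rightarrow> ('n \<Rightarrow> 'a \<Rightarrow> complex mat) list \<Rightarrow>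
      ('b::ring_1 \<Rightarrow> complex) \<Rightarrow> (nat \<Rightarrow> 'b) \<Rightarrow> bool" where
  "limit_distribution F M n Xs \<phi> a \<longleftrightarrow>
     (\<forall>w. set w \<subseteq> {..<length Xs} \<longrightarrow>
        (\<forall>\<^sub>F N in F. integrable (M N)
            (\<lambda>\<omega>. normalized_trace (mat_prod_list (n N) (map (\<lambda>i. (Xs ! i) N \<omega>) w)))) \<and>
        ((\<lambda>N. \<integral>\<omega>. normalized_trace (mat_prod_list (n N) (map (\<lambda>i. (Xs ! i) N \<omega>) w)) \<partial>(M N))
            \<longlongrightarrow> \<phi> (prod_list (map a w))) F)"

text \<open>
  The limit elements live in some non-commutative probability space. Since types cannot be quantified
  existentially, the underlying algebra is taken to be the free algebra; this is no restriction, by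
  lemma \<open>asymptotically_freeI\<close> below.
\<close>

definition asymptotically_free ::
    "'n filter \<Rightarrow> ('n \<Rightarrow> 'a measure) \<Rightarrow> ('n \<Rightarrow> nat) \<Rightarrow> ('n \<Rightarrow> 'a \<Rightarrow> complex mat) list \<Rightarrow> bool" where
  "asymptotically_free F M n Xs \<longleftrightarrow>
     (\<exists>(\<phi> :: nat free_algebra \<Rightarrow> complex) a.
        nc_prob_space scale_fa \<phi> \<and>
        limit_distribution F M n Xs \<phi> a \<and>
        free_elements scale_fa \<phi> {..<length Xs} a)"

definition eval_fa ::
    "(complex \<Rightarrow> 'b::ring_1 \<Rightarrow> 'b) \<Rightarrow> ('i \<Rightarrow> 'b) \<Rightarrow> 'i free_algebra \<Rightarrow> 'b" where
  "eval_fa smul a x =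
     (\<Sum>w\<in>Poly_Mapping.keys x. smul (Poly_Mapping.lookup x w) (prod_list (map a (letters w))))"

context nc_prob_space
begin

lemma eval_fa_superset:
  assumes "finite S" "Poly_Mapping.keys x \<subseteq> S"
  shows "eval_fa smul a x =
    (\<Sum>w\<in>S. smul (Poly_Mapping.lookup x w) (prod_list (map a (letters w))))"
  unfolding eval_fa_def using assms by (intro sum.mono_neutral_left) (auto simp: in_keys_iff)

lemma eval_fa_add: "eval_fa smul a (x + y) = eval_fa smul a x + eval_fa smul a y"
proof -
  let ?S = "Poly_Mapping.keys x \<union> Poly_Mapping.keys y"
  have "Poly_Mapping.keys (x + y) \<subseteq> ?S" by (rule Poly_Mapping.keys_add)
  then have "eval_fa smul a (x + y) =
      (\<Sum>w\<in>?S. smul (Poly_Mapping.lookup (x + y) w) (prod_list (map a (letters w))))"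
    by (intro eval_fa_superset) auto
  also have "\<dots> = (\<Sum>w\<in>?S. smul (Poly_Mapping.lookup x w) (prod_list (map a (letters w)))) +
      (\<Sum>w\<in>?S. smul (Poly_Mapping.lookup y w) (prod_list (map a (letters w))))"
    by (simp only: lookup_add scale_left_distrib sum.distrib)
  also have "\<dots> = eval_fa smul a x + eval_fa smul a y"
    by (intro arg_cong2[where f = "(+)"] eval_fa_superset[symmetric]) auto
  finally show ?thesis .
qed

lemma eval_fa_single: "eval_fa smul a (Poly_Mapping.single w c) = smul c (prod_list (map a (letters w)))"
  by (simp add: eval_fa_superset[of "{w}"])

lemma eval_fa_one: "eval_fa smul a 1 = 1"
  using eval_fa_single[of a 0 1] by simp

lemma eval_fa_mult: "eval_fa smul a (x * y) = eval_fa smul a x * eval_fa smul a y"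
proof (induction x rule: poly_mapping_induct_single)
  case (single w c)
  show ?case
  proof (induction y rule: poly_mapping_induct_single)
    case (single v d)
    then show ?case
      by (simp add: mult_single eval_fa_single scale_mult_left scale_mult_right)
  next
    case (sum f g)
    then show ?case by (simp add: distrib_left eval_fa_add)
  qed
next
  case (sum f g)
  then show ?case by (simp add: distrib_right eval_fa_add)
qed

lemma eval_fa_scale: "eval_fa smul a (scale_fa c x) = smul c (eval_fa smul a x)"
  by (simp add: scale_fa_def eval_fa_mult eval_fa_single scale_mult_left)

lemma eval_fa_gen: "eval_fa smul a (gen_fa i) = a i"
  by (simp add: gen_fa_def eval_fa_single)

lemma eval_fa_prod_list: "eval_fa smul a (prod_list xs) = prod_list (map (eval_fa smul a) xs)"
  by (induction xs) (auto simp: eval_fa_one eval_fa_mult)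

lemma nc_prob_space_eval_fa: "nc_prob_space scale_fa (\<lambda>x. \<phi> (eval_fa smul a x))"
proof
  have comm: "x * Poly_Mapping.single 0 c = Poly_Mapping.single 0 c * x" for c and x :: "'c free_algebra"
  proof (induction x rule: poly_mapping_induct_single)
    case (single w d)
    show ?case by (simp add: mult_single mult.commute)
  next
    case (sum f g)
    then show ?case by (simp only: distrib_left distrib_right)
  qed
  fix c d :: complex and x y :: "'c free_algebra"
  show "x * scale_fa c y = scale_fa c (x * y)"
    using comm[of x c] by (simp add: scale_fa_def mult.assoc[symmetric])
  show "scale_fa c x * y = scale_fa c (x * y)"
    by (simp add: scale_fa_def mult.assoc)
  show "scale_fa c (x + y) = scale_fa c x + scale_fa c y"
    by (simp add: scale_fa_def distrib_left)
  show "scale_fa (c + d) x = scale_fa c x + scale_fa d x"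
    by (simp add: scale_fa_def single_add distrib_right)
  show "scale_fa c (scale_fa d x) = scale_fa (c * d) x"
    by (simp add: scale_fa_def mult_single mult.assoc[symmetric])
  show "scale_fa 1 x = x"
    by (simp add: scale_fa_def)
qed (auto simp: eval_fa_add eval_fa_one eval_fa_scale state_add state_scale state_one)

lemma eval_fa_hull:
  assumes "x \<in> unital_subalgebra scale_fa hull {gen_fa i}"
  shows "eval_fa smul a x \<in> unital_subalgebra smul hull {a i}"
proof -
  let ?B = "eval_fa smul a -` (unital_subalgebra smul hull {a i})"
  have "unital_subalgebra smul (unital_subalgebra smul hull {a i})"
    by (rule hull_in[where S = "unital_subalgebra smul"]) (auto simp: unital_subalgebra_def)
  then have "unital_subalgebra scale_fa ?B"
    by (auto simp: unital_subalgebra_def eval_fa_one eval_fa_add eval_fa_mult eval_fa_scale)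
  moreover have "gen_fa i \<in> ?B"
    by (simp add: eval_fa_gen hull_inc)
  ultimately have "unital_subalgebra scale_fa hull {gen_fa i} \<subseteq> ?B"
    by (intro hull_minimal[where S = "unital_subalgebra scale_fa"]) simp_all
  then show ?thesis using assms by auto
qed

lemma asymptotically_freeI:
  assumes "limit_distribution F M n Xs \<phi> a" and "free_elements smul \<phi> {..<length Xs} a"
  shows "asymptotically_free F M n Xs"
proof -
  let ?\<psi> = "\<lambda>x. \<phi> (eval_fa smul a x)"
  have "limit_distribution F M n Xs ?\<psi> gen_fa"
    using assms(1) by (simp add: limit_distribution_def eval_fa_prod_list o_def eval_fa_gen)
  moreover have "free_elements scale_fa ?\<psi> {..<length Xs} gen_fa"
    unfolding free_elements_def free_subalgebras_def
  proof (intro allI impI)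
    fix "is" xs
    assume h: "is \<noteq> []" "set is \<subseteq> {..<length Xs}" "successively (\<noteq>) is"
      "list_all2 (\<lambda>i x. x \<in> unital_subalgebra scale_fa hull {gen_fa i} \<and> ?\<psi> x = 0) is xs"
    have "list_all2 (\<lambda>i x. x \<in> unital_subalgebra smul hull {a i} \<and> \<phi> x = 0)
        is (map (eval_fa smul a) xs)"
      using h(4) by (auto simp: list.rel_map eval_fa_hull elim!: list.rel_mono_strong)
    with h assms(2) show "?\<psi> (prod_list xs) = 0"
      unfolding eval_fa_prod_list free_elements_def free_subalgebras_def by blast
  qed
  ultimately show ?thesis
    unfolding asymptotically_free_def using nc_prob_space_eval_fa by blast
qed

end

end

theory Submission
  imports Defs
begin

text \<open>
  By Wick's formula, the expected normalized trace of a word of length \<open>m\<close> is a sum over pairings \<open>\<pi>\<close>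
  of the \<open>2m\<close> Gaussian factors. The summand of \<open>\<pi>\<close> is
  \<open>p\<^sup>P d\<^sub>1\<^sup>A d\<^sub>2\<^sup>B / (d\<^sub>1 d\<^sub>2)\<^sup>m\<^sup>+\<^sup>1\<close>, where \<open>P\<close>, \<open>A\<close> and \<open>B\<close> count the
  components of the graphs by which \<open>\<pi>\<close> identifies the three kinds of indices. Euler's bound gives
  \<open>A + P \<le> m + 1\<close> and \<open>B + P \<le> m + 1\<close>, so that only the pairings with equality in both survive in
  the limit. These are the pairings that are noncrossing for two orders of the factors on a
  circle, one for each tensor leg; a partial transpose reverses the factors of a letter in one of
  the orders.

  Reading such a pairing from left to right with a stack of open blocks shows that every block
  consists of equal letters, and that for \<open>W\<^sup>L\<close> and \<open>W\<^sup>R\<close> it has at most two elements. The limit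
  moments are therefore weighted counts of stack histories in which a letter only acts on the
  topmost run of letters of its own kind, as in a free product representation, and freeness follows.
\<close>

text \<open>The comparison of the two legs forces the shape of the blocks. Planarity in one leg
  prescribes which points of the topmost open block the next letter can meet; read in both legs,
  this and the contraction rule recover both flags, and the flags determine the letter. A letter
  transposed in exactly one leg shows its two points in opposite orders. The second point read
  cannot reach an open block unless the first one does, so both must meet the block at once: such a
  letter can close a block but never continue it. Components are not counted by following paths. A
  graph with \<open>k\<close> components has \<open>n ^ k\<close> labellings by \<open>n\<close>
  labels that are constant along edges. These labellings are the indices of the expanded trace, and
  for \<open>n = 2\<close> bijections between them show how the number of components changes when a
  pair of partners is removed. Freeness is verified on alternating products of centred elements,
  without cumulants. The free cumulants of the limit generators would be all \<open>c\<close> for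
  \<open>W\<close> and its full transpose (free Poisson), and \<open>c\<close>, \<open>c\<close>, 0,
  0, ... for the partial transposes (shifted semicircular).\<close>

section \<open>A functional with free generators\<close>

text \<open>
  The stack lists the letters of the blocks that are still open, the innermost one first. The summands
  open a block, add a singleton, continue the innermost block and close it; \<open>q i\<close> is 0 if blocks of
  letter \<open>i\<close> have at most two elements. Each completed block has weight \<open>c\<close>.
\<close>

fun path_weight :: "complex \<Rightarrow> ('i \<Rightarrow> complex) \<Rightarrow> 'i list \<Rightarrow> 'i list \<Rightarrow> complex" where
  "path_weight c q st [] = (if st = [] then 1 else 0)"
| "path_weight c q st (i # w) =
     path_weight c q (i # st) w + c * path_weight c q st w +
     (case st of [] \<Rightarrow> 0
      | j # st' \<Rightarrow> if j = i then q i * path_weight c q st w + c * path_weight c q st' w else 0)"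

text \<open>With the empty stack this is the limit state. The other stacks are needed because
  multiplication by a generator leaves a stack behind for the remaining factors.\<close>

definition path_functional :: "complex \<Rightarrow> ('i \<Rightarrow> complex) \<Rightarrow> 'i list \<Rightarrow> 'i free_algebra \<Rightarrow> complex" where
  "path_functional c q st x =
     (\<Sum>w\<in>Poly_Mapping.keys x. Poly_Mapping.lookup x w * path_weight c q st (letters w))"

lemma path_functional_superset:
  assumes "finite S" "Poly_Mapping.keys x \<subseteq> S"
  shows "path_functional c q st x = (\<Sum>w\<in>S. Poly_Mapping.lookup x w * path_weight c q st (letters w))"
  unfolding path_functional_def using assms by (intro sum.mono_neutral_left) (auto simp: in_keys_iff)

lemma path_functional_add:
  "path_functional c q st (x + y) = path_functional c q st x + path_functional c q st y"
proof -
  let ?S = "Poly_Mapping.keys x \<union> Poly_Mapping.keys y"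
  have 1: "Poly_Mapping.keys (x + y) \<subseteq> ?S" by (rule Poly_Mapping.keys_add)
  show ?thesis
    using path_functional_superset[of ?S "x + y"] path_functional_superset[of ?S x]
      path_functional_superset[of ?S y] 1
    by (simp add: lookup_add distrib_right sum.distrib)
qed

lemma path_functional_single:
  "path_functional c q st (Poly_Mapping.single w a) = a * path_weight c q st (letters w)"
  by (simp add: path_functional_superset[of "{w}"])

lemma path_functional_scale: "path_functional c q st (scale_fa a x) = a * path_functional c q st x"
  by (induction x rule: poly_mapping_induct_single)
    (simp_all add: scale_fa_def mult_single path_functional_single distrib_left path_functional_add)

lemma path_functional_one: "path_functional c q st 1 = (if st = [] then 1 else 0)"
  using path_functional_single[of c q st 0 1] by simp

lemma path_functional_gen_mult:
  "path_functional c q st (gen_fa i * y) =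
     path_functional c q (i # st) y + c * path_functional c q st y +
     (case st of [] \<Rightarrow> 0
      | j # st' \<Rightarrow> if j = i then q i * path_functional c q st y + c * path_functional c q st' y else 0)"
proof (induction y rule: poly_mapping_induct_single)
  case (single w a)
  show ?case
    by (simp add: gen_fa_def mult_single path_functional_single algebra_simps split: list.split)
next
  case (sum f g)
  then show ?case
    by (simp add: distrib_left path_functional_add algebra_simps split: list.split)
qed

text \<open>The algebra laws of \<open>scale_fa\<close> do not involve the state, so they are
  borrowed from a pullback of the trivial space of complex numbers; only the laws of the state are
  specific to the path functional.\<close>

lemma nc_prob_space_path_functional: "nc_prob_space scale_fa (path_functional c q [])"
proof -
  interpret C: nc_prob_space "(*)" "id :: complex \<Rightarrow> complex"
    by unfold_locales (simp_all add: algebra_simps)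
  interpret E: nc_prob_space scale_fa "\<lambda>x. id (eval_fa (*) (\<lambda>_::'a. 0::complex) x)"
    by (rule C.nc_prob_space_eval_fa)
  show ?thesis
    by unfold_locales
      (simp_all add: E.scale_mult_left E.scale_mult_right path_functional_add path_functional_scale
        path_functional_one)
qed

section \<open>The free product action and freeness of the generators\<close>

text \<open>
  The elements of the algebra generated by \<open>X\<^sub>i\<close> only act on the topmost run of letters \<open>i\<close> of the
  stack. This is the free product representation, in a form dual to the action on a Fock space.
\<close>

definition acts_on_top :: "complex \<Rightarrow> ('i \<Rightarrow> complex) \<Rightarrow> 'i \<Rightarrow> 'i free_algebra \<Rightarrow> nat \<Rightarrow> (complex \<times> nat) list \<Rightarrow> bool" where
  "acts_on_top c q i x k L \<longleftrightarrow>
     (\<forall>v y. (v = [] \<or> hd v \<noteq> i) \<longrightarrow>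
        path_functional c q (replicate k i @ v) (x * y) =
        (\<Sum>(a, j)\<leftarrow>L. a * path_functional c q (replicate j i @ v) y))"

lemma acts_on_top_one: "acts_on_top c q i 1 k [(1, k)]"
  by (simp add: acts_on_top_def)

lemma acts_on_top_scale:
  "acts_on_top c q i x k L \<Longrightarrow> acts_on_top c q i (scale_fa b x) k (map (\<lambda>(a, j). (b * a, j)) L)"
proof -
  assume a: "acts_on_top c q i x k L"
  have m: "scale_fa b x * y = scale_fa b (x * y)" for y
    by (simp add: scale_fa_def mult.assoc)
  show ?thesis
    using a by (simp add: acts_on_top_def m path_functional_scale sum_list_const_mult[symmetric]
      o_def case_prod_unfold mult.assoc)
qed

lemma acts_on_top_add:
  "acts_on_top c q i x k L \<Longrightarrow> acts_on_top c q i x' k L' \<Longrightarrow> acts_on_top c q i (x + x') k (L @ L')"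
  by (simp add: acts_on_top_def distrib_right path_functional_add)

lemma acts_on_top_mult:
  assumes "acts_on_top c q i x k L" "\<And>j. acts_on_top c q i x' j (L' j)"
  shows "acts_on_top c q i (x * x') k
    (concat (map (\<lambda>(a, j). map (\<lambda>(b, l). (a * b, l)) (L' j)) L))"
proof -
  have "(\<Sum>(a, j)\<leftarrow>L. a * (\<Sum>(b, l)\<leftarrow>L' j. b * F l)) =
    (\<Sum>(a, j)\<leftarrow>concat (map (\<lambda>(a, j). map (\<lambda>(b, l). (a * b, l)) (L' j)) L). a * F j)"
    for F :: "nat \<Rightarrow> complex"
    by (induction L)
      (auto simp: sum_list_const_mult[symmetric] o_def case_prod_unfold mult.assoc)
  then show ?thesis
    using assms by (simp add: acts_on_top_def mult.assoc)
qed

lemma acts_on_top_gen: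
  "acts_on_top c q i (gen_fa i) k
     ([(1, Suc k), (c, k)] @ (case k of 0 \<Rightarrow> [] | Suc k' \<Rightarrow> [(q i, k), (c, k')]))"
proof (cases k)
  case 0
  then show ?thesis
    by (auto simp: acts_on_top_def path_functional_gen_mult split: list.split)
next
  case (Suc k')
  then show ?thesis
    by (auto simp: acts_on_top_def path_functional_gen_mult)
qed

lemma acts_on_top_hull:
  assumes "x \<in> unital_subalgebra scale_fa hull {gen_fa i}"
  shows "\<exists>L. acts_on_top c q i x k L"
proof -
  \<comment> \<open>All run lengths at once: in a product, the second factor acts on whatever run
    length the first one leaves.\<close>
  have "\<forall>k. \<exists>L. acts_on_top c q i x k L"
    using assms
  proof (rule hull_induct)
    fix x assume "x \<in> {gen_fa i :: 'a free_algebra}"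
    then have "x = gen_fa i" by simp
    then show "\<forall>k. \<exists>L. acts_on_top c q i x k L" using acts_on_top_gen by metis
  next
    show "unital_subalgebra scale_fa {x. \<forall>k. \<exists>L. acts_on_top c q i x k L}"
      unfolding unital_subalgebra_def
    proof (intro conjI ballI allI; clarsimp)
      fix k show "\<exists>L. acts_on_top c q i 1 k L" by (rule exI, rule acts_on_top_one)
    next
      fix x y :: "'a free_algebra" and k
      assume "\<forall>k. \<exists>L. acts_on_top c q i x k L" "\<forall>k. \<exists>L. acts_on_top c q i y k L"
      then show "\<exists>L. acts_on_top c q i (x + y) k L" using acts_on_top_add by metis
    next
      fix x y :: "'a free_algebra" and k
      assume "\<forall>k. \<exists>L. acts_on_top c q i x k L" "\<forall>k. \<exists>L. acts_on_top c q i y k L"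
      then show "\<exists>L. acts_on_top c q i (x * y) k L" using acts_on_top_mult by metis
    next
      fix a and x :: "'a free_algebra" and k
      assume "\<forall>k. \<exists>L. acts_on_top c q i x k L"
      then show "\<exists>L. acts_on_top c q i (scale_fa a x) k L" using acts_on_top_scale by metis
    qed
  qed
  then show ?thesis by blast
qed

text \<open>Freeness in a form that admits induction, with a stack whose top the first factor cannot
  touch. Expand that factor from run length 0. A term with positive run length leaves a letter that
  the next factor cannot touch, or that stays open at the end, and vanishes by induction. The
  coefficients at run length 0 add up to the value of the factor, which is 0.\<close>

lemma path_functional_alternating:
  assumes "list_all2 (\<lambda>i x. x \<in> unital_subalgebra scale_fa hull {gen_fa i} \<and>
      path_functional c q [] x = 0) is xs"
    and "successively (\<noteq>) is" "v = [] \<or> is = [] \<or> hd v \<noteq> hd is" "v \<noteq> [] \<or> is \<noteq> []"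
  shows "path_functional c q v (prod_list xs) = 0"
  using assms
proof (induction "is" xs arbitrary: v rule: list_all2_induct)
  case Nil
  then show ?case by (simp add: path_functional_one)
next
  case (Cons i "is" x xs)
  obtain L where L: "acts_on_top c q i x 0 L"
    using Cons.hyps acts_on_top_hull[of x i c q 0] by auto
  have v: "v = [] \<or> hd v \<noteq> i" using Cons.prems by simp
  have s: "successively (\<noteq>) is" and i: "is = [] \<or> i \<noteq> hd is"
    using Cons.prems(1) by (cases "is"; simp)+
  define y where "y = prod_list xs"
  have pos: "path_functional c q (replicate j i @ v) y = 0" if "j > 0" for j
    unfolding y_def using Cons.IH[OF s, of "replicate j i @ v"] that i by (cases j) auto
  \<comment> \<open>Testing the expansion on the empty stack with \<open>y = 1\<close> isolates the
    coefficients at run length 0.\<close>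
  have centered: "(\<Sum>(a, j)\<leftarrow>L. a * (if j = 0 then 1 else 0)) = (0::complex)"
  proof -
    have "path_functional c q (replicate 0 i @ []) (x * 1) =
        (\<Sum>(a, j)\<leftarrow>L. a * path_functional c q (replicate j i @ []) 1)"
      using L unfolding acts_on_top_def by blast
    moreover have "path_functional c q [] x = 0" using Cons.hyps by simp
    ultimately show ?thesis by (simp add: path_functional_one)
  qed
  have "path_functional c q v (x * y) = (\<Sum>(a, j)\<leftarrow>L. a * path_functional c q (replicate j i @ v) y)"
    using L v unfolding acts_on_top_def by force
  also have "\<dots> = (\<Sum>(a, j)\<leftarrow>L. (a * (if j = 0 then 1 else 0)) * path_functional c q v y)"
    using pos by (intro arg_cong[where f = sum_list] map_cong) auto
  also have "\<dots> = 0"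
    using centered by (simp add: case_prod_unfold sum_list_mult_const)
  finally show ?case by (simp add: y_def)
qed

lemma free_elements_path_functional: "free_elements scale_fa (path_functional c q []) I gen_fa"
  unfolding free_elements_def free_subalgebras_def
  by (auto intro: path_functional_alternating)

lemma prod_list_gen_fa: "prod_list (map gen_fa w) = Poly_Mapping.single (Word w) 1"
proof (induction w)
  case Nil
  show ?case by (simp add: zero_free_monoid_def[symmetric])
next
  case (Cons i w)
  then show ?case by (simp add: gen_fa_def mult_single plus_free_monoid_def)
qed

lemma asymptotically_free_pathI:
  assumes "\<And>w. set w \<subseteq> {..<length Xs} \<Longrightarrow>
        (\<forall>\<^sub>F N in F. integrable (M N)
            (\<lambda>\<omega>. normalized_trace (mat_prod_list (n N) (map (\<lambda>i. (Xs ! i) N \<omega>) w)))) \<and>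
        ((\<lambda>N. \<integral>\<omega>. normalized_trace (mat_prod_list (n N) (map (\<lambda>i. (Xs ! i) N \<omega>) w)) \<partial>(M N))
            \<longlongrightarrow> path_weight c q [] w) F"
  shows "asymptotically_free F M n Xs"
  unfolding asymptotically_free_def
proof (intro exI conjI)
  show "limit_distribution F M n Xs (path_functional c q []) gen_fa"
    unfolding limit_distribution_def prod_list_gen_fa path_functional_single
    using assms by simp
qed (rule nc_prob_space_path_functional free_elements_path_functional)+

section \<open>Components of finite graphs\<close>

definition const_on_edges :: "('v \<times> 'v) set \<Rightarrow> ('v \<Rightarrow> nat) \<Rightarrow> bool" where
  "const_on_edges E f \<longleftrightarrow> (\<forall>(x, y)\<in>E. f x = f y)"

definition edge_funs :: "nat \<Rightarrow> 'v set \<Rightarrow> ('v \<times> 'v) set \<Rightarrow> ('v \<Rightarrow> nat) set" where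
  "edge_funs n V E = {f \<in> V \<rightarrow>\<^sub>E {..<n}. const_on_edges E f}"

definition connected_rel :: "'v set \<Rightarrow> ('v \<times> 'v) set \<Rightarrow> ('v \<times> 'v) set" where
  "connected_rel V E = (E \<union> E\<inverse>)\<^sup>* \<inter> V \<times> V"

definition components :: "'v set \<Rightarrow> ('v \<times> 'v) set \<Rightarrow> nat" where
  "components V E = card (V // connected_rel V E)"

lemma equiv_connected_rel: "equiv V (connected_rel V E)"
proof (rule equivI)
  show "sym (connected_rel V E)"
    unfolding connected_rel_def
    by (intro symI) (auto simp: sym_Un_converse sym_rtrancl[THEN symD])
  show "trans (connected_rel V E)"
    unfolding connected_rel_def by (intro transI) (auto intro: rtrancl_trans)
qed (auto simp: connected_rel_def refl_on_def)

lemma const_on_connected: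
  assumes "const_on_edges E f" "(x, y) \<in> connected_rel V E"
  shows "f x = f y"
proof -
  have "(x, y) \<in> (E \<union> E\<inverse>)\<^sup>*" using assms(2) by (simp add: connected_rel_def)
  then show ?thesis
    by induction (use assms(1) in \<open>auto simp: const_on_edges_def\<close>)
qed

text \<open>A function constant along edges is a free choice of one value per component. With
  general \<open>n\<close> this counts index assignments; with \<open>n = 2\<close> it compares
  numbers of components, since a power of 2 determines its exponent.\<close>

lemma card_edge_funs:
  assumes "finite V" "E \<subseteq> V \<times> V"
  shows "card (edge_funs n V E) = n ^ components V E"
proof -
  let ?R = "connected_rel V E"
  note eq = equiv_connected_rel[of V E]
  let ?to = "\<lambda>g. \<lambda>x\<in>V. g (?R `` {x})"
  let ?from = "\<lambda>f. \<lambda>C\<in>V // ?R. f (SOME x. x \<in> C)"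
  have fin: "finite (V // ?R)"
    using assms(1) finite_quotient[of V ?R] by (auto simp: connected_rel_def)
  have some: "(SOME y. y \<in> ?R `` {x}) \<in> V \<and> (x, SOME y. y \<in> ?R `` {x}) \<in> ?R" if "x \<in> V" for x
  proof -
    have "x \<in> ?R `` {x}" using eq that by (metis equiv_class_self)
    then have "(SOME y. y \<in> ?R `` {x}) \<in> ?R `` {x}" by (rule someI)
    then show ?thesis by (auto simp: connected_rel_def)
  qed
  have "bij_betw ?to (V // ?R \<rightarrow>\<^sub>E {..<n}) (edge_funs n V E)"
  proof (rule bij_betw_byWitness[where f' = ?from])
    show "\<forall>g\<in>V // ?R \<rightarrow>\<^sub>E {..<n}. ?from (?to g) = g"
    proof (intro ballI ext)
      fix g C assume g: "g \<in> V // ?R \<rightarrow>\<^sub>E {..<n}"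
      show "?from (?to g) C = g C"
      proof (cases "C \<in> V // ?R")
        case True
        then obtain x where x: "x \<in> V" "C = ?R `` {x}" by (auto elim: quotientE)
        then have "?R `` {SOME y. y \<in> C} = C"
          using some[of x] eq by (metis equiv_class_eq)
        then show ?thesis using True some[of x] x by simp
      qed (use g in auto)
    qed
    show "\<forall>f\<in>edge_funs n V E. ?to (?from f) = f"
    proof (intro ballI ext)
      fix f x assume f: "f \<in> edge_funs n V E"
      show "?to (?from f) x = f x"
      proof (cases "x \<in> V")
        case True
        then show ?thesis
          using some[OF True] f const_on_connected[of E f x _ V]
          by (auto simp: edge_funs_def quotientI)
      qed (use f in \<open>auto simp: edge_funs_def\<close>)
    qed
    show "?to ` (V // ?R \<rightarrow>\<^sub>E {..<n}) \<subseteq> edge_funs n V E"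
    proof (rule image_subsetI)
      fix g assume g: "g \<in> V // ?R \<rightarrow>\<^sub>E {..<n}"
      have "g (?R `` {x}) = g (?R `` {y}) \<and> x \<in> V \<and> y \<in> V" if "(x, y) \<in> E" for x y
      proof -
        have "(x, y) \<in> ?R" using that assms(2) by (auto simp: connected_rel_def)
        then have "?R `` {x} = ?R `` {y}" using eq by (metis equiv_class_eq)
        then show ?thesis using that assms(2) by auto
      qed
      then show "?to g \<in> edge_funs n V E"
        using PiE_mem[OF g quotientI[of _ V ?R]]
        by (auto simp: edge_funs_def const_on_edges_def PiE_iff)
    qed
    show "?from ` edge_funs n V E \<subseteq> V // ?R \<rightarrow>\<^sub>E {..<n}"
    proof (clarsimp simp: edge_funs_def)
      fix f C assume f: "f \<in> V \<rightarrow>\<^sub>E {..<n}" and C: "C \<in> V // ?R"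
      obtain x where "x \<in> V" "C = ?R `` {x}" using C by (auto elim: quotientE)
      then show "f (SOME x. x \<in> C) < n" using some[of x] f by (auto simp: PiE_iff)
    qed
  qed
  then have "card (edge_funs n V E) = card (V // ?R \<rightarrow>\<^sub>E {..<n})"
    by (simp add: bij_betw_same_card)
  also have "\<dots> = n ^ components V E"
    by (simp add: card_PiE fin components_def)
  finally show ?thesis .
qed

lemma const_on_edges_agree:
  assumes "E \<subseteq> V \<times> V" "\<And>x. x \<in> V \<Longrightarrow> f x = g x"
  shows "const_on_edges E f \<longleftrightarrow> const_on_edges E g"
  unfolding const_on_edges_def using assms by (intro ball_cong) auto

text \<open>The value at the new vertex is forced to be that at \<open>u\<close>, so labellings
  extend uniquely. Edge sets enter only through the functions constant on them, which allows edges
  to be contracted without any reasoning on paths.\<close>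

lemma components_leaf:
  assumes "finite V" "E' \<subseteq> V \<times> V" "E \<subseteq> insert x V \<times> insert x V" "x \<notin> V" "u \<in> V"
    and "\<And>f. const_on_edges E f \<longleftrightarrow> f x = f u \<and> const_on_edges E' f"
  shows "components (insert x V) E = components V E'"
proof -
  have upd: "const_on_edges E' (f(x := a)) \<longleftrightarrow> const_on_edges E' f" for f and a :: nat
    using assms(4) by (intro const_on_edges_agree[OF assms(2)]) auto
  have res: "const_on_edges E' (restrict f V) \<longleftrightarrow> const_on_edges E' f" for f :: "'a \<Rightarrow> nat"
    using assms(4) by (intro const_on_edges_agree[OF assms(2)]) auto
  have "bij_betw (\<lambda>f. restrict f V) (edge_funs 2 (insert x V) E) (edge_funs 2 V E')"
  proof (rule bij_betw_byWitness[where f' = "\<lambda>f. f(x := f u)"])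
    show "\<forall>f\<in>edge_funs 2 (insert x V) E. (restrict f V)(x := restrict f V u) = f"
      using assms(4-6) by (auto simp: edge_funs_def fun_eq_iff PiE_iff extensional_def)
    show "\<forall>f\<in>edge_funs 2 V E'. restrict (f(x := f u)) V = f"
      using assms(4,5) by (auto simp: edge_funs_def fun_eq_iff PiE_iff extensional_def)
    show "(\<lambda>f. restrict f V) ` edge_funs 2 (insert x V) E \<subseteq> edge_funs 2 V E'"
      using assms(6) by (auto simp: edge_funs_def PiE_iff res)
    show "(\<lambda>f. f(x := f u)) ` edge_funs 2 V E' \<subseteq> edge_funs 2 (insert x V) E"
      using assms(4-6) by (auto simp: edge_funs_def PiE_iff upd extensional_def)
  qed
  then have "(2::nat) ^ components (insert x V) E = 2 ^ components V E'"
    using card_edge_funs[of "insert x V" E 2] card_edge_funs[of V E' 2] assms(1-3)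
      bij_betw_same_card by (metis finite_insert)
  then show ?thesis by simp
qed

text \<open>The value at the new vertex is free, which doubles the number of two-valued
  labellings.\<close>

lemma components_isolated:
  assumes "finite V" "E \<subseteq> V \<times> V" "x \<notin> V"
  shows "components (insert x V) E = Suc (components V E)"
proof -
  have upd: "const_on_edges E (f(x := a)) \<longleftrightarrow> const_on_edges E f" for f and a :: nat
    using assms(3) by (intro const_on_edges_agree[OF assms(2)]) auto
  have "bij_betw (\<lambda>(a, f). f(x := a)) ({..<2} \<times> edge_funs 2 V E) (edge_funs 2 (insert x V) E)"
  proof (rule bij_betw_byWitness[where f' = "\<lambda>f. (f x, f(x := undefined))"])
    show "\<forall>af\<in>{..<2} \<times> edge_funs 2 V E.
        ((case af of (a, f) \<Rightarrow> f(x := a)) x, (case af of (a, f) \<Rightarrow> f(x := a))(x := undefined)) = af"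
      using assms(3) by (auto simp: edge_funs_def fun_eq_iff PiE_iff extensional_def)
    show "(\<lambda>(a, f). f(x := a)) ` ({..<2} \<times> edge_funs 2 V E) \<subseteq> edge_funs 2 (insert x V) E"
      using assms(3) by (auto simp: edge_funs_def PiE_iff extensional_def upd)
    show "(\<lambda>f. (f x, f(x := undefined))) ` edge_funs 2 (insert x V) E \<subseteq> {..<2} \<times> edge_funs 2 V E"
      using assms(3) by (auto simp: edge_funs_def PiE_iff extensional_def upd)
  qed auto
  then have "card (edge_funs 2 (insert x V) E) = 2 * card (edge_funs 2 V E)"
    by (auto dest!: bij_betw_same_card simp: card_cartesian_product)
  moreover have "E \<subseteq> insert x V \<times> insert x V" using assms(2) by auto
  ultimately have "(2::nat) ^ components (insert x V) E = 2 ^ Suc (components V E)"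
    using card_edge_funs[of "insert x V" E 2] card_edge_funs[of V E 2] assms by simp
  then show ?thesis using power_inject_exp[of "2::nat"] by (metis one_less_numeral_iff semiring_norm(76))
qed

lemma components_cong:
  assumes "finite V" "E \<subseteq> V \<times> V" "E' \<subseteq> V \<times> V"
    and "\<And>f. const_on_edges E f \<longleftrightarrow> const_on_edges E' f"
  shows "components V E = components V E'"
proof -
  have "edge_funs 2 V E = edge_funs 2 V E'" by (simp add: edge_funs_def assms(4))
  then have "(2::nat) ^ components V E = 2 ^ components V E'"
    using card_edge_funs[of V E 2] card_edge_funs[of V E' 2] assms(1-3) by simp
  then show ?thesis by simp
qed

text \<open>Sum the sizes of the classes. The exceptional class \<open>C0\<close> may be one vertex
  short; it is allowed not to be a class at all, so that the bound also covers graphs without a cut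
  vertex.\<close>

lemma components_bound:
  assumes fin: "finite V"
    and four: "\<And>C. C \<in> V // connected_rel V E \<Longrightarrow> C \<noteq> C0 \<Longrightarrow> 4 \<le> card C"
    and three: "C0 \<in> V // connected_rel V E \<Longrightarrow> 3 \<le> card C0"
  shows "4 * components V E \<le> card V + 1"
proof -
  let ?Q = "V // connected_rel V E"
  have eq: "equiv V (connected_rel V E)" by (rule equiv_connected_rel)
  have finQ: "finite ?Q"
    using fin finite_quotient[of V "connected_rel V E"] by (auto simp: connected_rel_def)
  have C: "finite C" if "C \<in> ?Q" for C
    using that fin Union_quotient[OF eq] by (metis Union_upper finite_subset)
  have "card V = card (\<Union>?Q)" by (simp add: Union_quotient[OF eq])
  also have "\<dots> = (\<Sum>C\<in>?Q. card C)"
    using C quotient_disj[OF eq] by (intro card_Union_disjoint) (auto simp: pairwise_def disjnt_def)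
  finally have V: "card V = (\<Sum>C\<in>?Q. card C)" .
  have "4 * card ?Q = (\<Sum>C\<in>?Q. 4)" by simp
  also have "\<dots> \<le> (\<Sum>C\<in>?Q. card C + (if C = C0 then 1 else 0))"
  proof (rule sum_mono)
    fix C assume "C \<in> ?Q"
    then show "4 \<le> card C + (if C = C0 then 1 else 0)" using four[of C] three by auto
  qed
  also have "\<dots> = card V + (if C0 \<in> ?Q then 1 else 0)"
    using finQ by (simp add: V sum.distrib)
  finally show ?thesis by (simp add: components_def split: if_splits)
qed

section \<open>Pairings\<close>

text \<open>Extending the involution by the identity makes it a permutation of \<open>V\<close>, so
  that finite sets have finitely many pairings, and makes the pairing left after removing two
  partners a unique function.\<close>

definition pairings :: "'v set \<Rightarrow> ('v \<Rightarrow> 'v) set" where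
  "pairings V = {\<pi>. (\<forall>x\<in>V. \<pi> x \<in> V \<and> \<pi> x \<noteq> x \<and> \<pi> (\<pi> x) = x) \<and> (\<forall>x. x \<notin> V \<longrightarrow> \<pi> x = x)}"

definition unpair :: "'v \<Rightarrow> 'v \<Rightarrow> ('v \<Rightarrow> 'v) \<Rightarrow> 'v \<Rightarrow> 'v" where
  "unpair x y \<pi> = \<pi>(x := x, y := y)"

lemma pairingsD:
  assumes "\<pi> \<in> pairings V"
  shows "x \<in> V \<Longrightarrow> \<pi> x \<in> V" "x \<in> V \<Longrightarrow> \<pi> x \<noteq> x" "\<pi> (\<pi> x) = x" "x \<notin> V \<Longrightarrow> \<pi> x = x"
proof -
  show "x \<in> V \<Longrightarrow> \<pi> x \<in> V" "x \<in> V \<Longrightarrow> \<pi> x \<noteq> x" "x \<notin> V \<Longrightarrow> \<pi> x = x"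
    using assms by (auto simp: pairings_def)
  show "\<pi> (\<pi> x) = x" using assms by (cases "x \<in> V") (auto simp: pairings_def)
qed

lemma pairings_empty [simp]: "pairings {} = {id}"
  by (auto simp: pairings_def)

lemma finite_pairings:
  assumes "finite V"
  shows "finite (pairings V)"
proof (rule finite_subset)
  show "pairings V \<subseteq> {\<pi>. \<pi> permutes V}"
  proof
    fix \<pi> assume "\<pi> \<in> pairings V"
    note p = pairingsD(3,4)[OF this]
    have "bij \<pi>" using p(1) by (intro o_bij[of \<pi> \<pi>]) auto
    then show "\<pi> \<in> {\<pi>. \<pi> permutes V}" using p(2) by (auto simp: permutes_def bij_iff)
  qed
qed (rule finite_permutations[OF assms])

lemma unpair_in_pairings:
  assumes "\<pi> \<in> pairings V" "\<pi> x = y"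
  shows "unpair x y \<pi> \<in> pairings (V - {x, y})"
proof -
  note p = pairingsD[OF assms(1)]
  have avoid: "\<pi> w \<noteq> x \<and> \<pi> w \<noteq> y" if "w \<noteq> x" "w \<noteq> y" for w
    using p(3)[of w] p(3)[of x] assms(2) that by auto
  show ?thesis
    unfolding pairings_def
  proof (intro CollectI conjI ballI allI impI)
    fix w assume "w \<in> V - {x, y}"
    then have w: "w \<in> V" "w \<noteq> x" "w \<noteq> y" by auto
    then show "unpair x y \<pi> w \<in> V - {x, y}" "unpair x y \<pi> w \<noteq> w"
      "unpair x y \<pi> (unpair x y \<pi> w) = w"
      using avoid[OF w(2,3)] p(1,2)[OF w(1)] p(3)[of w] by (simp_all add: unpair_def)
  next
    fix w assume "w \<notin> V - {x, y}"
    then show "unpair x y \<pi> w = w" using p(4)[of w] by (auto simp: unpair_def)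
  qed
qed

lemma unpair_apply [simp]: "z \<noteq> x \<Longrightarrow> z \<noteq> y \<Longrightarrow> unpair x y \<pi> z = \<pi> z"
  by (simp add: unpair_def)

lemma bij_betw_unpair:
  assumes "x \<in> V" "y \<in> V" "x \<noteq> y"
  shows "bij_betw (unpair x y) {\<pi> \<in> pairings V. \<pi> x = y} (pairings (V - {x, y}))"
proof (rule bij_betw_byWitness[where f' = "\<lambda>\<tau>. \<tau>(x := y, y := x)"])
  show "\<forall>\<pi>\<in>{\<pi> \<in> pairings V. \<pi> x = y}. (unpair x y \<pi>)(x := y, y := x) = \<pi>"
  proof clarify
    fix \<pi> assume "\<pi> \<in> pairings V" "y = \<pi> x"
    then show "(unpair x (\<pi> x) \<pi>)(x := \<pi> x, \<pi> x := x) = \<pi>"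
      using pairingsD(3)[of \<pi> V x] by (simp add: unpair_def fun_eq_iff)
  qed
  show "\<forall>\<tau>\<in>pairings (V - {x, y}). unpair x y (\<tau>(x := y, y := x)) = \<tau>"
  proof
    fix \<tau> assume "\<tau> \<in> pairings (V - {x, y})"
    then show "unpair x y (\<tau>(x := y, y := x)) = \<tau>"
      using pairingsD(4)[of \<tau> "V - {x, y}" x] pairingsD(4)[of \<tau> "V - {x, y}" y]
      by (simp add: unpair_def fun_eq_iff)
  qed
  show "unpair x y ` {\<pi> \<in> pairings V. \<pi> x = y} \<subseteq> pairings (V - {x, y})"
    by (auto intro: unpair_in_pairings)
  show "(\<lambda>\<tau>. \<tau>(x := y, y := x)) ` pairings (V - {x, y}) \<subseteq> {\<pi> \<in> pairings V. \<pi> x = y}"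
  proof (rule image_subsetI, intro CollectI conjI)
    fix \<tau> assume "\<tau> \<in> pairings (V - {x, y})"
    note p = pairingsD[OF this]
    let ?s = "\<tau>(x := y, y := x)"
    have avoid: "\<tau> w \<noteq> x \<and> \<tau> w \<noteq> y" if "w \<noteq> x" "w \<noteq> y" for w
      using p(3)[of w] p(4)[of x] p(4)[of y] that by auto
    have "?s w \<in> V \<and> ?s w \<noteq> w \<and> ?s (?s w) = w" if "w \<in> V" for w
    proof (cases "w = x \<or> w = y")
      case False
      then show ?thesis using avoid[of w] p(1,2)[of w] p(3)[of w] that by simp
    qed (use assms in auto)
    moreover have "?s w = w" if "w \<notin> V" for w
      using that assms p(4)[of w] by auto
    ultimately show "?s \<in> pairings V" by (simp add: pairings_def)
    show "?s x = y" using assms by simp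
  qed
qed

lemma even_card_pairings:
  assumes "finite V" "\<pi> \<in> pairings V"
  shows "even (card V)"
  using assms
proof (induction "card V" arbitrary: V \<pi> rule: less_induct)
  case less
  show ?case
  proof (cases "V = {}")
    case False
    then obtain x where x: "x \<in> V" by blast
    note p = pairingsD[OF less.prems(2), of x]
    have c: "card V = card (V - {x, \<pi> x}) + 2"
      using card_Diff_subset[of "{x, \<pi> x}" V] card_mono[of V "{x, \<pi> x}"] x p less.prems(1) by auto
    have "even (card (V - {x, \<pi> x}))"
      by (rule less.hyps[OF _ _ unpair_in_pairings[OF less.prems(2) refl]]) (use c less.prems(1) in auto)
    then show ?thesis using c by simp
  qed simp
qed

section \<open>Noncrossing pairings and the greedy reduction\<close>

text \<open>
  A greedy reduction: two partners cancel as soon as they are adjacent, and the stack holds the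
  points that were read but not cancelled. It succeeds if and only if the pairing has no crossing.
\<close>

fun noncrossing :: "('v \<Rightarrow> 'v) \<Rightarrow> 'v list \<Rightarrow> 'v list \<Rightarrow> bool" where
  "noncrossing \<pi> st [] \<longleftrightarrow> st = []"
| "noncrossing \<pi> [] (x # xs) \<longleftrightarrow> noncrossing \<pi> [x] xs"
| "noncrossing \<pi> (t # ts) (x # xs) \<longleftrightarrow>
     (if \<pi> t = x then noncrossing \<pi> ts xs else noncrossing \<pi> (x # t # ts) xs)"

lemma noncrossing_cong:
  assumes "\<And>x. x \<in> set st \<union> set xs \<Longrightarrow> \<pi> x = \<tau> x"
  shows "noncrossing \<pi> st xs \<longleftrightarrow> noncrossing \<tau> st xs"
  using assms by (induction \<pi> st xs rule: noncrossing.induct) auto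

text \<open>A point leaves the stack only when its partner is read, and at the end the stack is
  empty.\<close>

lemma noncrossing_partner:
  assumes "noncrossing \<pi> st xs" "y \<in> set st"
  shows "\<pi> y \<in> set xs"
  using assms by (induction \<pi> st xs rule: noncrossing.induct) (auto split: if_splits)

lemma noncrossing_push:
  assumes "\<And>x. \<pi> (\<pi> x) = x" "\<pi> x \<notin> set st"
  shows "noncrossing \<pi> st (x # xs) \<longleftrightarrow> noncrossing \<pi> (x # st) xs"
  using assms(2) assms(1)[of "hd st"] by (cases st) auto

text \<open>If the partner of \<open>x\<close> were on the stack but not on top, then
  \<open>x\<close> would be pushed and its partner would have to occur in the remaining input,
  against distinctness.\<close>

lemma noncrossing_pop:
  assumes "\<And>x. \<pi> (\<pi> x) = x" "\<pi> x \<in> set st" "distinct (st @ xs)" "noncrossing \<pi> st (x # xs)"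
  shows "st = \<pi> x # tl st \<and> noncrossing \<pi> (tl st) xs"
proof -
  obtain t ts where st: "st = t # ts" using assms(2) by (cases st) auto
  show ?thesis
  proof (cases "\<pi> t = x")
    case True
    then show ?thesis using assms(1)[of t] assms(4) st by auto
  next
    case False
    then have "noncrossing \<pi> (x # st) xs" using assms(4) st by simp
    then have "\<pi> x \<in> set xs" by (rule noncrossing_partner) simp
    then show ?thesis using assms(2,3) by auto
  qed
qed

text \<open>The edges start at even positions. A vertex put in front shifts the parity, so the same
  function yields the edges inside the letters and, for the list cut open at a new vertex, those
  between consecutive letters.\<close>

fun alt_edges :: "'v list \<Rightarrow> ('v \<times> 'v) set" where
  "alt_edges (x # y # zs) = insert (x, y) (alt_edges zs)"
| "alt_edges _ = {}"

lemma alt_edges_append: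
  "even (length as) \<Longrightarrow> alt_edges (as @ bs) = alt_edges as \<union> alt_edges bs"
  by (induction as rule: alt_edges.induct) auto

lemma alt_edges_subset: "alt_edges zs \<subseteq> set zs \<times> set zs"
  by (induction zs rule: alt_edges.induct) auto

lemma alt_edges_nth:
  "even i \<Longrightarrow> Suc i < length zs \<Longrightarrow> (zs ! i, zs ! Suc i) \<in> alt_edges zs"
proof (induction zs arbitrary: i rule: alt_edges.induct)
  case (1 x y zs)
  then show ?case by (cases i rule: nat.exhaust; cases "i - 1") auto
qed auto

lemma const_on_edges_Un:
  "const_on_edges (A \<union> B) f \<longleftrightarrow> const_on_edges A f \<and> const_on_edges B f"
  by (auto simp: const_on_edges_def)

lemma const_on_edges_insert:
  "const_on_edges (insert (x, y) B) f \<longleftrightarrow> f x = f y \<and> const_on_edges B f"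
  by (auto simp: const_on_edges_def)

definition graph_of :: "('v \<Rightarrow> 'v) \<Rightarrow> 'v set \<Rightarrow> ('v \<times> 'v) set" where
  "graph_of \<pi> V = (\<lambda>x. (x, \<pi> x)) ` V"

lemma const_on_graph_of: "const_on_edges (graph_of \<pi> V) f \<longleftrightarrow> (\<forall>x\<in>V. f x = f (\<pi> x))"
  by (auto simp: const_on_edges_def graph_of_def)

lemma const_on_graph_of_unpair:
  assumes "\<pi> \<in> pairings V" "x \<in> V" "\<pi> x = y"
  shows "const_on_edges (graph_of \<pi> V) f \<longleftrightarrow>
    f x = f y \<and> const_on_edges (graph_of (unpair x y \<pi>) (V - {x, y})) f"
proof -
  have "y \<in> V" "\<pi> y = x" using pairingsD(1,3)[OF assms(1), of x] assms(2,3) by auto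
  then show ?thesis using assms by (auto simp: const_on_graph_of)
qed

lemma graph_of_subset: "\<pi> \<in> pairings V \<Longrightarrow> graph_of \<pi> V \<subseteq> V \<times> V"
  by (auto simp: graph_of_def pairingsD)

lemma edges_subset:
  assumes "set zs \<subseteq> U" "V \<subseteq> U" "\<pi> \<in> pairings V"
  shows "alt_edges zs \<union> graph_of \<pi> V \<subseteq> U \<times> U"
proof -
  have "set zs \<times> set zs \<subseteq> U \<times> U" "V \<times> V \<subseteq> U \<times> U" using assms by (simp_all add: Sigma_mono)
  then show ?thesis
    using alt_edges_subset[of zs] graph_of_subset[OF assms(3)] by (meson Un_least subset_trans)
qed

text \<open>At an even offset the adjacent partners are joined to each other by both kinds of edges
  and to nothing else, so they are a whole component. \<open>W\<close> may contain further vertices,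
  such as the cut vertex.\<close>

lemma components_unpair_even:
  assumes "finite W" "set as \<union> set bs \<subseteq> W" "V - {t, x} \<subseteq> W" "t \<notin> W" "x \<notin> W"
    and "\<pi> \<in> pairings V" "t \<in> V" "\<pi> t = x" "even (length as)"
  shows "components (insert t (insert x W)) (alt_edges (as @ t # x # bs) \<union> graph_of \<pi> V) =
    Suc (components W (alt_edges (as @ bs) \<union> graph_of (unpair t x \<pi>) (V - {t, x})))"
    (is "components _ ?E = Suc (components W ?E')")
proof -
  have V: "x \<in> V" "t \<noteq> x" using pairingsD(1,2)[OF assms(6,7)] assms(8) by auto
  have "V \<subseteq> insert t (insert x W)" using assms by auto
  then have E: "?E \<subseteq> insert t (insert x W) \<times> insert t (insert x W)"
    using assms(2,6) by (intro edges_subset) auto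
  have E': "?E' \<subseteq> W \<times> W"
    using assms(2,3) unpair_in_pairings[OF assms(6,8)] by (intro edges_subset) auto
  have "const_on_edges ?E f \<longleftrightarrow> f t = f x \<and> const_on_edges ?E' f" for f
    using assms(9) const_on_graph_of_unpair[OF assms(6-8), of f]
    by (auto simp: alt_edges_append const_on_edges_Un const_on_edges_insert)
  then have "components (insert t (insert x W)) ?E = components (insert x W) ?E'"
    using E E' assms V by (intro components_leaf[where u = x]) auto
  also have "\<dots> = Suc (components W ?E')"
    using E' assms by (intro components_isolated) auto
  finally show ?thesis .
qed

text \<open>At an odd offset \<open>t\<close> and \<open>x\<close> are the interior of a path from
  the last point of \<open>as\<close> to the first point of \<open>bs\<close>. Their removal
  contracts this path to the edge that \<open>as @ bs\<close> has there.\<close>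

lemma components_unpair_odd:
  assumes "finite W" "set as \<union> set bs \<subseteq> W" "V - {t, x} \<subseteq> W" "t \<notin> W" "x \<notin> W"
    and "\<pi> \<in> pairings V" "t \<in> V" "\<pi> t = x" "odd (length as)" "bs \<noteq> []"
  shows "components (insert t (insert x W)) (alt_edges (as @ t # x # bs) \<union> graph_of \<pi> V) =
    components W (alt_edges (as @ bs) \<union> graph_of (unpair t x \<pi>) (V - {t, x}))"
    (is "components _ ?E = components W ?E'")
proof -
  have V: "x \<in> V" "t \<noteq> x" using pairingsD(1,2)[OF assms(6,7)] assms(8) by auto
  have "as \<noteq> []" using assms(9) by auto
  then obtain as' u where as: "as = as' @ [u]" by (metis rev_exhaust)
  obtain v bs' where bs: "bs = v # bs'" using assms(10) by (cases bs) auto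
  have "V \<subseteq> insert t (insert x W)" using assms by auto
  then have E: "?E \<subseteq> insert t (insert x W) \<times> insert t (insert x W)"
    using assms(2,6) by (intro edges_subset) auto
  have E': "?E' \<subseteq> W \<times> W"
    using assms(2,3) unpair_in_pairings[OF assms(6,8)] by (intro edges_subset) auto
  \<comment> \<open>The intermediate graph: \<open>t\<close> is removed as a leaf at
    \<open>x\<close>, after which \<open>x\<close> is a leaf at \<open>u\<close>.\<close>
  let ?E1 = "insert (x, u) ?E'"
  have c: "const_on_edges ?E f \<longleftrightarrow> f t = f x \<and> const_on_edges ?E1 f" for f
    using assms(9) const_on_graph_of_unpair[OF assms(6-8), of f]
    by (auto simp: as bs alt_edges_append const_on_edges_Un const_on_edges_insert)
  have u: "u \<in> W" using assms(2) as by simp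
  have "components (insert t (insert x W)) ?E = components (insert x W) ?E1"
    using E E' assms V u c by (intro components_leaf[where u = x]) auto
  also have "\<dots> = components W ?E'"
    using E' assms u by (intro components_leaf[where u = u]) (auto simp: const_on_edges_insert)
  finally show ?thesis .
qed

section \<open>Planarity and the Euler bound\<close>

text \<open>
  The additional vertex \<open>z\<close> marks the place where the circle is cut open. It makes the empty circle
  have one face, in accordance with the trace of the empty word.
\<close>

definition face_count :: "'v \<Rightarrow> 'v list \<Rightarrow> ('v \<Rightarrow> 'v) \<Rightarrow> nat" where
  "face_count z zs \<pi> =
     components (insert z (set zs)) (alt_edges (z # zs @ [z]) \<union> graph_of \<pi> (set zs))"

text \<open>For the points of a word these alternating edges stay inside the letters, so the
  components are the free summation indices of the matrix products
  \<open>G\<^sub>i G\<^sub>j*\<close>, with \<open>p\<close> values each.\<close>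

definition block_count :: "'v list \<Rightarrow> ('v \<Rightarrow> 'v) \<Rightarrow> nat" where
  "block_count zs \<pi> = components (set zs) (alt_edges zs \<union> graph_of \<pi> (set zs))"

lemma block_count_unpair_even:
  assumes "distinct (as @ t # x # bs)" "\<pi> \<in> pairings (set (as @ t # x # bs))" "\<pi> t = x" "even (length as)"
  shows "block_count (as @ t # x # bs) \<pi> = Suc (block_count (as @ bs) (unpair t x \<pi>))"
proof -
  define V where "V = set (as @ t # x # bs)"
  define W where "W = set (as @ bs)"
  note VW = V_def W_def
  have ins: "V = insert t (insert x W)" and diff: "V - {t, x} = W"
    using assms(1) by (auto simp: VW)
  have nin: "t \<notin> W" "x \<notin> W" "t \<in> V" "finite W" "V - {t, x} \<subseteq> W" "set as \<union> set bs \<subseteq> W"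
    using assms(1) by (auto simp: VW)
  have "components (insert t (insert x W)) (alt_edges (as @ t # x # bs) \<union> graph_of \<pi> V) =
      Suc (components W (alt_edges (as @ bs) \<union> graph_of (unpair t x \<pi>) (V - {t, x})))"
    using assms(2,3,4) nin by (intro components_unpair_even) (simp_all add: V_def)
  then show ?thesis
    unfolding block_count_def V_def[symmetric] W_def[symmetric] ins(1)[symmetric] diff .
qed

lemma block_count_unpair_odd:
  assumes "distinct (as @ t # x # bs)" "\<pi> \<in> pairings (set (as @ t # x # bs))" "\<pi> t = x" "odd (length as)"
    and "bs \<noteq> []"
  shows "block_count (as @ t # x # bs) \<pi> = block_count (as @ bs) (unpair t x \<pi>)"
proof -
  define V where "V = set (as @ t # x # bs)"
  define W where "W = set (as @ bs)"
  note VW = V_def W_def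
  have ins: "V = insert t (insert x W)" and diff: "V - {t, x} = W"
    using assms(1) by (auto simp: VW)
  have nin: "t \<notin> W" "x \<notin> W" "t \<in> V" "finite W" "V - {t, x} \<subseteq> W" "set as \<union> set bs \<subseteq> W"
    using assms(1) by (auto simp: VW)
  have "components (insert t (insert x W)) (alt_edges (as @ t # x # bs) \<union> graph_of \<pi> V) =
      components W (alt_edges (as @ bs) \<union> graph_of (unpair t x \<pi>) (V - {t, x}))"
    using assms(2-5) nin by (intro components_unpair_odd) (simp_all add: V_def)
  then show ?thesis
    unfolding block_count_def V_def[symmetric] W_def[symmetric] ins(1)[symmetric] diff .
qed

text \<open>The cut vertex shifts positions by one, so adjacent partners sit at an even offset in
  exactly one of the two graphs. That graph loses a component and the other one only contracts a
  path.\<close>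

lemma face_block_count_unpair:
  assumes "distinct (as @ t # x # bs)" "z \<notin> set (as @ t # x # bs)"
    and "\<pi> \<in> pairings (set (as @ t # x # bs))" "\<pi> t = x"
  shows "face_count z (as @ t # x # bs) \<pi> + block_count (as @ t # x # bs) \<pi> =
    Suc (face_count z (as @ bs) (unpair t x \<pi>) + block_count (as @ bs) (unpair t x \<pi>))"
proof -
  define V where "V = set (as @ t # x # bs)"
  define W where "W = set (as @ bs)"
  note VW = V_def W_def
  have ins: "V = insert t (insert x W)" "insert z V = insert t (insert x (insert z W))" and diff: "V - {t, x} = W"
    using assms(1) by (auto simp: VW)
  have \<pi>: "\<pi> \<in> pairings V" and z: "z \<notin> V" using assms(2,3) by (simp_all add: V_def)
  have nin: "t \<notin> W" "x \<notin> W" "t \<noteq> z" "x \<noteq> z" "t \<in> V" "finite W" "V - {t, x} \<subseteq> W"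
    "set as \<union> set bs \<subseteq> W"
    using assms(1) z by (auto simp: VW)
  \<comment> \<open>A paired set has even size, so a pair at an odd offset cannot stand at the end
    of the list.\<close>
  have len: "even (length as + length bs)"
    using even_card_pairings[OF _ assms(3)] distinct_card[OF assms(1)] by simp
  have face: "face_count z (as @ t # x # bs) \<pi> = components (insert t (insert x (insert z W))) (alt_edges ((z # as) @ t # x # (bs @ [z])) \<union> graph_of \<pi> V)"
    "face_count z (as @ bs) (unpair t x \<pi>) = components (insert z W) (alt_edges ((z # as) @ (bs @ [z])) \<union> graph_of (unpair t x \<pi>) (V - {t, x}))"
    unfolding face_count_def V_def[symmetric] W_def[symmetric] ins(2)[symmetric] diff by simp_all
  show ?thesis
  proof (cases "even (length as)")
    case True
    have "block_count (as @ t # x # bs) \<pi> = Suc (block_count (as @ bs) (unpair t x \<pi>))"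
      by (rule block_count_unpair_even[OF assms(1,3,4) True])
    moreover have "components (insert t (insert x (insert z W))) (alt_edges ((z # as) @ t # x # (bs @ [z])) \<union> graph_of \<pi> V) =
        components (insert z W) (alt_edges ((z # as) @ (bs @ [z])) \<union> graph_of (unpair t x \<pi>) (V - {t, x}))"
      using True nin by (intro components_unpair_odd \<pi> assms(4)) auto
    ultimately show ?thesis by (simp only: face)
  next
    case False
    then have "bs \<noteq> []" using len by auto
    then have "block_count (as @ t # x # bs) \<pi> = block_count (as @ bs) (unpair t x \<pi>)"
      by (rule block_count_unpair_odd[OF assms(1,3,4) False])
    moreover have "components (insert t (insert x (insert z W))) (alt_edges ((z # as) @ t # x # (bs @ [z])) \<union> graph_of \<pi> V) =
        Suc (components (insert z W) (alt_edges ((z # as) @ (bs @ [z])) \<union> graph_of (unpair t x \<pi>) (V - {t, x})))"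
      using False nin by (intro components_unpair_even \<pi> assms(4)) auto
    ultimately show ?thesis by (simp only: face)
  qed
qed

text \<open>A component that avoids \<open>z\<close> contains a point, its partner and the
  alternating neighbours of both, and these four are distinct when no adjacent points are partners.
  Injectivity is only required away from \<open>z\<close>, because the cut list has \<open>z\<close>
  at both ends.\<close>

lemma reduced_class:
  fixes ys :: "'v list"
  assumes "even (length ys)" "\<pi> \<in> pairings V" "z \<notin> V"
    and "V \<subseteq> set ys" "set ys \<subseteq> W" "W \<subseteq> insert z V"
    and inj: "\<And>i j. i < length ys \<Longrightarrow> j < length ys \<Longrightarrow> ys ! i = ys ! j \<Longrightarrow> ys ! i \<noteq> z \<Longrightarrow> i = j"
    and red: "\<And>i. Suc i < length ys \<Longrightarrow> \<pi> (ys ! i) \<noteq> ys ! Suc i"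
    and C: "C \<in> W // connected_rel W (alt_edges ys \<union> graph_of \<pi> V)" "z \<notin> C" "finite C"
  shows "4 \<le> card C"
proof -
  let ?E = "alt_edges ys \<union> graph_of \<pi> V"
  let ?R = "connected_rel W ?E"
  obtain x where x: "x \<in> W" "C = ?R `` {x}" using C(1) by (rule quotientE)
  have step: "y' \<in> C" if "y \<in> C" "y' \<in> W" "(y, y') \<in> ?E \<or> (y', y) \<in> ?E" for y y'
  proof -
    have "(x, y) \<in> (?E \<union> ?E\<inverse>)\<^sup>*" using that(1) x by (simp add: connected_rel_def)
    moreover have "(y, y') \<in> ?E \<union> ?E\<inverse>" using that(3) by blast
    ultimately have "(x, y') \<in> (?E \<union> ?E\<inverse>)\<^sup>*" by (rule rtrancl_into_rtrancl)
    then show ?thesis using x that(2) by (simp add: connected_rel_def)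
  qed
  have xC: "x \<in> C" using x by (simp add: connected_rel_def)
  then have xV: "x \<in> V" using C(2) x(1) assms(6) by blast
  note p = pairingsD[OF assms(2)]
  obtain j where j: "j < length ys" "ys ! j = x" using xV assms(4) by (metis in_set_conv_nth subsetD)
  obtain k where k: "k < length ys" "ys ! k = \<pi> x" using p(1)[OF xV] assms(4) by (metis in_set_conv_nth subsetD)
  \<comment> \<open>The position at the other end of the alternating edge.\<close>
  define nb where "nb i = (if even i then Suc i else i - 1)" for i :: nat
  have nb: "nb i < length ys" "nb i \<noteq> i" "nb (nb i) = i" if "i < length ys" for i
    using that assms(1) by (auto simp: nb_def elim!: evenE oddE)
  have nb_edge: "ys ! nb i \<in> C" if "i < length ys" "ys ! i \<in> C" for i
  proof (rule step[OF that(2)])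
    show "ys ! nb i \<in> W" using nb(1)[OF that(1)] assms(5) by auto
    show "(ys ! i, ys ! nb i) \<in> ?E \<or> (ys ! nb i, ys ! i) \<in> ?E"
    proof (cases "even i")
      case True
      then show ?thesis using alt_edges_nth[of i ys] nb(1)[OF that(1)] by (simp add: nb_def)
    next
      case False
      then show ?thesis using alt_edges_nth[of "i - 1" ys] that(1) by (auto simp: nb_def elim!: oddE)
    qed
  qed
  have nb_red: "nb a \<noteq> b" if "a < length ys" "b < length ys" "\<pi> (ys ! a) = ys ! b" "\<pi> (ys ! b) = ys ! a" for a b
  proof
    assume "nb a = b"
    then show False using red[of a] red[of b] that by (cases "even a") (auto simp: nb_def elim!: oddE)
  qed
  have "(x, \<pi> x) \<in> ?E" using xV by (auto simp: graph_of_def)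
  moreover have "\<pi> x \<in> W" using p(1)[OF xV] assms(4,5) by blast
  ultimately have "\<pi> x \<in> C" using step[OF xC] by blast
  \<comment> \<open>\<open>nb j = k\<close> would make adjacent points partners, and
    \<open>nb j = nb k\<close> would give \<open>j = k\<close> because \<open>nb\<close> is an
    involution.\<close>
  let ?I = "{j, k, nb j, nb k}"
  have I: "\<forall>i\<in>?I. i < length ys \<and> ys ! i \<in> C"
    using j k nb_edge nb(1) xC \<open>\<pi> x \<in> C\<close> by auto
  have "j \<noteq> k" using j k p(2)[OF xV] by auto
  moreover have "nb j \<noteq> k" "nb k \<noteq> j" using nb_red[of j k] nb_red[of k j] j k p(3) by auto
  moreover have "nb j \<noteq> nb k" using nb(3)[OF j(1)] nb(3)[OF k(1)] \<open>j \<noteq> k\<close> by metis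
  ultimately have "card ?I = 4" using nb(2)[OF j(1)] nb(2)[OF k(1)] by auto
  moreover have "inj_on ((!) ys) ?I"
    using I inj C(2) by (intro inj_onI) metis
  ultimately have "card ((!) ys ` ?I) = 4" by (simp only: card_image)
  moreover have "(!) ys ` ?I \<subseteq> C" using I by blast
  ultimately show ?thesis using C(3) card_mono by metis
qed

text \<open>
  Without a pair of adjacent partners, all components have at least four vertices, except for the
  one of \<open>z\<close>, which has at least three.
\<close>

lemma face_block_count_reduced:
  assumes "\<pi> \<in> pairings (set zs)" "distinct zs" "zs \<noteq> []" "z \<notin> set zs"
    and red: "\<And>i. Suc i < length zs \<Longrightarrow> \<pi> (zs ! i) \<noteq> zs ! Suc i"
  shows "face_count z zs \<pi> + block_count zs \<pi> \<le> length zs div 2"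
proof -
  have len: "even (length zs)"
    using even_card_pairings[OF _ assms(1)] distinct_card[OF assms(2)] by simp
  have finC: "finite C" if "C \<in> W // connected_rel W E" "finite W" for C W and E :: "('a \<times> 'a) set"
    using that Union_quotient[OF equiv_connected_rel] by (metis Union_upper finite_subset)
  note p = pairingsD[OF assms(1)]
  have "4 * block_count zs \<pi> \<le> card (set zs) + 1"
    unfolding block_count_def
  proof (rule components_bound[where ?C0.0 = "{}"])
    fix C assume C: "C \<in> set zs // connected_rel (set zs) (alt_edges zs \<union> graph_of \<pi> (set zs))"
    have "z \<notin> C" using C assms(4) by (auto simp: connected_rel_def elim!: quotientE)
    then show "4 \<le> card C"
      using C len assms finC[OF C] by (intro reduced_class[OF _ assms(1), where z = z]) (auto simp: nth_eq_iff_index_eq)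
  next
    assume "{} \<in> set zs // connected_rel (set zs) (alt_edges zs \<union> graph_of \<pi> (set zs))"
    then show "3 \<le> card {}" using in_quotient_imp_non_empty[OF equiv_connected_rel] by blast
  qed simp
  moreover have "4 * face_count z zs \<pi> \<le> card (insert z (set zs)) + 1"
    unfolding face_count_def
  proof -
    let ?W = "insert z (set zs)" and ?ys = "z # zs @ [z]"
    let ?E = "alt_edges ?ys \<union> graph_of \<pi> (set zs)"
    let ?R = "connected_rel ?W ?E"
    show "4 * components ?W ?E \<le> card ?W + 1"
    proof (rule components_bound[where ?C0.0 = "?R `` {z}"])
      fix C assume C: "C \<in> ?W // ?R" "C \<noteq> ?R `` {z}"
      have "z \<notin> C"
      proof
        assume "z \<in> C"
        obtain x where "C = ?R `` {x}" using C(1) by (rule quotientE)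
        then show False using equiv_class_eq[OF equiv_connected_rel, of x z ?W ?E] \<open>z \<in> C\<close> C(2) by simp
      qed
      then show "4 \<le> card C"
      proof (rule reduced_class[OF _ assms(1,4) _ _ _ _ _ C(1), rotated -2])
        show "even (length ?ys)" using len by simp
        show "finite C" using finC[OF C(1)] by simp
        show "i = j" if "i < length ?ys" "j < length ?ys" "?ys ! i = ?ys ! j" "?ys ! i \<noteq> z" for i j
          using that assms(2,4) by (auto simp: nth_Cons nth_append nth_eq_iff_index_eq split: nat.splits if_splits)
        show "\<pi> (?ys ! i) \<noteq> ?ys ! Suc i" if "Suc i < length ?ys" for i
        proof (cases i)
          case 0
          then show ?thesis using p(4)[OF assms(4)] assms(3,4) by (cases zs) auto
        next
          case (Suc i')
          then show ?thesis
            using that red[of i'] p(1)[of "zs ! i'"] assms(4) by (auto simp: nth_append)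
        qed
      qed auto
    next
      \<comment> \<open>The even length excludes a list with a single element.\<close>
      have l: "hd zs \<noteq> last zs"
        using assms(2,3) len by (cases zs) (auto split: if_splits)
      have "(z, hd zs) \<in> ?E" using assms(3) by (cases zs) auto
      moreover have "(last zs, z) \<in> ?E"
        using alt_edges_nth[of "length zs" ?ys] len assms(3)
        by (auto simp: nth_Cons' nth_append last_conv_nth)
      ultimately have "{z, hd zs, last zs} \<subseteq> ?R `` {z}"
        using assms(3) by (auto simp: connected_rel_def)
      moreover have "card {z, hd zs, last zs} = 3"
        using l assms(3,4) by (auto simp: card_insert_if)
      moreover have "finite (?R `` {z})"
        by (rule finite_subset[of _ ?W]) (auto simp: connected_rel_def)
      ultimately show "3 \<le> card (?R `` {z})" by (metis card_mono)
    qed simp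
  qed
  \<comment> \<open>For \<open>2 * m\<close> points the two bounds add up to
    \<open>4 * m + 3\<close> for four times the sum of the counts; rounding down leaves
    \<open>m\<close>.\<close>
  ultimately show ?thesis
    using len assms(4) distinct_card[OF assms(2)] by (auto elim!: evenE)
qed

lemma components_empty [simp]: "components {} E = 0"
  by (simp add: components_def)

lemma face_count_Nil: "face_count z [] \<pi> = 1"
proof -
  have "face_count z [] \<pi> = components {z} {}"
    unfolding face_count_def list.set append_Nil
    by (rule components_cong) (auto simp: graph_of_def const_on_edges_def)
  then show ?thesis using components_isolated[of "{}" "{}" z] by simp
qed

text \<open>The list \<open>rev st @ xs\<close> is what is left of the circle, and its read part has
  no adjacent partners. Each cancellation lowers both sides of the Euler bound by one. At the end,
  an empty stack gives equality, and a nonempty one is a reduced list, for which the bound is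
  strict.\<close>

lemma noncrossing_iff_genus_zero:
  assumes "\<pi> \<in> pairings (set (rev st @ xs))" "distinct (rev st @ xs)" "z \<notin> set (rev st @ xs)"
    and "successively (\<lambda>x y. \<pi> x \<noteq> y) (rev st)"
  shows "face_count z (rev st @ xs) \<pi> + block_count (rev st @ xs) \<pi> \<le> Suc (length (rev st @ xs) div 2) \<and>
    (face_count z (rev st @ xs) \<pi> + block_count (rev st @ xs) \<pi> = Suc (length (rev st @ xs) div 2) \<longleftrightarrow>
      noncrossing \<pi> st xs)"
  using assms
proof (induction xs arbitrary: st \<pi>)
  case Nil
  show ?case
  proof (cases "st = []")
    case True
    then show ?thesis by (simp add: face_count_Nil block_count_def)
  next
    case False
    have "face_count z (rev st) \<pi> + block_count (rev st) \<pi> \<le> length (rev st) div 2"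
      using Nil False by (intro face_block_count_reduced) (auto simp: successively_conv_nth)
    then show ?thesis using False by simp
  qed
next
  case (Cons x xs)
  show ?case
  proof (cases st)
    case Nil
    then show ?thesis using Cons.IH[of \<pi> "[x]"] Cons.prems by simp
  next
    case st: (Cons t ts)
    show ?thesis
    proof (cases "\<pi> t = x")
      case True
      let ?s = "unpair t x \<pi>"
      have zs: "rev st @ x # xs = rev ts @ t # x # xs" by (simp add: st)
      have d: "t \<notin> set ts" "x \<notin> set ts" "t \<notin> set xs" "x \<notin> set xs" "t \<noteq> x"
        using Cons.prems(2) st by auto
      have "set (rev st @ x # xs) - {t, x} = set (rev ts @ xs)"
        using d st by auto
      then have s: "?s \<in> pairings (set (rev ts @ xs))"
        using unpair_in_pairings[OF Cons.prems(1) True] by simp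
      have "successively (\<lambda>x y. \<pi> x \<noteq> y) (rev ts)"
        using Cons.prems(4) by (simp add: st successively_append_iff)
      then have "successively (\<lambda>x y. ?s x \<noteq> y) (rev ts)"
      proof (rule successively_cong[THEN iffD1, rotated -1])
        fix y w assume "y \<in> set (rev ts)"
        then have "y \<noteq> t" "y \<noteq> x" using d by auto
        then show "(\<pi> y \<noteq> w) = (?s y \<noteq> w)" by simp
      qed simp_all
      then have IH: "face_count z (rev ts @ xs) ?s + block_count (rev ts @ xs) ?s \<le> Suc (length (rev ts @ xs) div 2) \<and>
        (face_count z (rev ts @ xs) ?s + block_count (rev ts @ xs) ?s = Suc (length (rev ts @ xs) div 2) \<longleftrightarrow>
          noncrossing ?s ts xs)"
        using Cons.prems(2,3) by (intro Cons.IH s) (auto simp: st)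
      have "noncrossing ?s ts xs \<longleftrightarrow> noncrossing \<pi> st (x # xs)"
      proof -
        have "noncrossing ?s ts xs \<longleftrightarrow> noncrossing \<pi> ts xs"
        proof (rule noncrossing_cong)
          fix y assume "y \<in> set ts \<union> set xs"
          then have "y \<noteq> t" "y \<noteq> x" using d by auto
          then show "?s y = \<pi> y" by simp
        qed
        then show ?thesis using True by (simp add: st)
      qed
      then show ?thesis
        using IH face_block_count_unpair[of "rev ts" t x xs z \<pi>] Cons.prems(1-3) True unfolding zs by simp
    next
      case False
      have "\<pi> t \<noteq> x" by fact
      then have "successively (\<lambda>x y. \<pi> x \<noteq> y) (rev (x # st))"
        using Cons.prems(4) by (simp add: st successively_append_iff)
      then show ?thesis using Cons.IH[of \<pi> "x # st"] Cons.prems(1-3) False by (simp add: st insert_commute)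
    qed
  qed
qed

section \<open>Pairings that are planar for two circular orders\<close>

text \<open>Makes the order of two points joined by an alternating edge irrelevant, which is needed
  to move points on the stack and to compare the legs.\<close>

lemma block_count_cong:
  assumes "\<pi> \<in> pairings (set zs)" "set zs = set zs'"
    and "\<And>f. const_on_edges (alt_edges zs) f \<longleftrightarrow> const_on_edges (alt_edges zs') f"
  shows "block_count zs \<pi> = block_count zs' \<pi>"
  unfolding block_count_def assms(2)
proof (rule components_cong)
  show "alt_edges zs \<union> graph_of \<pi> (set zs') \<subseteq> set zs' \<times> set zs'"
    using assms(1,2) by (intro edges_subset) auto
  show "alt_edges zs' \<union> graph_of \<pi> (set zs') \<subseteq> set zs' \<times> set zs'"
    using assms(1,2) by (intro edges_subset) auto
qed (simp_all add: const_on_edges_Un assms(3))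

text \<open>Carries a side condition through the removal of a pair; the recursions over pairings
  below have this form.\<close>

lemma bij_betw_unpair_Collect:
  assumes "x \<in> V" "y \<in> V" "x \<noteq> y"
    and "\<And>\<pi>. \<pi> \<in> pairings V \<Longrightarrow> \<pi> x = y \<Longrightarrow> P \<pi> \<longleftrightarrow> P' (unpair x y \<pi>)"
  shows "bij_betw (unpair x y) {\<pi> \<in> pairings V. \<pi> x = y \<and> P \<pi>} {\<tau> \<in> pairings (V - {x, y}). P' \<tau>}"
proof -
  note b = bij_betw_unpair[OF assms(1-3)]
  have "bij_betw (unpair x y) {\<pi> \<in> {\<pi> \<in> pairings V. \<pi> x = y}. P \<pi>} {\<tau> \<in> pairings (V - {x, y}). P' \<tau>}"
  proof (rule bij_betw_subset[OF b])
    have "pairings (V - {x, y}) = unpair x y ` {\<pi> \<in> pairings V. \<pi> x = y}"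
      using b by (simp add: bij_betw_def)
    then have "{\<tau> \<in> pairings (V - {x, y}). P' \<tau>} =
        unpair x y ` {\<pi> \<in> {\<pi> \<in> pairings V. \<pi> x = y}. P' (unpair x y \<pi>)}"
      by auto
    also have "{\<pi> \<in> {\<pi> \<in> pairings V. \<pi> x = y}. P' (unpair x y \<pi>)} = {\<pi> \<in> {\<pi> \<in> pairings V. \<pi> x = y}. P \<pi>}"
      using assms(4) by blast
    finally show "unpair x y ` {\<pi> \<in> {\<pi> \<in> pairings V. \<pi> x = y}. P \<pi>} = {\<tau> \<in> pairings (V - {x, y}). P' \<tau>}"
      by simp
  qed auto
  moreover have "{\<pi> \<in> {\<pi> \<in> pairings V. \<pi> x = y}. P \<pi>} = {\<pi> \<in> pairings V. \<pi> x = y \<and> P \<pi>}" by auto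
  ultimately show ?thesis by simp
qed

text \<open>\<open>snd\<close> tells a Gaussian factor from a conjugate one. In the complex case
  only a factor and a conjugate have nonzero covariance; in the real case \<open>r\<close> there is
  no such restriction.\<close>

definition admissible :: "bool \<Rightarrow> ('v \<times> bool) set \<Rightarrow> ('v \<times> bool \<Rightarrow> 'v \<times> bool) \<Rightarrow> bool" where
  "admissible r V \<pi> \<longleftrightarrow> r \<or> (\<forall>x\<in>V. snd x \<noteq> snd (\<pi> x))"

lemma admissible_unpair:
  assumes "\<pi> \<in> pairings V" "x \<in> V" "\<pi> x = y" "snd x \<noteq> snd y"
  shows "admissible r V \<pi> \<longleftrightarrow> admissible r (V - {x, y}) (unpair x y \<pi>)"
proof -
  have "\<pi> y = x" using pairingsD(3)[OF assms(1), of x] assms(3) by simp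
  have "(\<forall>w\<in>V. snd w \<noteq> snd (\<pi> w)) \<longleftrightarrow> (\<forall>w\<in>V - {x, y}. snd w \<noteq> snd (unpair x y \<pi> w))"
  proof
    assume l: "\<forall>w\<in>V. snd w \<noteq> snd (\<pi> w)"
    show "\<forall>w\<in>V - {x, y}. snd w \<noteq> snd (unpair x y \<pi> w)"
    proof
      fix w assume "w \<in> V - {x, y}"
      then show "snd w \<noteq> snd (unpair x y \<pi> w)" using l by simp
    qed
  next
    assume l: "\<forall>w\<in>V - {x, y}. snd w \<noteq> snd (unpair x y \<pi> w)"
    show "\<forall>w\<in>V. snd w \<noteq> snd (\<pi> w)"
    proof
      fix w assume w: "w \<in> V"
      show "snd w \<noteq> snd (\<pi> w)"
      proof (cases "w = x \<or> w = y")
        case True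
        then show ?thesis using assms(3,4) \<open>\<pi> y = x\<close> by auto
      next
        case False
        then have "w \<in> V - {x, y}" using w by simp
        from l[rule_format, OF this] show ?thesis using False by simp
      qed
    qed
  qed
  then show ?thesis by (simp add: admissible_def)
qed

lemma noncrossing_unpair:
  assumes "x \<notin> set st \<union> set xs" "y \<notin> set st \<union> set xs"
  shows "noncrossing (unpair x y \<pi>) st xs \<longleftrightarrow> noncrossing \<pi> st xs"
proof (rule noncrossing_cong)
  fix z assume "z \<in> set st \<union> set xs"
  then have "z \<noteq> x" "z \<noteq> y" using assms by auto
  then show "unpair x y \<pi> z = \<pi> z" by simp
qed

section \<open>States of the reading: open blocks on the stack and points still to be read\<close>

text \<open>
  The point \<open>(s, True)\<close> stands for the factor \<open>g\<close> of the \<open>s\<close>-th letter, and \<open>(s, False)\<close> for its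
  conjugate. A flag \<open>e i\<close> is true if letter \<open>i\<close> is not transposed in the tensor leg under
  consideration. The point that carries the row index comes first.
\<close>

fun factor_points :: "('i \<Rightarrow> bool) \<Rightarrow> nat \<Rightarrow> 'i list \<Rightarrow> (nat \<times> bool) list" where
  "factor_points e s [] = []"
| "factor_points e s (i # w) = (s, e i) # (s, \<not> e i) # factor_points e (Suc s) w"

text \<open>
  An open block \<open>(f, l, i)\<close> has first position \<open>f\<close>, last position \<open>l\<close> and letter \<open>i\<close>. Its unpaired
  points carry the column index of \<open>l\<close> and the row index of \<open>f\<close>.
\<close>

fun open_points :: "('i \<Rightarrow> bool) \<Rightarrow> (nat \<times> nat \<times> 'i) list \<Rightarrow> (nat \<times> bool) list" where
  "open_points e [] = []"
| "open_points e ((f, l, i) # B) = (l, \<not> e i) # (f, e i) # open_points e B"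

lemma set_factor_points: "set (factor_points e s w) = {s..<s + length w} \<times> UNIV"
proof (induction w arbitrary: s)
  case (Cons i w)
  have "{s..<s + length (i # w)} = insert s {Suc s..<Suc s + length w}" by auto
  moreover have "(UNIV :: bool set) = {e i, \<not> e i}" by auto
  ultimately show ?case using Cons by auto
qed simp

lemma distinct_factor_points: "distinct (factor_points e s w)"
  by (induction w arbitrary: s) (auto simp: set_factor_points)

lemma length_factor_points: "length (factor_points e s w) = 2 * length w"
  by (induction w arbitrary: s) auto

lemma even_length_open_points: "even (length (open_points e B))"
  by (induction e B rule: open_points.induct) auto

text \<open>
  \<open>e1\<close> and \<open>e2\<close> are the flags for the two tensor legs. In the real case \<open>r\<close> a matrix equals its full
  transpose, so that the first flag can be assumed to be true.
\<close>

locale transpose_flags =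
  fixes e1 e2 :: "'i \<Rightarrow> bool" and \<Lambda> :: "'i set" and r :: bool and q :: "'i \<Rightarrow> complex"
  assumes flags_inj: "i \<in> \<Lambda> \<Longrightarrow> j \<in> \<Lambda> \<Longrightarrow> e1 i = e1 j \<Longrightarrow> e2 i = e2 j \<Longrightarrow> i = j"
    and flags_real: "r \<Longrightarrow> i \<in> \<Lambda> \<Longrightarrow> e1 i"
    and q_eq: "q i = (if e1 i = e2 i then 1 else 0)"
begin

text \<open>The last condition says that an open block of a partially transposed letter still has a
  single element. This makes the unpaired points the same set in both legs, although their order
  differs.\<close>

definition valid_blocks :: "nat \<Rightarrow> (nat \<times> nat \<times> 'i) list \<Rightarrow> bool" where
  "valid_blocks s B \<longleftrightarrow> distinct (open_points e1 B) \<and> distinct (open_points e2 B) \<and>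
     (\<forall>(f, l, i)\<in>set B. f < s \<and> l < s \<and> i \<in> \<Lambda> \<and> (f = l \<or> e1 i = e2 i))"

lemma open_points_eq_set: "valid_blocks s B \<Longrightarrow> set (open_points e2 B) = set (open_points e1 B)"
proof (induction B)
  case (Cons b B)
  obtain f l i where b: "b = (f, l, i)" by (cases b)
  have "valid_blocks s B" using Cons.prems by (auto simp: valid_blocks_def b)
  moreover have "{(l, \<not> e2 i), (f, e2 i)} = {(l, \<not> e1 i), (f, e1 i)}"
    using Cons.prems by (auto simp: valid_blocks_def b)
  ultimately show ?case using Cons.IH by (auto simp: b)
qed simp

lemma open_points_less:
  assumes "valid_blocks s B" "x \<in> set (open_points e1 B)"
  shows "fst x < s"
proof -
  have "x \<in> set (open_points e B) \<Longrightarrow> \<exists>(f, l, i)\<in>set B. fst x = f \<or> fst x = l" for e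
    by (induction e B rule: open_points.induct) auto
  then show ?thesis using assms unfolding valid_blocks_def by fastforce
qed

definition state_points :: "nat \<Rightarrow> (nat \<times> nat \<times> 'i) list \<Rightarrow> 'i list \<Rightarrow> (nat \<times> bool) list" where
  "state_points s B w = open_points e1 B @ factor_points e1 s w"

definition planar_pairings :: "nat \<Rightarrow> (nat \<times> nat \<times> 'i) list \<Rightarrow> 'i list \<Rightarrow> (nat \<times> bool \<Rightarrow> nat \<times> bool) set" where
  "planar_pairings s B w = {\<pi> \<in> pairings (set (state_points s B w)).
     admissible r (set (state_points s B w)) \<pi> \<and>
     noncrossing \<pi> (open_points e1 B) (factor_points e1 s w) \<and>
     noncrossing \<pi> (open_points e2 B) (factor_points e2 s w)}"

text \<open>The two unpaired points of an open block are neighbours at an even offset, so an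
  alternating edge keeps the block connected through the part already removed.\<close>

definition weight :: "complex \<Rightarrow> nat \<Rightarrow> (nat \<times> nat \<times> 'i) list \<Rightarrow> 'i list \<Rightarrow> (nat \<times> bool \<Rightarrow> nat \<times> bool) \<Rightarrow> complex" where
  "weight c s B w \<pi> = c ^ block_count (state_points s B w) \<pi>"

lemma finite_planar_pairings: "finite (planar_pairings s B w)"
  unfolding planar_pairings_def using finite_pairings by fastforce

lemma distinct_state:
  assumes "valid_blocks s B" "e = e1 \<or> e = e2"
  shows "distinct (open_points e B @ factor_points e s w)"
    and "set (open_points e B @ factor_points e s w) = set (state_points s B w)"
proof -
  have O: "set (open_points e B) = set (open_points e1 B)" using assms(2) open_points_eq_set[OF assms(1)] by auto
  have "set (open_points e B) \<inter> set (factor_points e s w) = {}"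
    unfolding O using open_points_less[OF assms(1)] by (fastforce simp: set_factor_points)
  then show "distinct (open_points e B @ factor_points e s w)"
    using assms by (auto simp: valid_blocks_def distinct_factor_points)
  show "set (open_points e B @ factor_points e s w) = set (state_points s B w)"
    unfolding state_points_def set_append O set_factor_points ..
qed

context
  fixes s :: nat and B :: "(nat \<times> nat \<times> 'i) list" and i :: 'i and w :: "'i list"
  assumes B: "valid_blocks s B" and i: "i \<in> \<Lambda>"
begin

abbreviation "Op \<equiv> set (open_points e1 B)"

lemma s_fresh: "(s, b) \<notin> Op" "(s, b) \<notin> set (factor_points e (Suc s) w)"
  using open_points_less[OF B, of "(s, b)"] by (auto simp: set_factor_points)

lemma Op_rest: "x \<in> Op \<Longrightarrow> x \<notin> set (factor_points e (Suc s) w)"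
  using open_points_less[OF B, of x] by (auto simp: set_factor_points)

text \<open>The first point can only cancel the top of the stack, and the second one then only the
  point below it, which belongs to the same open block.\<close>

lemma planar_first:
  assumes "e = e1 \<or> e = e2" "\<pi> \<in> planar_pairings s B (i # w)" "\<pi> (s, e i) \<in> Op"
  shows "\<exists>f l j B'. B = (f, l, j) # B' \<and> \<pi> (s, e i) = (l, \<not> e j) \<and>
    (\<pi> (s, \<not> e i) \<in> Op \<longrightarrow> \<pi> (s, \<not> e i) = (f, e j))"
proof -
  let ?a = "(s, e i)" and ?b = "(s, \<not> e i)" and ?fp = "factor_points e (Suc s) w"
  have p: "\<pi> \<in> pairings (set (state_points s B (i # w)))"
    and nc: "noncrossing \<pi> (open_points e B) (?a # ?b # ?fp)"
    using assms(1,2) by (auto simp: planar_pairings_def)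
  have O: "set (open_points e B) = Op" using assms(1) open_points_eq_set[OF B] by auto
  have d: "distinct (open_points e B @ ?a # ?b # ?fp)"
    using distinct_state(1)[OF B assms(1), of "i # w"] by simp
  note inv = pairingsD(3)[OF p]
  have d': "distinct (open_points e B @ ?b # ?fp)" using d by auto
  have st: "open_points e B = \<pi> ?a # tl (open_points e B)" "noncrossing \<pi> (tl (open_points e B)) (?b # ?fp)"
    using noncrossing_pop[OF inv _ d' nc] assms(3) O by auto
  then obtain f l j B' where BB: "B = (f, l, j) # B'" by (cases B) auto
  have a: "\<pi> ?a = (l, \<not> e j)" using st(1) by (simp add: BB)
  have "\<pi> ?b = (f, e j)" if b: "\<pi> ?b \<in> Op"
  proof -
    have "\<pi> ?b \<noteq> \<pi> ?a" using inv by (metis prod.inject)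
    then have "\<pi> ?b \<in> set (tl (open_points e B))" using b O a by (auto simp: BB)
    moreover have "distinct (tl (open_points e B) @ ?fp)" using d by (auto simp: BB)
    ultimately have "tl (open_points e B) = \<pi> ?b # tl (tl (open_points e B))"
      using noncrossing_pop[OF inv _ _ st(2)] by blast
    then show ?thesis by (simp add: BB)
  qed
  then show ?thesis using BB a by blast
qed

text \<open>A first point that is not cancelled is pushed and hides all open points from the second
  one.\<close>

lemma planar_second:
  assumes "e = e1 \<or> e = e2" "\<pi> \<in> planar_pairings s B (i # w)" "\<pi> (s, \<not> e i) \<in> Op"
  shows "\<pi> (s, e i) \<in> Op"
proof (rule ccontr)
  let ?a = "(s, e i)" and ?b = "(s, \<not> e i)" and ?fp = "factor_points e (Suc s) w"
  assume n: "\<pi> ?a \<notin> Op"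
  have p: "\<pi> \<in> pairings (set (state_points s B (i # w)))"
    and nc: "noncrossing \<pi> (open_points e B) (?a # ?b # ?fp)"
    using assms(1,2) by (auto simp: planar_pairings_def)
  have O: "set (open_points e B) = Op" using assms(1) open_points_eq_set[OF B] by auto
  have d: "distinct (open_points e B @ ?a # ?b # ?fp)"
    using distinct_state(1)[OF B assms(1), of "i # w"] by simp
  note inv = pairingsD(3)[OF p]
  have nc': "noncrossing \<pi> (?a # open_points e B) (?b # ?fp)"
    using noncrossing_push[OF inv, of ?a] nc n O by simp
  have "?a # open_points e B = \<pi> ?b # tl (?a # open_points e B)"
    using noncrossing_pop[OF inv _ _ nc'] assms(3) O d by auto
  then have "\<pi> ?b = ?a" by simp
  then show False using assms(3) s_fresh by simp
qed

lemma points_cases: "e = e1 \<or> e = e2 \<Longrightarrow>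
  (s, e i) = (s, e1 i) \<and> (s, \<not> e i) = (s, \<not> e1 i) \<or> (s, e i) = (s, \<not> e1 i) \<and> (s, \<not> e i) = (s, e1 i)"
  by auto

lemma set_state_Cons: "set (state_points s B (i # w)) = Op \<union> {(s, e1 i), (s, \<not> e1 i)} \<union> set (factor_points e1 (Suc s) w)"
  by (auto simp: state_points_def)

text \<open>The two points cancel immediately in either order. Being joined by their alternating
  edge as well, they are a component of their own, which accounts for the factor
  \<open>c\<close>.\<close>

lemma sum_single:
  "(\<Sum>\<pi> | \<pi> \<in> planar_pairings s B (i # w) \<and> \<pi> (s, e1 i) = (s, \<not> e1 i). weight c s B (i # w) \<pi>) =
    c * (\<Sum>\<pi>\<in>planar_pairings (Suc s) B w. weight c (Suc s) B w \<pi>)"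
proof -
  let ?a = "(s, e1 i)" and ?b = "(s, \<not> e1 i)"
  let ?V = "set (state_points s B (i # w))"
  let ?nc = "\<lambda>e \<pi>. noncrossing \<pi> (open_points e B) (factor_points e s (i # w))"
  let ?nc' = "\<lambda>e \<pi>. noncrossing \<pi> (open_points e B) (factor_points e (Suc s) w)"
  have V': "?V - {?a, ?b} = set (state_points (Suc s) B w)"
    using s_fresh by (auto simp: state_points_def)
  have nc: "?nc e \<pi> \<longleftrightarrow> ?nc' e (unpair ?a ?b \<pi>)"
    if e: "e = e1 \<or> e = e2" and \<pi>: "\<pi> \<in> pairings ?V" "\<pi> ?a = ?b" for e \<pi>
  proof -
    note inv = pairingsD(3)[OF \<pi>(1)]
    have "\<pi> ?b = ?a" using inv[of ?a] \<pi>(2) by simp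
    then have xy: "\<pi> (s, e i) = (s, \<not> e i)" using \<pi>(2) points_cases[OF e] by auto
    have O: "set (open_points e B) = Op" using e open_points_eq_set[OF B] by auto
    have "?nc e \<pi> \<longleftrightarrow> ?nc' e \<pi>"
      using noncrossing_push[OF inv, of "(s, e i)" "open_points e B"] xy s_fresh(1) O by simp
    also have "\<dots> \<longleftrightarrow> ?nc' e (unpair ?a ?b \<pi>)"
      using s_fresh O by (intro noncrossing_unpair[symmetric]) auto
    finally show ?thesis .
  qed
  have ab: "?a \<in> ?V" "?b \<in> ?V" "?a \<noteq> ?b" by (auto simp: set_state_Cons)
  have "bij_betw (unpair ?a ?b)
      {\<pi> \<in> pairings ?V. \<pi> ?a = ?b \<and> (admissible r ?V \<pi> \<and> ?nc e1 \<pi> \<and> ?nc e2 \<pi>)}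
      {\<tau> \<in> pairings (?V - {?a, ?b}). admissible r (?V - {?a, ?b}) \<tau> \<and> ?nc' e1 \<tau> \<and> ?nc' e2 \<tau>}"
  proof (rule bij_betw_unpair_Collect[OF ab])
    fix \<pi> assume \<pi>: "\<pi> \<in> pairings ?V" "\<pi> ?a = ?b"
    show "(admissible r ?V \<pi> \<and> ?nc e1 \<pi> \<and> ?nc e2 \<pi>) =
      (admissible r (?V - {?a, ?b}) (unpair ?a ?b \<pi>) \<and> ?nc' e1 (unpair ?a ?b \<pi>) \<and> ?nc' e2 (unpair ?a ?b \<pi>))"
      using admissible_unpair[OF \<pi>(1) ab(1) \<pi>(2)] nc[OF _ \<pi>] by simp
  qed
  also have "{\<pi> \<in> pairings ?V. \<pi> ?a = ?b \<and> (admissible r ?V \<pi> \<and> ?nc e1 \<pi> \<and> ?nc e2 \<pi>)} =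
      {\<pi> \<in> planar_pairings s B (i # w). \<pi> ?a = ?b}"
    by (auto simp: planar_pairings_def)
  also have "{\<tau> \<in> pairings (?V - {?a, ?b}). admissible r (?V - {?a, ?b}) \<tau> \<and> ?nc' e1 \<tau> \<and> ?nc' e2 \<tau>} =
      planar_pairings (Suc s) B w"
    unfolding V' planar_pairings_def ..
  finally have bij: "bij_betw (unpair ?a ?b) {\<pi> \<in> planar_pairings s B (i # w). \<pi> ?a = ?b} (planar_pairings (Suc s) B w)" .
  have w: "weight c s B (i # w) \<pi> = c * weight c (Suc s) B w (unpair ?a ?b \<pi>)"
    if "\<pi> \<in> planar_pairings s B (i # w)" "\<pi> ?a = ?b" for \<pi>
  proof -
    have "\<pi> \<in> pairings (set (open_points e1 B @ ?a # ?b # factor_points e1 (Suc s) w))"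
      using that(1) by (simp add: planar_pairings_def state_points_def)
    moreover have "distinct (open_points e1 B @ ?a # ?b # factor_points e1 (Suc s) w)"
      using distinct_state(1)[OF B, of e1 "i # w"] by simp
    ultimately show ?thesis
      using block_count_unpair_even[of "open_points e1 B" ?a ?b "factor_points e1 (Suc s) w" \<pi>]
        that(2)
      by (simp add: weight_def state_points_def even_length_open_points)
  qed
  have "(\<Sum>\<pi> | \<pi> \<in> planar_pairings s B (i # w) \<and> \<pi> ?a = ?b. weight c s B (i # w) \<pi>) =
    (\<Sum>\<pi> | \<pi> \<in> planar_pairings s B (i # w) \<and> \<pi> ?a = ?b. c * weight c (Suc s) B w (unpair ?a ?b \<pi>))"
    by (intro sum.cong w) auto
  also have "\<dots> = (\<Sum>\<pi>\<in>planar_pairings (Suc s) B w. c * weight c (Suc s) B w \<pi>)"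
    by (rule sum.reindex_bij_betw[OF bij])
  finally show ?thesis by (simp add: sum_distrib_left)
qed

lemma valid_open: "valid_blocks (Suc s) ((s, s, i) # B)"
proof -
  have "(s, b) \<notin> set (open_points e2 B)" for b using s_fresh(1) open_points_eq_set[OF B] by simp
  then show ?thesis
    using B i s_fresh(1) unfolding valid_blocks_def by auto
qed

text \<open>The pairings themselves are unchanged; only the boundary between stack and input moves
  past the letter. Its points reach the stack in reversed order, which leaves the alternating edges
  the same.\<close>

lemma sum_open:
  "(\<Sum>\<pi> | \<pi> \<in> planar_pairings s B (i # w) \<and> \<pi> (s, e1 i) \<notin> Op \<and> \<pi> (s, \<not> e1 i) \<notin> Op \<and>
      \<pi> (s, e1 i) \<noteq> (s, \<not> e1 i). weight c s B (i # w) \<pi>) =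
    (\<Sum>\<pi>\<in>planar_pairings (Suc s) ((s, s, i) # B) w. weight c (Suc s) ((s, s, i) # B) w \<pi>)"
proof (rule sum.cong)
  let ?a = "(s, e1 i)" and ?b = "(s, \<not> e1 i)" and ?B = "(s, s, i) # B"
  let ?V = "set (state_points s B (i # w))"
  have V: "set (state_points (Suc s) ?B w) = ?V" by (auto simp: state_points_def)
  have nc: "noncrossing \<pi> (open_points e B) (factor_points e s (i # w)) \<longleftrightarrow>
      noncrossing \<pi> (open_points e ?B) (factor_points e (Suc s) w)"
    if e: "e = e1 \<or> e = e2" and \<pi>: "\<pi> \<in> pairings ?V" "\<pi> ?a \<notin> Op" "\<pi> ?b \<notin> Op" "\<pi> ?a \<noteq> ?b" for e \<pi>
  proof -
    note inv = pairingsD(3)[OF \<pi>(1)]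
    have O: "set (open_points e B) = Op" using e open_points_eq_set[OF B] by auto
    have "\<pi> ?b \<noteq> ?a" using inv[of ?b] \<pi>(4) by auto
    then have xy: "\<pi> (s, e i) \<notin> Op" "\<pi> (s, \<not> e i) \<notin> Op" "\<pi> (s, \<not> e i) \<noteq> (s, e i)"
      using \<pi> points_cases[OF e] by auto
    show ?thesis
      using noncrossing_push[OF inv, of "(s, e i)" "open_points e B"]
        noncrossing_push[OF inv, of "(s, \<not> e i)" "(s, e i) # open_points e B"] xy O by simp
  qed
  \<comment> \<open>Points on a stack that gets emptied have their partners in the remaining input,
    which contains neither open points nor points of the current letter.\<close>
  have conv: "\<pi> ?a \<notin> Op \<and> \<pi> ?b \<notin> Op \<and> \<pi> ?a \<noteq> ?b"
    if "noncrossing \<pi> (open_points e1 ?B) (factor_points e1 (Suc s) w)" for \<pi>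
    using noncrossing_partner[OF that, of ?a] noncrossing_partner[OF that, of ?b] Op_rest s_fresh(2)
    by (metis insert_iff list.simps(15) open_points.simps(2))
  show "{\<pi>. \<pi> \<in> planar_pairings s B (i # w) \<and> \<pi> ?a \<notin> Op \<and> \<pi> ?b \<notin> Op \<and> \<pi> ?a \<noteq> ?b} =
    planar_pairings (Suc s) ?B w"
  proof (rule Set.set_eqI)
    fix \<pi>
    show "\<pi> \<in> {\<pi>. \<pi> \<in> planar_pairings s B (i # w) \<and> \<pi> ?a \<notin> Op \<and> \<pi> ?b \<notin> Op \<and> \<pi> ?a \<noteq> ?b} \<longleftrightarrow>
      \<pi> \<in> planar_pairings (Suc s) ?B w"
      unfolding planar_pairings_def V mem_Collect_eq
      using nc[of e1 \<pi>] nc[of e2 \<pi>] conv[of \<pi>] by blast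
  qed
  fix \<pi> assume "\<pi> \<in> planar_pairings (Suc s) ?B w"
  then have "\<pi> \<in> pairings ?V" by (simp add: planar_pairings_def V)
  then have "block_count (state_points s B (i # w)) \<pi> = block_count (state_points (Suc s) ?B w) \<pi>"
    by (rule block_count_cong)
      (auto simp: V state_points_def alt_edges_append even_length_open_points
        const_on_edges_Un const_on_edges_insert)
  then show "weight c s B (i # w) \<pi> = weight c (Suc s) ?B w \<pi>" by (simp add: weight_def)
qed

text \<open>Removing the contracted pair splices the letter into the open block, whose last position
  becomes \<open>s\<close>. The component gets shorter but survives, hence no factor.\<close>

lemma sum_continue:
  assumes BB: "B = (f, l, i) # B2" and ee: "e1 i = e2 i"
  shows "(\<Sum>\<pi> | \<pi> \<in> planar_pairings s B (i # w) \<and> \<pi> (s, e1 i) = (l, \<not> e1 i) \<and> \<pi> (s, \<not> e1 i) \<notin> Op.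
      weight c s B (i # w) \<pi>) =
    (\<Sum>\<pi>\<in>planar_pairings (Suc s) ((f, s, i) # B2) w. weight c (Suc s) ((f, s, i) # B2) w \<pi>)"
    and "valid_blocks (Suc s) ((f, s, i) # B2)"
proof -
  let ?a = "(s, e1 i)" and ?b = "(s, \<not> e1 i)" and ?t = "(l, \<not> e1 i)" and ?u = "(f, e1 i)"
  let ?B = "(f, s, i) # B2"
  let ?V = "set (state_points s B (i # w))"
  let ?nc = "\<lambda>e \<pi>. noncrossing \<pi> (open_points e B) (factor_points e s (i # w))"
  let ?nc' = "\<lambda>e \<pi>. noncrossing \<pi> (open_points e ?B) (factor_points e (Suc s) w)"
  have Op: "Op = insert ?t (insert ?u (set (open_points e1 B2)))" by (simp add: BB)
  have fl: "f < s" "l < s" using B by (auto simp: valid_blocks_def BB)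
  have Op2: "Op = insert ?t (insert ?u (set (open_points e2 B2)))"
    using open_points_eq_set[OF B] ee by (simp add: BB)
  have d1: "distinct (?t # ?u # open_points e1 B2)" and d2: "distinct (?t # ?u # open_points e2 B2)"
    using B ee by (simp_all add: valid_blocks_def BB)
  show v: "valid_blocks (Suc s) ?B"
    unfolding valid_blocks_def
  proof (intro conjI)
    show "distinct (open_points e1 ?B)" using d1 s_fresh(1) Op by auto
    show "distinct (open_points e2 ?B)" using d2 s_fresh(1) Op2 ee by auto
    show "\<forall>(f, l, j)\<in>set ?B. f < Suc s \<and> l < Suc s \<and> j \<in> \<Lambda> \<and> (f = l \<or> e1 j = e2 j)"
      using B i ee by (auto simp: valid_blocks_def BB)
  qed
  have rest: "x \<notin> set (factor_points e (Suc s) w)" if "x \<in> {?t, ?a, ?u, ?b}" for x e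
    using that Op_rest[of ?t e] Op_rest[of ?u e] s_fresh(2) Op by auto
  have V': "?V - {?t, ?a} = set (state_points (Suc s) ?B w)"
    using d1 s_fresh rest fl by (auto simp: state_points_def BB)
  have nc: "(?nc e \<pi> \<and> \<pi> ?b \<notin> Op) \<longleftrightarrow> ?nc' e (unpair ?t ?a \<pi>)"
    if e: "e = e1 \<or> e = e2" and \<pi>: "\<pi> \<in> pairings ?V" "\<pi> ?t = ?a" for e \<pi>
  proof -
    note inv = pairingsD(3)[OF \<pi>(1)]
    have ei: "e i = e1 i" using e ee by auto
    have O: "Op = insert ?t (insert ?u (set (open_points e B2)))"
      by (rule disjE[OF e]; use Op Op2 in simp)
    have d: "distinct (?t # ?u # open_points e B2)"
      by (rule disjE[OF e]; use d1 d2 in simp)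
    have s': "(s, b) \<notin> set (open_points e B2)" for b
      using s_fresh(1)[of b] O by simp
    have "?nc' e (unpair ?t ?a \<pi>) \<longleftrightarrow> noncrossing (unpair ?t ?a \<pi>) (?b # ?u # open_points e B2) (factor_points e (Suc s) w)"
      by (simp add: ei)
    also have "\<dots> \<longleftrightarrow> noncrossing \<pi> (?b # ?u # open_points e B2) (factor_points e (Suc s) w)"
      using d rest s' fl by (intro noncrossing_unpair) simp_all
    finally have 1: "?nc' e (unpair ?t ?a \<pi>) \<longleftrightarrow> noncrossing \<pi> (?b # ?u # open_points e B2) (factor_points e (Suc s) w)" .
    have 2: "?nc e \<pi> \<longleftrightarrow> noncrossing \<pi> (?u # open_points e B2) (?b # factor_points e (Suc s) w)"
      using \<pi>(2) by (simp add: BB ei)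
    have 3: "noncrossing \<pi> (?u # open_points e B2) (?b # factor_points e (Suc s) w) \<longleftrightarrow>
      noncrossing \<pi> (?b # ?u # open_points e B2) (factor_points e (Suc s) w)" if "\<pi> ?b \<notin> Op"
      using noncrossing_push[OF inv, of ?b "?u # open_points e B2"] that O by simp
    have 4: "\<pi> ?b \<notin> Op" if "noncrossing \<pi> (?b # ?u # open_points e B2) (factor_points e (Suc s) w)"
      using noncrossing_partner[OF that, of ?b] Op_rest[of "\<pi> ?b" e] by auto
    show ?thesis using 1 2 3 4 by blast
  qed
  have ta: "?t \<in> ?V" "?a \<in> ?V" "?t \<noteq> ?a" using Op by (auto simp: set_state_Cons)
  have inv_ta: "\<pi> ?a = ?t \<longleftrightarrow> \<pi> ?t = ?a" if "\<pi> \<in> pairings ?V" for \<pi>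
    using pairingsD(3)[OF that] by metis
  have "bij_betw (unpair ?t ?a)
      {\<pi> \<in> pairings ?V. \<pi> ?t = ?a \<and> (admissible r ?V \<pi> \<and> (?nc e1 \<pi> \<and> \<pi> ?b \<notin> Op) \<and> (?nc e2 \<pi> \<and> \<pi> ?b \<notin> Op))}
      {\<tau> \<in> pairings (?V - {?t, ?a}). admissible r (?V - {?t, ?a}) \<tau> \<and> ?nc' e1 \<tau> \<and> ?nc' e2 \<tau>}"
  proof (rule bij_betw_unpair_Collect[OF ta])
    fix \<pi> assume \<pi>: "\<pi> \<in> pairings ?V" "\<pi> ?t = ?a"
    have "admissible r ?V \<pi> \<longleftrightarrow> admissible r (?V - {?t, ?a}) (unpair ?t ?a \<pi>)"
      by (rule admissible_unpair[OF \<pi>(1) ta(1) \<pi>(2)]) simp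
    then show "(admissible r ?V \<pi> \<and> (?nc e1 \<pi> \<and> \<pi> ?b \<notin> Op) \<and> (?nc e2 \<pi> \<and> \<pi> ?b \<notin> Op)) =
      (admissible r (?V - {?t, ?a}) (unpair ?t ?a \<pi>) \<and> ?nc' e1 (unpair ?t ?a \<pi>) \<and> ?nc' e2 (unpair ?t ?a \<pi>))"
      using nc[of e1 \<pi>] nc[of e2 \<pi>] \<pi> by blast
  qed
  also have "{\<pi> \<in> pairings ?V. \<pi> ?t = ?a \<and> (admissible r ?V \<pi> \<and> (?nc e1 \<pi> \<and> \<pi> ?b \<notin> Op) \<and> (?nc e2 \<pi> \<and> \<pi> ?b \<notin> Op))} =
      {\<pi> \<in> planar_pairings s B (i # w). \<pi> ?a = ?t \<and> \<pi> ?b \<notin> Op}"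
    unfolding planar_pairings_def using inv_ta by blast
  also have "{\<tau> \<in> pairings (?V - {?t, ?a}). admissible r (?V - {?t, ?a}) \<tau> \<and> ?nc' e1 \<tau> \<and> ?nc' e2 \<tau>} =
      planar_pairings (Suc s) ?B w"
    unfolding V' planar_pairings_def ..
  finally have bij: "bij_betw (unpair ?t ?a) {\<pi> \<in> planar_pairings s B (i # w). \<pi> ?a = ?t \<and> \<pi> ?b \<notin> Op}
      (planar_pairings (Suc s) ?B w)" .
  have w: "weight c s B (i # w) \<pi> = weight c (Suc s) ?B w (unpair ?t ?a \<pi>)"
    if "\<pi> \<in> planar_pairings s B (i # w)" "\<pi> ?a = ?t" for \<pi>
  proof -
    let ?r = "open_points e1 B2 @ factor_points e1 (Suc s) w"
    have \<pi>: "\<pi> \<in> pairings ?V" "\<pi> ?t = ?a" using that inv_ta by (auto simp: planar_pairings_def)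
    \<comment> \<open>With the two points of the open block exchanged, the partners
      \<open>?t\<close> and \<open>?a\<close> become adjacent at an odd offset, where their removal
      contracts a path.\<close>
    have set: "set ([?u] @ ?t # ?a # ?b # ?r) = ?V" by (auto simp: state_points_def BB)
    have dist: "distinct ([?u] @ ?t # ?a # ?b # ?r)"
      using distinct_state(1)[OF B, of e1 "i # w"] by (auto simp: BB)
    have "block_count (state_points s B (i # w)) \<pi> = block_count ([?u] @ ?t # ?a # ?b # ?r) \<pi>"
      by (rule block_count_cong[OF \<pi>(1)])
        (auto simp: state_points_def BB alt_edges_append even_length_open_points
          const_on_edges_Un const_on_edges_insert)
    also have "\<dots> = block_count ([?u] @ ?b # ?r) (unpair ?t ?a \<pi>)"
      using dist \<pi> set by (intro block_count_unpair_odd) auto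
    also have "\<dots> = block_count (state_points (Suc s) ?B w) (unpair ?t ?a \<pi>)"
    proof (rule block_count_cong)
      have "set ([?u] @ ?b # ?r) = ?V - {?t, ?a}" unfolding V' by (auto simp: state_points_def)
      then show "unpair ?t ?a \<pi> \<in> pairings (set ([?u] @ ?b # ?r))"
        using unpair_in_pairings[OF \<pi>] by simp
    qed (auto simp: state_points_def alt_edges_append even_length_open_points
          const_on_edges_Un const_on_edges_insert)
    finally show ?thesis by (simp add: weight_def)
  qed
  have "(\<Sum>\<pi> | \<pi> \<in> planar_pairings s B (i # w) \<and> \<pi> ?a = ?t \<and> \<pi> ?b \<notin> Op. weight c s B (i # w) \<pi>) =
    (\<Sum>\<pi> | \<pi> \<in> planar_pairings s B (i # w) \<and> \<pi> ?a = ?t \<and> \<pi> ?b \<notin> Op. weight c (Suc s) ?B w (unpair ?t ?a \<pi>))"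
    by (intro sum.cong w) auto
  also have "\<dots> = (\<Sum>\<pi>\<in>planar_pairings (Suc s) ?B w. weight c (Suc s) ?B w \<pi>)"
    by (rule sum.reindex_bij_betw[OF bij])
  finally show "(\<Sum>\<pi> | \<pi> \<in> planar_pairings s B (i # w) \<and> \<pi> ?a = ?t \<and> \<pi> ?b \<notin> Op. weight c s B (i # w) \<pi>) =
    (\<Sum>\<pi>\<in>planar_pairings (Suc s) ?B w. weight c (Suc s) ?B w \<pi>)" .
qed

text \<open>Two removals: the first splices the letter into the block, and the second takes away the
  two points left over, which by then are joined only to each other. This finished component is the
  factor \<open>c\<close>.\<close>

lemma sum_close:
  assumes BB: "B = (f, l, i) # B2"
  shows "(\<Sum>\<pi> | \<pi> \<in> planar_pairings s B (i # w) \<and> \<pi> (s, e1 i) = (l, \<not> e1 i) \<and> \<pi> (s, \<not> e1 i) = (f, e1 i).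
      weight c s B (i # w) \<pi>) =
    c * (\<Sum>\<pi>\<in>planar_pairings (Suc s) B2 w. weight c (Suc s) B2 w \<pi>)"
    and "valid_blocks (Suc s) B2"
proof -
  let ?a = "(s, e1 i)" and ?b = "(s, \<not> e1 i)" and ?t = "(l, \<not> e1 i)" and ?u = "(f, e1 i)"
  let ?V = "set (state_points s B (i # w))"
  let ?nc = "\<lambda>e \<pi>. noncrossing \<pi> (open_points e B) (factor_points e s (i # w))"
  let ?nc' = "\<lambda>e \<pi>. noncrossing \<pi> (open_points e B2) (factor_points e (Suc s) w)"
  let ?h = "\<lambda>\<pi>. unpair ?u ?b (unpair ?t ?a \<pi>)"
  show v: "valid_blocks (Suc s) B2"
    using B by (auto simp: valid_blocks_def BB)
  have tu: "{(l, \<not> e2 i), (f, e2 i)} = {?t, ?u}"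
    using B by (auto simp: valid_blocks_def BB)
  have Op: "Op = insert ?t (insert ?u (set (open_points e1 B2)))" by (simp add: BB)
  have fl: "f < s" "l < s" using B by (auto simp: valid_blocks_def BB)
  have d1: "distinct (?t # ?u # open_points e1 B2)"
    using B by (simp add: valid_blocks_def BB)
  have "\<forall>x\<in>{(l, \<not> e2 i), (f, e2 i)}. x \<notin> set (open_points e2 B2)"
    using B by (simp add: valid_blocks_def BB)
  then have d2: "?t \<notin> set (open_points e2 B2)" "?u \<notin> set (open_points e2 B2)"
    unfolding tu by simp_all
  have fresh2: "(s, b) \<notin> set (open_points e2 B2)" for b
    using s_fresh(1) open_points_eq_set[OF B] by (auto simp: BB)
  have rest: "x \<notin> set (factor_points e (Suc s) w)" if "x \<in> {?t, ?a, ?u, ?b}" for x e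
    using that Op_rest[of ?t e] Op_rest[of ?u e] s_fresh(2) Op by auto
  have ne: "?t \<noteq> ?u" "?t \<noteq> ?a" "?t \<noteq> ?b" "?u \<noteq> ?a" "?u \<noteq> ?b"
    using d1 s_fresh(1) Op by auto
  have V': "?V - {?t, ?a} - {?u, ?b} = set (state_points (Suc s) B2 w)"
    using d1 s_fresh rest fl Op by (auto simp: state_points_def BB)
  have nc: "?nc e \<pi> \<longleftrightarrow> ?nc' e (?h \<pi>)"
    if e: "e = e1 \<or> e = e2" and \<pi>: "\<pi> ?t = ?a" "\<pi> ?u = ?b" for e \<pi>
  proof -
    \<comment> \<open>In a leg that reverses the letter the block has one element, so its two points
      are exchanged as well and the two contracted pairs swap roles.\<close>
    have "\<pi> (l, \<not> e i) = (s, e i) \<and> \<pi> (f, e i) = (s, \<not> e i)"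
    proof (cases "e i = e1 i")
      case False
      then have "e2 i \<noteq> e1 i" using e by auto
      then have "f = l" using B by (auto simp: valid_blocks_def BB)
      then show ?thesis using False \<pi> by auto
    qed (use \<pi> in auto)
    then have *: "?nc e \<pi> \<longleftrightarrow> ?nc' e \<pi>" by (simp add: BB)
    have d': "?t \<notin> set (open_points e B2)" "?u \<notin> set (open_points e B2)"
      by (rule disjE[OF e]; use d1 d2 in simp)+
    have s': "(s, b) \<notin> set (open_points e B2)" for b
      by (rule disjE[OF e]; use s_fresh(1)[of b] fresh2[of b] Op in simp)
    note *
    also have "?nc' e \<pi> \<longleftrightarrow> ?nc' e (unpair ?t ?a \<pi>)"
      using d' rest s' by (intro noncrossing_unpair[symmetric]) simp_all
    also have "\<dots> \<longleftrightarrow> ?nc' e (?h \<pi>)"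
      using d' rest s' by (intro noncrossing_unpair[symmetric]) simp_all
    finally show ?thesis .
  qed
  have ta: "?t \<in> ?V" "?a \<in> ?V" and ub: "?u \<in> ?V - {?t, ?a}" "?b \<in> ?V - {?t, ?a}"
    using ne Op by (auto simp: set_state_Cons)
  have inv_ta: "\<pi> ?a = ?t \<longleftrightarrow> \<pi> ?t = ?a" "\<pi> ?b = ?u \<longleftrightarrow> \<pi> ?u = ?b" if "\<pi> \<in> pairings ?V" for \<pi>
    using pairingsD(3)[OF that] by metis+
  have "bij_betw (unpair ?t ?a)
      {\<pi> \<in> pairings ?V. \<pi> ?t = ?a \<and> (\<pi> ?u = ?b \<and> admissible r ?V \<pi> \<and> ?nc e1 \<pi> \<and> ?nc e2 \<pi>)}
      {\<tau> \<in> pairings (?V - {?t, ?a}). \<tau> ?u = ?b \<and> (admissible r (?V - {?t, ?a}) \<tau> \<and>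
        ?nc' e1 (unpair ?u ?b \<tau>) \<and> ?nc' e2 (unpair ?u ?b \<tau>))}"
  proof (rule bij_betw_unpair_Collect[OF ta ne(2)])
    fix \<pi> assume \<pi>: "\<pi> \<in> pairings ?V" "\<pi> ?t = ?a"
    have "admissible r ?V \<pi> \<longleftrightarrow> admissible r (?V - {?t, ?a}) (unpair ?t ?a \<pi>)"
      by (rule admissible_unpair[OF \<pi>(1) ta(1) \<pi>(2)]) simp
    moreover have "unpair ?t ?a \<pi> ?u = \<pi> ?u" using ne by (intro unpair_apply) auto
    ultimately show "(\<pi> ?u = ?b \<and> admissible r ?V \<pi> \<and> ?nc e1 \<pi> \<and> ?nc e2 \<pi>) =
      (unpair ?t ?a \<pi> ?u = ?b \<and> (admissible r (?V - {?t, ?a}) (unpair ?t ?a \<pi>) \<and> ?nc' e1 (?h \<pi>) \<and> ?nc' e2 (?h \<pi>)))"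
      using nc[of e1 \<pi>] nc[of e2 \<pi>] \<pi>(2) by auto
  qed
  moreover have "bij_betw (unpair ?u ?b)
      {\<tau> \<in> pairings (?V - {?t, ?a}). \<tau> ?u = ?b \<and> (admissible r (?V - {?t, ?a}) \<tau> \<and>
        ?nc' e1 (unpair ?u ?b \<tau>) \<and> ?nc' e2 (unpair ?u ?b \<tau>))}
      {\<tau> \<in> pairings (?V - {?t, ?a} - {?u, ?b}). admissible r (?V - {?t, ?a} - {?u, ?b}) \<tau> \<and> ?nc' e1 \<tau> \<and> ?nc' e2 \<tau>}"
  proof (rule bij_betw_unpair_Collect[OF ub ne(5)])
    fix \<tau> assume \<tau>: "\<tau> \<in> pairings (?V - {?t, ?a})" "\<tau> ?u = ?b"
    have "admissible r (?V - {?t, ?a}) \<tau> \<longleftrightarrow> admissible r (?V - {?t, ?a} - {?u, ?b}) (unpair ?u ?b \<tau>)"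
      by (rule admissible_unpair[OF \<tau>(1) ub(1) \<tau>(2)]) simp
    then show "(admissible r (?V - {?t, ?a}) \<tau> \<and> ?nc' e1 (unpair ?u ?b \<tau>) \<and> ?nc' e2 (unpair ?u ?b \<tau>)) =
      (admissible r (?V - {?t, ?a} - {?u, ?b}) (unpair ?u ?b \<tau>) \<and> ?nc' e1 (unpair ?u ?b \<tau>) \<and> ?nc' e2 (unpair ?u ?b \<tau>))"
      by simp
  qed
  ultimately have "bij_betw (unpair ?u ?b \<circ> unpair ?t ?a)
      {\<pi> \<in> pairings ?V. \<pi> ?t = ?a \<and> (\<pi> ?u = ?b \<and> admissible r ?V \<pi> \<and> ?nc e1 \<pi> \<and> ?nc e2 \<pi>)}
      {\<tau> \<in> pairings (?V - {?t, ?a} - {?u, ?b}). admissible r (?V - {?t, ?a} - {?u, ?b}) \<tau> \<and> ?nc' e1 \<tau> \<and> ?nc' e2 \<tau>}"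
    by (rule bij_betw_trans)
  also have "unpair ?u ?b \<circ> unpair ?t ?a = ?h" by (simp add: fun_eq_iff)
  also have "{\<pi> \<in> pairings ?V. \<pi> ?t = ?a \<and> (\<pi> ?u = ?b \<and> admissible r ?V \<pi> \<and> ?nc e1 \<pi> \<and> ?nc e2 \<pi>)} =
      {\<pi> \<in> planar_pairings s B (i # w). \<pi> ?a = ?t \<and> \<pi> ?b = ?u}"
    unfolding planar_pairings_def using inv_ta by blast
  also have "{\<tau> \<in> pairings (?V - {?t, ?a} - {?u, ?b}). admissible r (?V - {?t, ?a} - {?u, ?b}) \<tau> \<and> ?nc' e1 \<tau> \<and> ?nc' e2 \<tau>} =
      planar_pairings (Suc s) B2 w"
    unfolding V' planar_pairings_def ..
  finally have bij: "bij_betw ?h {\<pi> \<in> planar_pairings s B (i # w). \<pi> ?a = ?t \<and> \<pi> ?b = ?u}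
      (planar_pairings (Suc s) B2 w)" .
  have w: "weight c s B (i # w) \<pi> = c * weight c (Suc s) B2 w (?h \<pi>)"
    if "\<pi> \<in> planar_pairings s B (i # w)" "\<pi> ?a = ?t" "\<pi> ?b = ?u" for \<pi>
  proof -
    let ?r = "open_points e1 B2 @ factor_points e1 (Suc s) w"
    let ?s = "unpair ?t ?a \<pi>"
    have \<pi>: "\<pi> \<in> pairings ?V" "\<pi> ?t = ?a" "\<pi> ?u = ?b" using that inv_ta by (auto simp: planar_pairings_def)
    have set: "set ([?u] @ ?t # ?a # ?b # ?r) = ?V" by (auto simp: state_points_def BB)
    have dist: "distinct ([?u] @ ?t # ?a # ?b # ?r)"
      using distinct_state(1)[OF B, of e1 "i # w"] by (auto simp: BB)
    have "block_count (state_points s B (i # w)) \<pi> = block_count ([?u] @ ?t # ?a # ?b # ?r) \<pi>"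
      by (rule block_count_cong[OF \<pi>(1)])
        (auto simp: state_points_def BB alt_edges_append even_length_open_points
          const_on_edges_Un const_on_edges_insert)
    also have "\<dots> = block_count ([?u] @ ?b # ?r) ?s"
      using dist \<pi> set by (intro block_count_unpair_odd) auto
    also have "\<dots> = block_count ([] @ ?u # ?b # ?r) ?s" by simp
    also have "\<dots> = Suc (block_count ([] @ ?r) (?h \<pi>))"
    proof (rule block_count_unpair_even)
      have "set ([] @ ?u # ?b # ?r) = ?V - {?t, ?a}" using dist unfolding set[symmetric] by auto
      then show "?s \<in> pairings (set ([] @ ?u # ?b # ?r))"
        using unpair_in_pairings[OF \<pi>(1,2)] by simp
      show "?s ?u = ?b" using \<pi>(3) ne by simp
    qed (use dist in auto)
    finally show ?thesis by (simp add: weight_def state_points_def)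
  qed
  have "(\<Sum>\<pi> | \<pi> \<in> planar_pairings s B (i # w) \<and> \<pi> ?a = ?t \<and> \<pi> ?b = ?u. weight c s B (i # w) \<pi>) =
    (\<Sum>\<pi> | \<pi> \<in> planar_pairings s B (i # w) \<and> \<pi> ?a = ?t \<and> \<pi> ?b = ?u. c * weight c (Suc s) B2 w (?h \<pi>))"
    by (intro sum.cong w) auto
  also have "\<dots> = (\<Sum>\<pi>\<in>planar_pairings (Suc s) B2 w. c * weight c (Suc s) B2 w \<pi>)"
    by (rule sum.reindex_bij_betw[OF bij])
  finally show "(\<Sum>\<pi> | \<pi> \<in> planar_pairings s B (i # w) \<and> \<pi> ?a = ?t \<and> \<pi> ?b = ?u. weight c s B (i # w) \<pi>) =
    c * (\<Sum>\<pi>\<in>planar_pairings (Suc s) B2 w. weight c (Suc s) B2 w \<pi>)"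
    by (simp add: sum_distrib_left)
qed

text \<open>In the complex case partners are of opposite kinds, which ties the flags together; in
  the real case the first flag is always true.\<close>

lemma first_flag:
  assumes "\<pi> \<in> planar_pairings s B (i # w)" "\<pi> (s, e1 i) = (l, \<not> e1 j)" "j \<in> \<Lambda>"
  shows "e1 i = e1 j"
proof (cases r)
  case True
  then show ?thesis using flags_real i assms(3) by simp
next
  case False
  have "admissible r (set (state_points s B (i # w))) \<pi>" "(s, e1 i) \<in> set (state_points s B (i # w))"
    using assms(1) by (auto simp: planar_pairings_def set_state_Cons)
  then have "snd (s, e1 i) \<noteq> snd (\<pi> (s, e1 i))" using False unfolding admissible_def by blast
  then show ?thesis using assms(2) by simp
qed

text \<open>If the legs read the letter in opposite orders, then \<open>planar_second\<close> in the
  second leg would send the other point to an open point too. With equal orders both legs name the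
  same partner, so the open block is not partially transposed either, and the first flags
  agree.\<close>

lemma planar_continue:
  assumes \<pi>: "\<pi> \<in> planar_pairings s B (i # w)" and a: "\<pi> (s, e1 i) \<in> Op" and b: "\<pi> (s, \<not> e1 i) \<notin> Op"
  shows "\<exists>f l B2. B = (f, l, i) # B2 \<and> e1 i = e2 i \<and> \<pi> (s, e1 i) = (l, \<not> e1 i)"
proof -
  have ee: "e1 i = e2 i"
  proof (rule ccontr)
    assume "e1 i \<noteq> e2 i"
    then have "(s, e2 i) = (s, \<not> e1 i)" "(s, \<not> e2 i) = (s, e1 i)" by auto
    then show False using planar_second[of e2 \<pi>] \<pi> a b by simp
  qed
  obtain f l j B2 where 1: "B = (f, l, j) # B2" "\<pi> (s, e1 i) = (l, \<not> e1 j)"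
    using planar_first[of e1 \<pi>] \<pi> a by blast
  have j: "j \<in> \<Lambda>" using B by (simp add: valid_blocks_def 1)
  have "\<pi> (s, e2 i) = (l, \<not> e2 j)"
    using planar_first[of e2 \<pi>] \<pi> a ee 1(1) by auto
  then have "e1 j = e2 j" using 1(2) ee by simp
  moreover have "e1 i = e1 j" by (rule first_flag[OF \<pi> 1(2) j])
  ultimately have "i = j" using flags_inj[OF i j] ee by simp
  then show ?thesis using 1 ee by blast
qed

text \<open>The first leg fixes both partners, and the second leg prescribes the partner of its own
  first point. Matching the two descriptions yields equality of the second flags, also when the legs
  read the letter in opposite orders.\<close>

lemma planar_close:
  assumes \<pi>: "\<pi> \<in> planar_pairings s B (i # w)" and a: "\<pi> (s, e1 i) \<in> Op" and b: "\<pi> (s, \<not> e1 i) \<in> Op"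
  shows "\<exists>f l B2. B = (f, l, i) # B2 \<and> \<pi> (s, e1 i) = (l, \<not> e1 i) \<and> \<pi> (s, \<not> e1 i) = (f, e1 i)"
proof -
  obtain f l j B2 where 1: "B = (f, l, j) # B2" "\<pi> (s, e1 i) = (l, \<not> e1 j)" "\<pi> (s, \<not> e1 i) = (f, e1 j)"
    using planar_first[of e1 \<pi>] \<pi> a b by blast
  have j: "j \<in> \<Lambda>" using B by (simp add: valid_blocks_def 1)
  have "\<pi> (s, e2 i) \<in> Op" using a b by (cases "e2 i = e1 i") auto
  then have 2: "\<pi> (s, e2 i) = (l, \<not> e2 j)"
    using planar_first[of e2 \<pi>] \<pi> 1(1) by auto
  have 3: "e1 i = e1 j" by (rule first_flag[OF \<pi> 1(2) j])
  have "e2 i = e2 j"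
  proof (cases "e2 i = e1 i")
    case True
    then show ?thesis using 1(2) 2 3 by simp
  next
    case False
    then have "(s, e2 i) = (s, \<not> e1 i)" by auto
    then show ?thesis using 1(3) 2 3 False by simp
  qed
  then have "i = j" using flags_inj[OF i j] 3 by simp
  then show ?thesis using 1 by blast
qed

text \<open>
  With \<open>a\<close> and \<open>b\<close> the two points of the next letter, the four sums are the cases in which the letter
  opens a block, is a singleton, continues a block and closes a block.
\<close>

lemma sum_planar_Cons:
  "(\<Sum>\<pi>\<in>planar_pairings s B (i # w). weight c s B (i # w) \<pi>) =
    (\<Sum>\<pi>\<in>planar_pairings (Suc s) ((s, s, i) # B) w. weight c (Suc s) ((s, s, i) # B) w \<pi>) +
    c * (\<Sum>\<pi>\<in>planar_pairings (Suc s) B w. weight c (Suc s) B w \<pi>) +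
    (\<Sum>\<pi> | \<pi> \<in> planar_pairings s B (i # w) \<and> \<pi> (s, e1 i) \<in> Op \<and> \<pi> (s, \<not> e1 i) \<notin> Op. weight c s B (i # w) \<pi>) +
    (\<Sum>\<pi> | \<pi> \<in> planar_pairings s B (i # w) \<and> \<pi> (s, e1 i) \<in> Op \<and> \<pi> (s, \<not> e1 i) \<in> Op. weight c s B (i # w) \<pi>)"
proof -
  let ?a = "(s, e1 i)" and ?b = "(s, \<not> e1 i)" and ?S = "planar_pairings s B (i # w)"
  let ?f = "weight c s B (i # w)"
  have fin: "finite {\<pi>. \<pi> \<in> ?S \<and> P \<pi>}" for P using finite_planar_pairings by simp
  have "\<pi> ?b \<notin> Op" if "\<pi> \<in> ?S" "\<pi> ?a \<notin> Op" for \<pi>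
    using planar_second[of e1 \<pi>] that by blast
  then have "?S = {\<pi>. \<pi> \<in> ?S \<and> \<pi> ?a \<notin> Op \<and> \<pi> ?b \<notin> Op \<and> \<pi> ?a \<noteq> ?b} \<union> {\<pi>. \<pi> \<in> ?S \<and> \<pi> ?a = ?b} \<union>
      {\<pi>. \<pi> \<in> ?S \<and> \<pi> ?a \<in> Op \<and> \<pi> ?b \<notin> Op} \<union> {\<pi>. \<pi> \<in> ?S \<and> \<pi> ?a \<in> Op \<and> \<pi> ?b \<in> Op}"
    (is "_ = ?S1 \<union> ?S2 \<union> ?S3 \<union> ?S4") by blast
  then have "sum ?f ?S = sum ?f (?S1 \<union> ?S2 \<union> ?S3 \<union> ?S4)" by (rule arg_cong)
  also have "\<dots> = sum ?f (?S1 \<union> ?S2 \<union> ?S3) + sum ?f ?S4"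
    using s_fresh(1) by (intro sum.union_disjoint finite_UnI fin) auto
  also have "sum ?f (?S1 \<union> ?S2 \<union> ?S3) = sum ?f (?S1 \<union> ?S2) + sum ?f ?S3"
    using s_fresh(1) by (intro sum.union_disjoint finite_UnI fin) auto
  also have "sum ?f (?S1 \<union> ?S2) = sum ?f ?S1 + sum ?f ?S2"
    by (intro sum.union_disjoint fin) auto
  finally show ?thesis by (simp only: sum_open sum_single)
qed

end

text \<open>The four cases for the next letter are the summands of \<open>path_weight\<close>;
  positions drop out, and of the open blocks only the letters matter.\<close>

lemma sum_planar_pairings:
  assumes "valid_blocks s B" "set w \<subseteq> \<Lambda>"
  shows "(\<Sum>\<pi>\<in>planar_pairings s B w. weight c s B w \<pi>) = path_weight c q (map (\<lambda>(f, l, i). i) B) w"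
  using assms
proof (induction w arbitrary: s B)
  case Nil
  show ?case
  proof (cases B)
    case Nil
    then show ?thesis
      by (simp add: planar_pairings_def admissible_def weight_def block_count_def state_points_def)
  next
    case (Cons b B')
    then have "open_points e1 B \<noteq> []" by (cases b) auto
    then show ?thesis using Cons by (simp add: planar_pairings_def)
  qed
next
  case (Cons i w)
  have i: "i \<in> \<Lambda>" and w: "set w \<subseteq> \<Lambda>" using Cons.prems(2) by auto
  note B = Cons.prems(1)
  have "valid_blocks (Suc s) B" using B by (fastforce simp: valid_blocks_def)
  note IH = Cons.IH[OF valid_open[OF B i] w] Cons.IH[OF this w]
  let ?S = "planar_pairings s B (i # w)"
  let ?S3 = "{\<pi>. \<pi> \<in> ?S \<and> \<pi> (s, e1 i) \<in> set (open_points e1 B) \<and> \<pi> (s, \<not> e1 i) \<notin> set (open_points e1 B)}"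
  let ?S4 = "{\<pi>. \<pi> \<in> ?S \<and> \<pi> (s, e1 i) \<in> set (open_points e1 B) \<and> \<pi> (s, \<not> e1 i) \<in> set (open_points e1 B)}"
  have "sum (weight c s B (i # w)) ?S3 + sum (weight c s B (i # w)) ?S4 =
    (case map (\<lambda>(f, l, i). i) B of [] \<Rightarrow> 0
      | j # st' \<Rightarrow> if j = i then q i * path_weight c q (map (\<lambda>(f, l, i). i) B) w + c * path_weight c q st' w else 0)"
  proof (cases "\<exists>f l B2. B = (f, l, i) # B2")
    case False
    then have "?S3 = {}" "?S4 = {}"
      using planar_continue[OF B i] planar_close[OF B i] by blast+
    moreover have "(case map (\<lambda>(f, l, i). i) B of [] \<Rightarrow> 0
      | j # st' \<Rightarrow> if j = i then q i * path_weight c q (map (\<lambda>(f, l, i). i) B) w + c * path_weight c q st' w else 0) = 0"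
      using False by (auto split: list.split)
    ultimately show ?thesis by (simp only: sum.empty add_0_right)
  next
    case True
    then obtain f l B2 where BB: "B = (f, l, i) # B2" by blast
    have "?S4 = {\<pi>. \<pi> \<in> ?S \<and> \<pi> (s, e1 i) = (l, \<not> e1 i) \<and> \<pi> (s, \<not> e1 i) = (f, e1 i)}" (is "_ = ?R")
    proof
      show "?S4 \<subseteq> ?R" using planar_close[OF B i] BB by auto
      show "?R \<subseteq> ?S4" by (auto simp: BB)
    qed
    then have 4: "sum (weight c s B (i # w)) ?S4 = c * path_weight c q (map (\<lambda>(f, l, i). i) B2) w"
      using sum_close(1)[OF B i BB] Cons.IH[OF sum_close(2)[OF B i BB] w] by simp
    have 3: "sum (weight c s B (i # w)) ?S3 = q i * path_weight c q (map (\<lambda>(f, l, i). i) B) w"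
    proof (cases "e1 i = e2 i")
      case True
      have "?S3 = {\<pi>. \<pi> \<in> ?S \<and> \<pi> (s, e1 i) = (l, \<not> e1 i) \<and> \<pi> (s, \<not> e1 i) \<notin> set (open_points e1 B)}" (is "_ = ?R")
      proof
        show "?S3 \<subseteq> ?R" using planar_continue[OF B i] BB by auto
        show "?R \<subseteq> ?S3" by (auto simp: BB)
      qed
      then have "sum (weight c s B (i # w)) ?S3 = path_weight c q (map (\<lambda>(f, l, i). i) B) w"
        using sum_continue(1)[OF B i BB True] Cons.IH[OF sum_continue(2)[OF B i BB True] w]
        by (simp add: BB)
      moreover have "q i = 1" using True by (simp add: q_eq)
      ultimately show ?thesis by simp
    next
      case False
      then have "?S3 = {}" using planar_continue[OF B i] by blast
      then show ?thesis using False by (simp only: sum.empty q_eq if_False mult_zero_left)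
    qed
    show ?thesis unfolding 3 4 by (simp add: BB)
  qed
  then show ?case
    using sum_planar_Cons[OF B i, of c w] IH by (simp add: algebra_simps)
qed

end

section \<open>The Wick formula\<close>

definition compatible_pairings :: "('v \<Rightarrow> 'v \<Rightarrow> bool) \<Rightarrow> 'v set \<Rightarrow> ('v \<Rightarrow> 'v) set" where
  "compatible_pairings R V = {\<pi> \<in> pairings V. \<forall>x\<in>V. R x (\<pi> x)}"

text \<open>Classification by the partner of a chosen point, the combinatorial counterpart of one
  integration by parts.\<close>

lemma card_compatible_pairings_first:
  assumes "finite V" "x \<in> V" and sym: "\<And>x y. R x y \<Longrightarrow> R y x"
  shows "card (compatible_pairings R V) =
    (\<Sum>y | y \<in> V - {x} \<and> R x y. card (compatible_pairings R (V - {x, y})))"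
proof -
  let ?Y = "{y. y \<in> V - {x} \<and> R x y}"
  let ?P = "\<lambda>\<pi>. \<forall>w\<in>V. R w (\<pi> w)"
  have "\<pi> x \<in> ?Y" if "\<pi> \<in> compatible_pairings R V" for \<pi>
    using that assms(2) pairingsD(1,2)[of \<pi> V x] by (auto simp: compatible_pairings_def)
  then have "compatible_pairings R V = (\<Union>y\<in>?Y. {\<pi> \<in> pairings V. \<pi> x = y \<and> ?P \<pi>})"
    by (auto simp: compatible_pairings_def)
  then have "card (compatible_pairings R V) = card (\<Union>y\<in>?Y. {\<pi> \<in> pairings V. \<pi> x = y \<and> ?P \<pi>})"
    by simp
  also have "\<dots> = (\<Sum>y\<in>?Y. card {\<pi> \<in> pairings V. \<pi> x = y \<and> ?P \<pi>})"
    using assms(1) by (intro card_UN_disjoint) (auto intro: finite_subset[OF _ finite_pairings])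
  also have "\<dots> = (\<Sum>y\<in>?Y. card (compatible_pairings R (V - {x, y})))"
  proof (rule sum.cong)
    fix y assume y: "y \<in> ?Y"
    have "bij_betw (unpair x y) {\<pi> \<in> pairings V. \<pi> x = y \<and> ?P \<pi>}
        {\<tau> \<in> pairings (V - {x, y}). \<forall>w\<in>V - {x, y}. R w (\<tau> w)}"
    proof (rule bij_betw_unpair_Collect)
      fix \<pi> assume \<pi>: "\<pi> \<in> pairings V" "\<pi> x = y"
      then have "\<pi> y = x" using pairingsD(3)[of \<pi> V x] by simp
      show "?P \<pi> \<longleftrightarrow> (\<forall>w\<in>V - {x, y}. R w (unpair x y \<pi> w))"
      proof
        assume "?P \<pi>"
        then show "\<forall>w\<in>V - {x, y}. R w (unpair x y \<pi> w)" by simp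
      next
        assume R: "\<forall>w\<in>V - {x, y}. R w (unpair x y \<pi> w)"
        show "?P \<pi>"
        proof
          fix w assume "w \<in> V"
          show "R w (\<pi> w)"
          proof (cases "w = x \<or> w = y")
            case True
            then show ?thesis using y sym \<pi>(2) \<open>\<pi> y = x\<close> by auto
          next
            case False
            then have "w \<in> V - {x, y}" using \<open>w \<in> V\<close> by simp
            from R[rule_format, OF this] show ?thesis using False by simp
          qed
        qed
      qed
    qed (use assms(2) y in auto)
    then show "card {\<pi> \<in> pairings V. \<pi> x = y \<and> ?P \<pi>} = card (compatible_pairings R (V - {x, y}))"
      by (simp add: compatible_pairings_def bij_betw_same_card)
  qed simp
  finally show ?thesis .
qed

text \<open>
  The recursions for \<open>m a b = E (Z\<^sup>a (cnj Z)\<^sup>b)\<close> given by Gaussian integration by parts: \<open>r\<close> holds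
  for a real variable \<open>Z\<close>, where a factor can also be contracted with one of its own kind.
\<close>

definition wick_moments :: "bool \<Rightarrow> (nat \<Rightarrow> nat \<Rightarrow> complex) \<Rightarrow> bool" where
  "wick_moments r m \<longleftrightarrow> m 0 0 = 1 \<and>
     (\<forall>a b. m (Suc a) b = (if r then of_nat a * m (a - 1) b else 0) + of_nat b * m a (b - 1)) \<and>
     (\<forall>a b. m a (Suc b) = of_nat a * m (a - 1) b + (if r then of_nat b * m a (b - 1) else 0))"

definition wick_rel :: "bool \<Rightarrow> ('p \<times> bool \<Rightarrow> 'v) \<Rightarrow> 'p \<times> bool \<Rightarrow> 'p \<times> bool \<Rightarrow> bool" where
  "wick_rel r idx x y \<longleftrightarrow> idx x = idx y \<and> (r \<or> snd x \<noteq> snd y)"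

definition occurrences :: "('p \<times> bool \<Rightarrow> 'v) \<Rightarrow> ('p \<times> bool) set \<Rightarrow> 'v \<Rightarrow> bool \<Rightarrow> ('p \<times> bool) set" where
  "occurrences idx V v b = {x \<in> V. idx x = v \<and> snd x = b}"

text \<open>Remove one point \<open>x\<close>. The recursion for the moments of its variable is a
  sum over the possible partners of \<open>x\<close>, and the counts for the other variables do not
  change.\<close>

lemma wick_formula:
  assumes m: "\<And>v. v \<in> I \<Longrightarrow> wick_moments r (m v)" and fin: "finite V" "finite I" and idx: "\<And>x. x \<in> V \<Longrightarrow> idx x \<in> I"
  shows "(\<Prod>v\<in>I. m v (card (occurrences idx V v True)) (card (occurrences idx V v False))) =
    of_nat (card (compatible_pairings (wick_rel r idx) V))"
  using fin(1) idx
proof (induction "card V" arbitrary: V rule: less_induct)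
  case less
  let ?F = "\<lambda>v V. m v (card (occurrences idx V v True)) (card (occurrences idx V v False))"
  let ?R = "wick_rel r idx"
  show ?case
  proof (cases "V = {}")
    case True
    then show ?thesis using m by (simp add: wick_moments_def occurrences_def compatible_pairings_def)
  next
    case False
    then obtain x where x: "x \<in> V" by blast
    define v where "v = idx x"
    define b where "b = snd x"
    have vI: "v \<in> I" using less.prems(2)[OF x] by (simp add: v_def)
    \<comment> \<open>The arguments are ordered so that the kind of \<open>x\<close> comes first,
      which treats a factor and a conjugate alike.\<close>
    define mm where "mm p q = (if b then m v p q else m v q p)" for p q
    have F: "?F v V = mm (card (occurrences idx V v b)) (card (occurrences idx V v (\<not> b)))" for V
      by (cases b) (simp_all add: mm_def)
    have mm: "mm (Suc p) q = (if r then of_nat p * mm (p - 1) q else 0) + of_nat q * mm p (q - 1)" for p q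
      using m[OF vI] by (auto simp: mm_def wick_moments_def)
    let ?A = "occurrences idx (V - {x}) v b" and ?B = "occurrences idx (V - {x}) v (\<not> b)"
    have finAB: "finite ?A" "finite ?B" using less.prems(1) by (auto simp: occurrences_def)
    have "occurrences idx V v b = insert x ?A" "x \<notin> ?A" "occurrences idx V v (\<not> b) = ?B"
      using x by (auto simp: occurrences_def v_def b_def)
    then have "?F v V = mm (Suc (card ?A)) (card ?B)" using finAB by (simp add: F)
    also have "\<dots> = (\<Sum>y\<in>{y\<in>?A. r}. ?F v (V - {x, y})) + (\<Sum>y\<in>?B. ?F v (V - {x, y}))"
    proof -
      have "?F v (V - {x, y}) = mm (card ?A - 1) (card ?B)" if "y \<in> ?A" for y
      proof -
        have "occurrences idx (V - {x, y}) v b = ?A - {y}" "occurrences idx (V - {x, y}) v (\<not> b) = ?B"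
          using that by (auto simp: occurrences_def)
        then show ?thesis using that finAB by (simp add: F)
      qed
      moreover have "?F v (V - {x, y}) = mm (card ?A) (card ?B - 1)" if "y \<in> ?B" for y
      proof -
        have "occurrences idx (V - {x, y}) v b = ?A" "occurrences idx (V - {x, y}) v (\<not> b) = ?B - {y}"
          using that by (auto simp: occurrences_def)
        then show ?thesis using that finAB by (simp add: F)
      qed
      ultimately show ?thesis by (simp add: mm)
    qed
    also have "\<dots> = (\<Sum>y\<in>{y\<in>?A. r} \<union> ?B. ?F v (V - {x, y}))"
      using less.prems(1) by (intro sum.union_disjoint[symmetric]) (auto simp: occurrences_def)
    also have "{y\<in>?A. r} \<union> ?B = {y. y \<in> V - {x} \<and> ?R x y}"
      by (auto simp: occurrences_def wick_rel_def v_def b_def)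
    finally have Fv: "?F v V = (\<Sum>y | y \<in> V - {x} \<and> ?R x y. ?F v (V - {x, y}))" .
    have other: "?F u (V - {x, y}) = ?F u V" if "u \<noteq> v" "?R x y" for u y
    proof -
      have "occurrences idx (V - {x, y}) u c = occurrences idx V u c" for c
        using that by (auto simp: occurrences_def wick_rel_def v_def)
      then show ?thesis by simp
    qed
    have "(\<Prod>u\<in>I. ?F u V) = ?F v V * (\<Prod>u\<in>I - {v}. ?F u V)"
      using fin(2) vI by (rule prod.remove)
    also have "\<dots> = (\<Sum>y | y \<in> V - {x} \<and> ?R x y. ?F v (V - {x, y}) * (\<Prod>u\<in>I - {v}. ?F u V))"
      by (simp only: Fv sum_distrib_right)
    also have "\<dots> = (\<Sum>y | y \<in> V - {x} \<and> ?R x y. \<Prod>u\<in>I. ?F u (V - {x, y}))"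
    proof (rule sum.cong)
      fix y assume y: "y \<in> {y. y \<in> V - {x} \<and> ?R x y}"
      have "(\<Prod>u\<in>I. ?F u (V - {x, y})) = ?F v (V - {x, y}) * (\<Prod>u\<in>I - {v}. ?F u (V - {x, y}))"
        using fin(2) vI by (rule prod.remove)
      also have "(\<Prod>u\<in>I - {v}. ?F u (V - {x, y})) = (\<Prod>u\<in>I - {v}. ?F u V)"
        using y other by (intro prod.cong) auto
      finally show "?F v (V - {x, y}) * (\<Prod>u\<in>I - {v}. ?F u V) = (\<Prod>u\<in>I. ?F u (V - {x, y}))" by simp
    qed simp
    also have "\<dots> = (\<Sum>y | y \<in> V - {x} \<and> ?R x y. of_nat (card (compatible_pairings ?R (V - {x, y}))))"
    proof (rule sum.cong)
      fix y assume y: "y \<in> {y. y \<in> V - {x} \<and> ?R x y}"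
      have "V - {x, y} \<subset> V" using x by auto
      then show "(\<Prod>u\<in>I. ?F u (V - {x, y})) = of_nat (card (compatible_pairings ?R (V - {x, y})))"
        using less.prems psubset_card_mono[of V "V - {x, y}"] by (intro less.hyps) auto
    qed simp
    also have "\<dots> = of_nat (card (compatible_pairings ?R V))"
    proof -
      have "?R w y \<Longrightarrow> ?R y w" for w y by (auto simp: wick_rel_def)
      from card_compatible_pairings_first[of V x ?R, OF less.prems(1) x this] show ?thesis by simp
    qed
    finally show ?thesis .
  qed
qed

text \<open>Grouping the factors by variable gives a product of independent monomials, so the
  expectation is a product of single moments.\<close>

lemma (in prob_space) wick_expectation:
  fixes G :: "'v \<Rightarrow> 'a \<Rightarrow> complex" and V :: "('p \<times> bool) set"
  assumes indep: "indep_vars (\<lambda>_. borel) G I" and fin: "finite V" "finite I"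
    and idx: "\<And>x. x \<in> V \<Longrightarrow> idx x \<in> I"
    and int: "\<And>v a b. v \<in> I \<Longrightarrow> integrable M (\<lambda>\<omega>. G v \<omega> ^ a * cnj (G v \<omega>) ^ b)"
    and mom: "\<And>v. v \<in> I \<Longrightarrow> wick_moments r (\<lambda>a b. expectation (\<lambda>\<omega>. G v \<omega> ^ a * cnj (G v \<omega>) ^ b))"
  defines "h \<equiv> \<lambda>x \<omega>. if snd x then G (idx x) \<omega> else cnj (G (idx x) \<omega>)"
  shows "integrable M (\<lambda>\<omega>. \<Prod>x\<in>V. h x \<omega>)"
    and "expectation (\<lambda>\<omega>. \<Prod>x\<in>V. h x \<omega>) = of_nat (card (compatible_pairings (wick_rel r idx) V))"
proof -
  let ?a = "\<lambda>v. card (occurrences idx V v True)" and ?b = "\<lambda>v. card (occurrences idx V v False)"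
  have h: "(\<Prod>x\<in>V. h x \<omega>) = (\<Prod>v\<in>I. G v \<omega> ^ ?a v * cnj (G v \<omega>) ^ ?b v)" for \<omega>
  proof -
    have "(\<Prod>x\<in>V. h x \<omega>) = (\<Prod>v\<in>I. \<Prod>x\<in>{x \<in> V. idx x = v}. h x \<omega>)"
      using fin idx by (intro prod.group[symmetric]) auto
    also have "\<dots> = (\<Prod>v\<in>I. G v \<omega> ^ ?a v * cnj (G v \<omega>) ^ ?b v)"
    proof (rule prod.cong)
      fix v
      have "{x \<in> V. idx x = v} = occurrences idx V v True \<union> occurrences idx V v False"
        by (auto simp: occurrences_def)
      then have "(\<Prod>x\<in>{x \<in> V. idx x = v}. h x \<omega>) =
          (\<Prod>x\<in>occurrences idx V v True. h x \<omega>) * (\<Prod>x\<in>occurrences idx V v False. h x \<omega>)"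
        using fin(1) by (simp add: prod.union_disjoint occurrences_def disjoint_iff)
      also have "(\<Prod>x\<in>occurrences idx V v True. h x \<omega>) = (\<Prod>x\<in>occurrences idx V v True. G v \<omega>)"
        by (rule prod.cong) (auto simp: occurrences_def h_def)
      also have "(\<Prod>x\<in>occurrences idx V v False. h x \<omega>) = (\<Prod>x\<in>occurrences idx V v False. cnj (G v \<omega>))"
        by (rule prod.cong) (auto simp: occurrences_def h_def)
      finally show "(\<Prod>x\<in>{x \<in> V. idx x = v}. h x \<omega>) = G v \<omega> ^ ?a v * cnj (G v \<omega>) ^ ?b v"
        by simp
    qed simp
    finally show ?thesis .
  qed
  have ind: "indep_vars (\<lambda>_. borel) (\<lambda>v \<omega>. G v \<omega> ^ ?a v * cnj (G v \<omega>) ^ ?b v) I"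
    by (rule indep_vars_compose2[OF indep]) (intro borel_measurable_continuous_onI continuous_intros)
  show "integrable M (\<lambda>\<omega>. \<Prod>x\<in>V. h x \<omega>)"
    unfolding h using int by (intro indep_vars_integrable[OF fin(2) ind]) auto
  have "expectation (\<lambda>\<omega>. \<Prod>x\<in>V. h x \<omega>) = (\<Prod>v\<in>I. expectation (\<lambda>\<omega>. G v \<omega> ^ ?a v * cnj (G v \<omega>) ^ ?b v))"
    unfolding h using int by (intro indep_vars_lebesgue_integral[OF fin(2) ind]) auto
  also have "\<dots> = of_nat (card (compatible_pairings (wick_rel r idx) V))"
    using wick_formula[OF mom fin idx] by simp
  finally show "expectation (\<lambda>\<omega>. \<Prod>x\<in>V. h x \<omega>) = of_nat (card (compatible_pairings (wick_rel r idx) V))" .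
qed

section \<open>Moments of real and complex Gaussian variables\<close>

definition normal_moment :: "real \<Rightarrow> nat \<Rightarrow> real" where
  "normal_moment s n = (if even n then fact n / ((2 / s\<^sup>2) ^ (n div 2) * fact (n div 2)) else 0)"

text \<open>The even moments are \<open>s ^ n\<close> times the double factorial of
  \<open>n - 1\<close>, written as a quotient of factorials; this is their recursion.\<close>

lemma normal_moment_Suc:
  assumes "s > 0"
  shows "normal_moment s (Suc n) = s\<^sup>2 * real n * normal_moment s (n - 1)"
proof (cases "odd n")
  case True
  then obtain k where n: "n = Suc (2 * k)" by (auto elim: oddE)
  define D :: real where "D = (2 / s\<^sup>2) ^ k * fact k"
  define f :: real where "f = fact (2 * k)"
  have D: "D \<noteq> 0" using assms by (simp add: D_def)
  have "normal_moment s (Suc n) = fact (Suc (Suc (2 * k))) / ((2 / s\<^sup>2) ^ Suc k * fact (Suc k))"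
    by (simp add: normal_moment_def n)
  also have "fact (Suc (Suc (2 * k))) = (2 * real k + 2) * (2 * real k + 1) * f"
    by (simp add: f_def algebra_simps)
  also have "(2 / s\<^sup>2) ^ Suc k * fact (Suc k) = 2 / s\<^sup>2 * (real k + 1) * D"
    by (simp add: D_def algebra_simps)
  also have "(2 * real k + 2) * (2 * real k + 1) * f / (2 / s\<^sup>2 * (real k + 1) * D) = s\<^sup>2 * (2 * real k + 1) * (f / D)"
  proof -
    have "2 * real k + 2 = 2 * (real k + 1)" by simp
    then show ?thesis using assms D by (simp add: divide_simps del: distrib_left_numeral)
  qed
  also have "\<dots> = s\<^sup>2 * real n * normal_moment s (n - 1)"
    by (simp add: normal_moment_def n f_def D_def)
  finally show ?thesis .
qed (auto simp: normal_moment_def)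

lemma (in prob_space) normal_distributed_moment:
  assumes "distributed M lborel X (normal_density 0 s)" "s > 0"
  shows "integrable M (\<lambda>\<omega>. X \<omega> ^ n)" and "expectation (\<lambda>\<omega>. X \<omega> ^ n) = normal_moment s n"
proof -
  have "has_bochner_integral lborel (\<lambda>x. normal_density 0 s x * x ^ n) (normal_moment s n)"
  proof (cases "even n")
    case True
    then show ?thesis using normal_moment_even[OF assms(2), of 0 "n div 2"] by (simp add: normal_moment_def)
  next
    case False
    then obtain k where "n = 2 * k + 1" by (auto elim: oddE)
    then show ?thesis using normal_moment_odd[OF assms(2), of 0 k] by (simp add: normal_moment_def)
  qed
  then have i: "integrable lborel (\<lambda>x. normal_density 0 s x * x ^ n)"
    "(\<integral>x. normal_density 0 s x * x ^ n \<partial>lborel) = normal_moment s n"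
    by (auto simp: has_bochner_integral_iff)
  show "integrable M (\<lambda>\<omega>. X \<omega> ^ n)"
    using distributed_integrable[OF assms(1), of "\<lambda>x. x ^ n"] i(1) by simp
  show "expectation (\<lambda>\<omega>. X \<omega> ^ n) = normal_moment s n"
    using distributed_integral[OF assms(1), of "\<lambda>x. x ^ n"] i(2) by simp
qed

text \<open>Conjugation does nothing here, so the moment only depends on \<open>a + b\<close>, and
  the integer factor of the recursion splits into contractions with either kind. Where an exponent
  \<open>a - 1\<close> is truncated, its coefficient is 0.\<close>

lemma (in prob_space) wick_moments_real_normal:
  assumes X: "distributed M lborel X (normal_density 0 1)"
  defines "Z \<equiv> \<lambda>\<omega>. complex_of_real (X \<omega>)"
  shows "integrable M (\<lambda>\<omega>. Z \<omega> ^ a * cnj (Z \<omega>) ^ b)"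
    and "wick_moments True (\<lambda>a b. expectation (\<lambda>\<omega>. Z \<omega> ^ a * cnj (Z \<omega>) ^ b))"
proof -
  have Z: "(\<lambda>\<omega>. Z \<omega> ^ a * cnj (Z \<omega>) ^ b) = (\<lambda>\<omega>. complex_of_real (X \<omega> ^ (a + b)))" for a b
    by (simp add: Z_def power_add)
  show "integrable M (\<lambda>\<omega>. Z \<omega> ^ a * cnj (Z \<omega>) ^ b)"
    unfolding Z by (intro integrable_of_real normal_distributed_moment(1)[OF X]) simp
  have "expectation (\<lambda>\<omega>. Z \<omega> ^ a * cnj (Z \<omega>) ^ b) = complex_of_real (normal_moment 1 (a + b))" for a b
    unfolding Z integral_complex_of_real using normal_distributed_moment(2)[OF X] by simp
  then have E: "(\<lambda>a b. expectation (\<lambda>\<omega>. Z \<omega> ^ a * cnj (Z \<omega>) ^ b)) = (\<lambda>a b. complex_of_real (normal_moment 1 (a + b)))"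
    by (simp add: fun_eq_iff)
  have S: "normal_moment 1 (Suc (a + b)) = real a * normal_moment 1 (a - 1 + b) + real b * normal_moment 1 (a + (b - 1))" for a b
    using normal_moment_Suc[of 1 "a + b"] by (cases a; cases b) (simp_all add: algebra_simps)
  show "wick_moments True (\<lambda>a b. expectation (\<lambda>\<omega>. Z \<omega> ^ a * cnj (Z \<omega>) ^ b))"
    unfolding E wick_moments_def by (simp add: S) (simp add: normal_moment_def)
qed

text \<open>
  \<open>F k l a b\<close> stands for \<open>E (X\<^sup>k Y\<^sup>l Z\<^sup>a (cnj Z)\<^sup>b)\<close> with \<open>Z = X + \<i> Y\<close>, where \<open>X\<close> and \<open>Y\<close>
  are independent normal variables of variance \<open>1/2\<close>. The conclusion is Gaussian integration by parts.
\<close>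

lemma complex_moment_recursion:
  fixes F :: "nat \<Rightarrow> nat \<Rightarrow> nat \<Rightarrow> nat \<Rightarrow> complex"
  assumes z: "\<And>k l a b. F k l (Suc a) b = F (Suc k) l a b + \<i> * F k (Suc l) a b"
    and c: "\<And>k l a b. F k l a (Suc b) = F (Suc k) l a b - \<i> * F k (Suc l) a b"
    and x: "\<And>k l. 2 * F (Suc k) l 0 0 = of_nat k * F (k - 1) l 0 0"
    and y: "\<And>k l. 2 * F k (Suc l) 0 0 = of_nat l * F k (l - 1) 0 0"
  shows "2 * F (Suc k) l a b = of_nat k * F (k - 1) l a b + of_nat a * F k l (a - 1) b + of_nat b * F k l a (b - 1) \<and>
    2 * F k (Suc l) a b = of_nat l * F k (l - 1) a b + \<i> * of_nat a * F k l (a - 1) b - \<i> * of_nat b * F k l a (b - 1)"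
proof (induction "a + b" arbitrary: a b k l)
  case 0
  then show ?case using x y by simp
next
  case (Suc n)
  show ?case
  proof (cases a)
    case (Suc a')
    then have n: "n = a' + b" using \<open>Suc n = a + b\<close> by simp
    note IH = Suc.hyps(1)[OF n]
    \<comment> \<open>The case \<open>k = 0\<close> is separate because \<open>k - 1\<close> is
      truncated there; the coefficient 0 makes both sides agree.\<close>
    have 1: "of_nat k * F (k - 1) l (Suc a') b = of_nat k * F k l a' b + \<i> * (of_nat k * F (k - 1) (Suc l) a' b)"
      by (cases k) (simp_all add: z algebra_simps)
    have 2: "of_nat l * F k (l - 1) (Suc a') b = of_nat l * F (Suc k) (l - 1) a' b + \<i> * (of_nat l * F k l a' b)"
      by (cases l) (simp_all add: z algebra_simps)
    have 3: "of_nat a' * F k l a' b = of_nat a' * F (Suc k) l (a' - 1) b + \<i> * (of_nat a' * F k (Suc l) (a' - 1) b)"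
      by (cases a') (simp_all add: z algebra_simps)
    have 4: "of_nat b * F k l (Suc a') (b - 1) = of_nat b * F (Suc k) l a' (b - 1) + \<i> * (of_nat b * F k (Suc l) a' (b - 1))"
      by (simp add: z algebra_simps)
    have "2 * F (Suc k) l (Suc a') b = 2 * F (Suc (Suc k)) l a' b + \<i> * (2 * F (Suc k) (Suc l) a' b)"
      by (simp add: z algebra_simps)
    also have "\<dots> = F k l a' b + of_nat k * F (k - 1) l (Suc a') b + of_nat a' * F k l a' b + of_nat b * F k l (Suc a') (b - 1)"
      unfolding 1 3 4 conjunct1[OF IH[of "Suc k" l]] conjunct1[OF IH[of k "Suc l"]] by (simp add: algebra_simps)
    finally have A: "2 * F (Suc k) l (Suc a') b = F k l a' b + of_nat k * F (k - 1) l (Suc a') b + of_nat a' * F k l a' b + of_nat b * F k l (Suc a') (b - 1)" .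
    have "2 * F k (Suc l) (Suc a') b = 2 * F (Suc k) (Suc l) a' b + \<i> * (2 * F k (Suc (Suc l)) a' b)"
      by (simp add: z algebra_simps)
    also have "\<dots> = \<i> * F k l a' b + of_nat l * F k (l - 1) (Suc a') b + \<i> * (of_nat a' * F k l a' b) - \<i> * (of_nat b * F k l (Suc a') (b - 1))"
      unfolding 2 3 4 conjunct2[OF IH[of "Suc k" l]] conjunct2[OF IH[of k "Suc l"]] by (simp add: algebra_simps)
    finally have B: "2 * F k (Suc l) (Suc a') b = \<i> * F k l a' b + of_nat l * F k (l - 1) (Suc a') b + \<i> * (of_nat a' * F k l a' b) - \<i> * (of_nat b * F k l (Suc a') (b - 1))" .
    show ?thesis unfolding Suc A B by (simp add: algebra_simps)
  next
    case 0
    then obtain b' where b: "b = Suc b'" and n: "n = 0 + b'" using \<open>Suc n = a + b\<close> by simp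
    note IH = Suc.hyps(1)[OF n]
    have 1: "of_nat k * F (k - 1) l 0 (Suc b') = of_nat k * F k l 0 b' - \<i> * (of_nat k * F (k - 1) (Suc l) 0 b')"
      by (cases k) (simp_all add: c algebra_simps)
    have 2: "of_nat l * F k (l - 1) 0 (Suc b') = of_nat l * F (Suc k) (l - 1) 0 b' - \<i> * (of_nat l * F k l 0 b')"
      by (cases l) (simp_all add: c algebra_simps)
    have 3: "of_nat b' * F k l 0 b' = of_nat b' * F (Suc k) l 0 (b' - 1) - \<i> * (of_nat b' * F k (Suc l) 0 (b' - 1))"
      by (cases b') (simp_all add: c algebra_simps)
    have "2 * F (Suc k) l 0 (Suc b') = 2 * F (Suc (Suc k)) l 0 b' - \<i> * (2 * F (Suc k) (Suc l) 0 b')"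
      by (simp add: c algebra_simps)
    also have "\<dots> = F k l 0 b' + of_nat k * F (k - 1) l 0 (Suc b') + of_nat b' * F k l 0 b'"
      unfolding 1 3 conjunct1[OF IH[of "Suc k" l]] conjunct1[OF IH[of k "Suc l"]] by (simp add: algebra_simps)
    finally have A: "2 * F (Suc k) l 0 (Suc b') = F k l 0 b' + of_nat k * F (k - 1) l 0 (Suc b') + of_nat b' * F k l 0 b'" .
    have "2 * F k (Suc l) 0 (Suc b') = 2 * F (Suc k) (Suc l) 0 b' - \<i> * (2 * F k (Suc (Suc l)) 0 b')"
      by (simp add: c algebra_simps)
    also have "\<dots> = - \<i> * F k l 0 b' + of_nat l * F k (l - 1) 0 (Suc b') - \<i> * (of_nat b' * F k l 0 b')"
      unfolding 2 3 conjunct2[OF IH[of "Suc k" l]] conjunct2[OF IH[of k "Suc l"]] by (simp add: algebra_simps)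
    finally have B: "2 * F k (Suc l) 0 (Suc b') = - \<i> * F k l 0 b' + of_nat l * F k (l - 1) 0 (Suc b') - \<i> * (of_nat b' * F k l 0 b')" .
    show ?thesis unfolding 0 b A B by (simp add: algebra_simps)
  qed
qed

text \<open>Extra powers of the real and imaginary part make the moments closed under expanding one
  factor \<open>Z\<close> or \<open>cnj Z\<close>, so integration by parts in the two real variables
  carries over to \<open>Z\<close>.\<close>

lemma (in prob_space) wick_moments_complex_normal:
  assumes Z: "complex_normal M Z 0 1"
  shows "integrable M (\<lambda>\<omega>. Z \<omega> ^ a * cnj (Z \<omega>) ^ b)"
    and "wick_moments False (\<lambda>a b. expectation (\<lambda>\<omega>. Z \<omega> ^ a * cnj (Z \<omega>) ^ b))"
proof -
  let ?X = "\<lambda>\<omega>. Re (Z \<omega>)" and ?Y = "\<lambda>\<omega>. Im (Z \<omega>)" and ?s = "sqrt (1 / 2)"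
  have X: "distributed M lborel ?X (normal_density 0 ?s)" and Y: "distributed M lborel ?Y (normal_density 0 ?s)"
    and ind: "indep_var borel ?X borel ?Y"
    using Z by (simp_all add: complex_normal_def)
  note mX = normal_distributed_moment[OF X] and mY = normal_distributed_moment[OF Y]
  let ?f = "\<lambda>k l a b \<omega>. complex_of_real (?X \<omega> ^ k * ?Y \<omega> ^ l) * (Z \<omega> ^ a * cnj (Z \<omega>) ^ b)"
  define F where "F k l a b = expectation (?f k l a b)" for k l a b
  have indkl: "indep_var borel (\<lambda>\<omega>. ?X \<omega> ^ k) borel (\<lambda>\<omega>. ?Y \<omega> ^ l)" for k l
    using indep_var_compose[OF ind, of "\<lambda>x. x ^ k" borel "\<lambda>x. x ^ l" borel] by (simp add: o_def)
  have int00: "integrable M (\<lambda>\<omega>. ?X \<omega> ^ k * ?Y \<omega> ^ l)"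
    and F00: "expectation (\<lambda>\<omega>. ?X \<omega> ^ k * ?Y \<omega> ^ l) = normal_moment ?s k * normal_moment ?s l" for k l
    using indep_var_integrable[OF indkl[of k l]] indep_var_lebesgue_integral[OF indkl[of k l]] mX mY by simp_all
  have fz: "?f k l (Suc a) b = (\<lambda>\<omega>. ?f (Suc k) l a b \<omega> + \<i> * ?f k (Suc l) a b \<omega>)" for k l a b
  proof
    fix \<omega>
    have "Z \<omega> = complex_of_real (?X \<omega>) + \<i> * complex_of_real (?Y \<omega>)" by (rule complex_eq)
    then have "?f k l (Suc a) b \<omega> = complex_of_real (?X \<omega> ^ k * ?Y \<omega> ^ l) *
      ((complex_of_real (?X \<omega>) + \<i> * complex_of_real (?Y \<omega>)) * (Z \<omega> ^ a * cnj (Z \<omega>) ^ b))"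
      by (simp add: mult.assoc)
    then show "?f k l (Suc a) b \<omega> = ?f (Suc k) l a b \<omega> + \<i> * ?f k (Suc l) a b \<omega>"
      by (simp add: algebra_simps)
  qed
  have fc: "?f k l a (Suc b) = (\<lambda>\<omega>. ?f (Suc k) l a b \<omega> - \<i> * ?f k (Suc l) a b \<omega>)" for k l a b
  proof
    fix \<omega>
    have "cnj (Z \<omega>) = complex_of_real (?X \<omega>) - \<i> * complex_of_real (?Y \<omega>)" by (simp add: complex_eq_iff)
    then have "?f k l a (Suc b) \<omega> = complex_of_real (?X \<omega> ^ k * ?Y \<omega> ^ l) *
      ((complex_of_real (?X \<omega>) - \<i> * complex_of_real (?Y \<omega>)) * (Z \<omega> ^ a * cnj (Z \<omega>) ^ b))"
      by (simp add: mult_ac)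
    then show "?f k l a (Suc b) \<omega> = ?f (Suc k) l a b \<omega> - \<i> * ?f k (Suc l) a b \<omega>"
      by (simp add: algebra_simps)
  qed
  have int: "integrable M (?f k l a b)" for k l a b
  proof (induction "a + b" arbitrary: k l a b)
    case 0
    then show ?case using integrable_of_real[OF int00[of k l], where 'a = complex] by simp
  next
    case (Suc n)
    show ?case
    proof (cases a)
      case (Suc a')
      then have "n = a' + b" using Suc.hyps(2) by simp
      note IH = Suc.hyps(1)[OF this]
      show ?thesis unfolding Suc fz
        by (intro Bochner_Integration.integrable_add integrable_mult_right IH)
    next
      case 0
      then obtain b' where b: "b = Suc b'" and "n = a + b'" using Suc.hyps(2) by simp
      note IH = Suc.hyps(1)[OF \<open>n = a + b'\<close>]
      show ?thesis unfolding b fc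
        by (intro Bochner_Integration.integrable_diff integrable_mult_right IH)
    qed
  qed
  show "integrable M (\<lambda>\<omega>. Z \<omega> ^ a * cnj (Z \<omega>) ^ b)" using int[of 0 0 a b] by simp
  have z: "F k l (Suc a) b = F (Suc k) l a b + \<i> * F k (Suc l) a b" for k l a b
    unfolding F_def fz using int
    by (subst Bochner_Integration.integral_add)
      (intro int integrable_mult_right, intro int integrable_mult_right, simp only: integral_mult_right_zero)
  have c: "F k l a (Suc b) = F (Suc k) l a b - \<i> * F k (Suc l) a b" for k l a b
    unfolding F_def fc using int
    by (subst Bochner_Integration.integral_diff)
      (intro int integrable_mult_right, intro int integrable_mult_right, simp only: integral_mult_right_zero)
  have F0: "F k l 0 0 = complex_of_real (normal_moment ?s k * normal_moment ?s l)" for k l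
    unfolding F_def power_0 mult_1_right integral_complex_of_real F00 ..
  have nm: "normal_moment ?s (Suc k) = real k * normal_moment ?s (k - 1) / 2" for k
    using normal_moment_Suc[of ?s k] by simp
  have x: "2 * F (Suc k) l 0 0 = of_nat k * F (k - 1) l 0 0" for k l
    unfolding F0 nm by simp
  have y: "2 * F k (Suc l) 0 0 = of_nat l * F k (l - 1) 0 0" for k l
    unfolding F0 nm by simp
  note rec = complex_moment_recursion[of F, OF z c x y]
  have "F 0 0 (Suc a) b = of_nat b * F 0 0 a (b - 1)" for a b
  proof -
    have "2 * F 0 0 (Suc a) b = 2 * F (Suc 0) 0 a b + \<i> * (2 * F 0 (Suc 0) a b)"
      by (simp add: z algebra_simps)
    \<comment> \<open>The contributions of \<open>of_nat a\<close> cancel because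
      \<open>1 + \<i> * \<i> = 0\<close>, and those of \<open>of_nat b\<close> double.\<close>
    also have "\<dots> = 2 * (of_nat b * F 0 0 a (b - 1))"
      unfolding conjunct1[OF rec[of 0 0 a b]] conjunct2[OF rec[of 0 0 a b]] by (simp add: algebra_simps)
    finally show ?thesis by simp
  qed
  moreover have "F 0 0 a (Suc b) = of_nat a * F 0 0 (a - 1) b" for a b
  proof -
    have "2 * F 0 0 a (Suc b) = 2 * F (Suc 0) 0 a b - \<i> * (2 * F 0 (Suc 0) a b)"
      by (simp add: c algebra_simps)
    also have "\<dots> = 2 * (of_nat a * F 0 0 (a - 1) b)"
      unfolding conjunct1[OF rec[of 0 0 a b]] conjunct2[OF rec[of 0 0 a b]] by (simp add: algebra_simps)
    finally show ?thesis by simp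
  qed
  moreover have "F 0 0 0 0 = 1" by (simp add: F0 normal_moment_def)
  moreover have "(\<lambda>a b. expectation (\<lambda>\<omega>. Z \<omega> ^ a * cnj (Z \<omega>) ^ b)) = F 0 0"
    by (simp add: F_def fun_eq_iff)
  ultimately show "wick_moments False (\<lambda>a b. expectation (\<lambda>\<omega>. Z \<omega> ^ a * cnj (Z \<omega>) ^ b))"
    by (simp add: wick_moments_def)
qed

section \<open>Expansion of the trace\<close>

text \<open>A false flag exchanges row and column index in its tensor leg only; quotient and
  remainder modulo \<open>d2\<close> are the two legs of an index.\<close>

definition flagged_wishart ::
    "bool \<Rightarrow> bool \<Rightarrow> nat \<Rightarrow> nat \<Rightarrow> nat \<Rightarrow> (nat \<Rightarrow> nat \<Rightarrow> nat \<Rightarrow> complex) \<Rightarrow> complex mat" where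
  "flagged_wishart b1 b2 d1 d2 p g = mat (d1 * d2) (d1 * d2) (\<lambda>(r, t). 1 / of_nat (d1 * d2) *
     (\<Sum>k<p. g (if b1 then r div d2 else t div d2) (if b2 then r mod d2 else t mod d2) k *
       cnj (g (if b1 then t div d2 else r div d2) (if b2 then t mod d2 else r mod d2) k)))"

lemma mat_adjoint_index:
  "i < dim_col A \<Longrightarrow> j < dim_row A \<Longrightarrow> mat_adjoint (A :: complex mat) $$ (i, j) = cnj (A $$ (j, i))"
  by (simp add: mat_adjoint_def mat_of_rows_index)

lemma dim_mat_adjoint [simp]:
  "dim_row (mat_adjoint A) = dim_col A" "dim_col (mat_adjoint A) = dim_row A"
  by (simp_all add: mat_adjoint_def)

lemma wishart_block_index:
  "a < d2 \<Longrightarrow> b < d2 \<Longrightarrow>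
    wishart_block d2 p g i j $$ (a, b) = 1 / of_nat d2 * (\<Sum>k<p. g i a k * cnj (g j b k))"
  by (simp add: wishart_block_def gaussian_block_def scalar_prod_def mat_adjoint_index atLeast0LessThan)

lemma dim_wishart_block [simp]:
  "dim_row (wishart_block d2 p g i j) = d2" "dim_col (wishart_block d2 p g i j) = d2"
  by (simp_all add: wishart_block_def gaussian_block_def)

lemma div_mod_less: "r < d1 * d2 \<Longrightarrow> r div d2 < d1 \<and> r mod d2 < (d2 :: nat)"
  by (metis less_mult_imp_div_less mod_less_divisor mult_0_right neq0_conv not_less_zero)

lemma wishart_flags:
  "wishart d1 d2 p g = flagged_wishart True True d1 d2 p g"
  "wishart_left d1 d2 p g = flagged_wishart False True d1 d2 p g"
  "wishart_right d1 d2 p g = flagged_wishart True False d1 d2 p g"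
  "wishart_transpose d1 d2 p g = flagged_wishart False False d1 d2 p g"
  by (rule eq_matI; simp add: wishart_def wishart_left_def wishart_right_def wishart_transpose_def
    flagged_wishart_def block_matrix_def wishart_block_index div_mod_less)+

fun pairwise_equal :: "'a list \<Rightarrow> bool" where
  "pairwise_equal (x # y # zs) \<longleftrightarrow> x = y \<and> pairwise_equal zs"
| "pairwise_equal _ \<longleftrightarrow> True"

lemma const_on_alt_edges:
  "const_on_edges (alt_edges zs) f \<longleftrightarrow> pairwise_equal (map f zs)"
  by (induction zs rule: alt_edges.induct)
    (simp_all add: const_on_edges_insert, simp_all add: const_on_edges_def)

lemma sum_PiE_insert:
  fixes f :: "('v \<Rightarrow> 't) \<Rightarrow> complex"
  assumes "x \<notin> V"
  shows "(\<Sum>F\<in>insert x V \<rightarrow>\<^sub>E T. f F) = (\<Sum>y\<in>T. \<Sum>F\<in>V \<rightarrow>\<^sub>E T. f (F(x := y)))"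
proof -
  have "(\<Sum>F\<in>insert x V \<rightarrow>\<^sub>E T. f F) = (\<Sum>(y, F)\<in>T \<times> (V \<rightarrow>\<^sub>E T). f (F(x := y)))"
    unfolding PiE_insert_eq using inj_combinator[OF assms, of "\<lambda>_. T"]
    by (subst sum.reindex) (simp_all add: case_prod_unfold)
  then show ?thesis by (simp add: sum.cartesian_product)
qed

definition entry_factor :: "(nat \<Rightarrow> nat \<Rightarrow> nat \<Rightarrow> complex) \<Rightarrow> bool \<Rightarrow> nat \<times> nat \<times> nat \<Rightarrow> complex" where
  "entry_factor g b v = (case v of (i, j, k) \<Rightarrow> if b then g i j k else cnj (g i j k))"

abbreviation "fst3 \<equiv> fst :: nat \<times> nat \<times> nat \<Rightarrow> nat"
abbreviation "snd3 \<equiv> \<lambda>v :: nat \<times> nat \<times> nat. fst (snd v)"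
abbreviation "trd3 \<equiv> \<lambda>v :: nat \<times> nat \<times> nat. snd (snd v)"

text \<open>The shifted lists glue the column index of each letter to the row index of the next,
  from the row \<open>(r1, r2)\<close> to the column \<open>(t1, t2)\<close>. The unshifted list
  equates the inner summation index of the two factors of a letter.\<close>

definition index_chain ::
    "('i \<Rightarrow> bool) \<Rightarrow> ('i \<Rightarrow> bool) \<Rightarrow> nat \<Rightarrow> 'i list \<Rightarrow> nat \<Rightarrow> nat \<Rightarrow> nat \<Rightarrow> nat \<Rightarrow> (nat \<times> bool \<Rightarrow> nat \<times> nat \<times> nat) \<Rightarrow> bool" where
  "index_chain e1 e2 s w r1 r2 t1 t2 F \<longleftrightarrow>
     pairwise_equal (r1 # map (\<lambda>x. fst3 (F x)) (factor_points e1 s w) @ [t1]) \<and>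
     pairwise_equal (r2 # map (\<lambda>x. snd3 (F x)) (factor_points e2 s w) @ [t2]) \<and>
     pairwise_equal (map (\<lambda>x. trd3 (F x)) (factor_points e1 s w))"

lemma index_chain_Cons:
  "index_chain e1 e2 s (i # w) r1 r2 t1 t2 (F((s, False) := z, (s, True) := y)) \<longleftrightarrow>
    r1 = (if e1 i then fst3 y else fst3 z) \<and> r2 = (if e2 i then snd3 y else snd3 z) \<and> trd3 y = trd3 z \<and>
    index_chain e1 e2 (Suc s) w (if e1 i then fst3 z else fst3 y) (if e2 i then snd3 z else snd3 y) t1 t2 F"
proof -
  let ?F = "F((s, False) := z, (s, True) := y)"
  have rest: "map (\<lambda>x. h (?F x)) (factor_points e (Suc s) w) = map (\<lambda>x. h (F x)) (factor_points e (Suc s) w)"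
    for h :: "nat \<times> nat \<times> nat \<Rightarrow> nat" and e :: "'a \<Rightarrow> bool"
    by (rule map_cong) (auto simp: set_factor_points)
  show ?thesis
    unfolding index_chain_def factor_points.simps list.map append_Cons pairwise_equal.simps
      rest[of fst3] rest[of snd3] rest[of trd3] by auto
qed

text \<open>Turns a matrix entry, a sum over the inner index, into a sum over independent index
  triples for the two Gaussian factors, restricted by a predicate. All factors then range over the
  same set.\<close>

lemma sum_two_triples:
  fixes f :: "nat \<times> nat \<times> nat \<Rightarrow> nat \<times> nat \<times> nat \<Rightarrow> complex" and p :: nat
  assumes "r1 < d1" "u1 < d1" "r2 < d2" "u2 < (d2 :: nat)"
  defines "T \<equiv> {..<d1} \<times> {..<d2} \<times> {..<p}"
  shows "(\<Sum>y\<in>T. \<Sum>z\<in>T. if r1 = (if b1 then fst3 y else fst3 z) \<and> r2 = (if b2 then snd3 y else snd3 z) \<and>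
      trd3 y = trd3 z \<and> u1 = (if b1 then fst3 z else fst3 y) \<and> u2 = (if b2 then snd3 z else snd3 y)
      then f y z else 0) =
    (\<Sum>k<p. f (if b1 then r1 else u1, if b2 then r2 else u2, k) (if b1 then u1 else r1, if b2 then u2 else r2, k))"
    (is "(\<Sum>y\<in>T. \<Sum>z\<in>T. if ?P y z then f y z else 0) = _")
proof -
  let ?y = "\<lambda>k. (if b1 then r1 else u1, if b2 then r2 else u2, k)"
  let ?z = "\<lambda>k. (if b1 then u1 else r1, if b2 then u2 else r2, k)"
  have bij: "bij_betw (\<lambda>k. (?y k, ?z k)) {..<p} {(y, z) \<in> T \<times> T. ?P y z}"
    by (rule bij_betw_byWitness[where f' = "\<lambda>(y, z). trd3 y"])
      (use assms(1-4) in \<open>auto simp: T_def split: if_splits\<close>)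
  have "(\<Sum>y\<in>T. \<Sum>z\<in>T. if ?P y z then f y z else 0) =
      (\<Sum>yz\<in>T \<times> T. if ?P (fst yz) (snd yz) then f (fst yz) (snd yz) else 0)"
    by (simp add: sum.cartesian_product case_prod_unfold)
  also have "\<dots> = (\<Sum>yz\<in>{yz \<in> T \<times> T. ?P (fst yz) (snd yz)}. f (fst yz) (snd yz))"
    by (rule sum.inter_filter[symmetric]) (simp add: T_def)
  also have "{yz \<in> T \<times> T. ?P (fst yz) (snd yz)} = {(y, z) \<in> T \<times> T. ?P y z}" by auto
  also have "(\<Sum>yz\<in>{(y, z) \<in> T \<times> T. ?P y z}. f (fst yz) (snd yz)) = (\<Sum>k<p. f (?y k) (?z k))"
    by (subst sum.reindex_bij_betw[OF bij, symmetric]) simp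
  finally show ?thesis .
qed

lemma scaled_sum_product:
  fixes a :: "'y \<Rightarrow> 'z \<Rightarrow> complex"
  shows "(c * (\<Sum>y\<in>T. \<Sum>z\<in>T'. a y z)) * (c ^ m * (\<Sum>F\<in>P. b F)) =
    c ^ Suc m * (\<Sum>y\<in>T. \<Sum>z\<in>T'. \<Sum>F\<in>P. a y z * b F)"
proof -
  have "(\<Sum>y\<in>T. \<Sum>z\<in>T'. a y z) * (\<Sum>F\<in>P. b F) = (\<Sum>y\<in>T. \<Sum>z\<in>T'. \<Sum>F\<in>P. a y z * b F)"
    unfolding sum_distrib_right unfolding sum_distrib_left ..
  then show ?thesis by (metis (no_types) mult.assoc mult.left_commute power_Suc)
qed

lemma mat_prod_list_carrier:
  "(\<And>A. A \<in> set As \<Longrightarrow> A \<in> carrier_mat n n) \<Longrightarrow> mat_prod_list n As \<in> carrier_mat n n"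
  by (induction As) (auto simp: mat_prod_list_def intro: mult_carrier_mat)

text \<open>Induction on the word from the left; \<open>s\<close> is arbitrary because the rest of
  the word starts one position later.\<close>

lemma mat_prod_list_flagged:
  fixes d1 d2 p :: nat and g :: "nat \<Rightarrow> nat \<Rightarrow> nat \<Rightarrow> complex"
  defines "T \<equiv> {..<d1} \<times> {..<d2} \<times> {..<p}"
  assumes "r < d1 * d2" "t < d1 * d2"
  shows "mat_prod_list (d1 * d2) (map (\<lambda>i. flagged_wishart (e1 i) (e2 i) d1 d2 p g) w) $$ (r, t) =
    (1 / of_nat (d1 * d2)) ^ length w *
    (\<Sum>F\<in>{s..<s + length w} \<times> UNIV \<rightarrow>\<^sub>E T.
      if index_chain e1 e2 s w (r div d2) (r mod d2) (t div d2) (t mod d2) F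
      then \<Prod>x\<in>{s..<s + length w} \<times> UNIV. entry_factor g (snd x) (F x) else 0)"
  using assms(2)
proof (induction w arbitrary: s r)
  case Nil
  have "r = t \<longleftrightarrow> r div d2 = t div d2 \<and> r mod d2 = t mod d2" by (metis div_mult_mod_eq)
  then show ?case using Nil assms(3) by (simp add: mat_prod_list_def index_chain_def)
next
  case (Cons i w)
  let ?n = "d1 * d2" and ?c = "1 / of_nat (d1 * d2) :: complex"
  let ?X = "\<lambda>i. flagged_wishart (e1 i) (e2 i) d1 d2 p g"
  let ?P = "mat_prod_list ?n (map ?X w)"
  let ?V = "{Suc s..<Suc s + length w} \<times> (UNIV :: bool set)"
  let ?t1 = "t div d2" and ?t2 = "t mod d2"
  let ?\<Pi> = "\<lambda>F. \<Prod>x\<in>?V. entry_factor g (snd x) (F x)"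
  let ?ch = "index_chain e1 e2 (Suc s) w"
  let ?A = "\<lambda>y z. r div d2 = (if e1 i then fst3 y else fst3 z) \<and> r mod d2 = (if e2 i then snd3 y else snd3 z) \<and> trd3 y = trd3 z"
  let ?u1 = "\<lambda>y z. if e1 i then fst3 z else fst3 y" and ?u2 = "\<lambda>y z. if e2 i then snd3 z else snd3 y"
  let ?f = "\<lambda>y z. entry_factor g True y * entry_factor g False z"
  have P: "?P \<in> carrier_mat ?n ?n"
    by (rule mat_prod_list_carrier) (auto simp: flagged_wishart_def)
  have "mat_prod_list ?n (map ?X (i # w)) $$ (r, t) = (?X i * ?P) $$ (r, t)"
    by (simp add: mat_prod_list_def)
  also have "\<dots> = (\<Sum>u<?n. ?X i $$ (r, u) * ?P $$ (u, t))"
    using Cons.prems assms(3) P by (simp add: scalar_prod_def flagged_wishart_def atLeast0LessThan)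
  also have "\<dots> = (\<Sum>u<?n. (?c * (\<Sum>y\<in>T. \<Sum>z\<in>T. if ?A y z \<and> u div d2 = ?u1 y z \<and> u mod d2 = ?u2 y z then ?f y z else 0)) *
      (?c ^ length w * (\<Sum>F\<in>?V \<rightarrow>\<^sub>E T. if ?ch (u div d2) (u mod d2) ?t1 ?t2 F then ?\<Pi> F else 0)))"
  proof (intro sum.cong refl arg_cong2[where f = "(*)"])
    fix u assume "u \<in> {..<?n}"
    then have u: "u < ?n" by simp
    show "?P $$ (u, t) = ?c ^ length w * (\<Sum>F\<in>?V \<rightarrow>\<^sub>E T. if ?ch (u div d2) (u mod d2) ?t1 ?t2 F then ?\<Pi> F else 0)"
      by (rule Cons.IH[OF u])
    have "(\<Sum>y\<in>T. \<Sum>z\<in>T. if ?A y z \<and> u div d2 = ?u1 y z \<and> u mod d2 = ?u2 y z then ?f y z else 0) =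
      (\<Sum>k<p. ?f (if e1 i then r div d2 else u div d2, if e2 i then r mod d2 else u mod d2, k)
         (if e1 i then u div d2 else r div d2, if e2 i then u mod d2 else r mod d2, k))"
      unfolding T_def conj_assoc
      by (rule sum_two_triples) (use div_mod_less[OF u] div_mod_less[OF Cons.prems] in auto)
    then show "?X i $$ (r, u) = ?c * (\<Sum>y\<in>T. \<Sum>z\<in>T. if ?A y z \<and> u div d2 = ?u1 y z \<and> u mod d2 = ?u2 y z then ?f y z else 0)"
      using u Cons.prems by (simp add: flagged_wishart_def entry_factor_def)
  qed
  also have "\<dots> = (\<Sum>u<?n. ?c ^ Suc (length w) * (\<Sum>y\<in>T. \<Sum>z\<in>T. \<Sum>F\<in>?V \<rightarrow>\<^sub>E T. (if ?A y z \<and> u div d2 = ?u1 y z \<and> u mod d2 = ?u2 y z then ?f y z else 0) *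
        (if ?ch (u div d2) (u mod d2) ?t1 ?t2 F then ?\<Pi> F else 0)))"
    by (intro sum.cong refl scaled_sum_product)
  also have "\<dots> = ?c ^ Suc (length w) * (\<Sum>u<?n. \<Sum>y\<in>T. \<Sum>z\<in>T. \<Sum>F\<in>?V \<rightarrow>\<^sub>E T. (if ?A y z \<and> u div d2 = ?u1 y z \<and> u mod d2 = ?u2 y z then ?f y z else 0) *
        (if ?ch (u div d2) (u mod d2) ?t1 ?t2 F then ?\<Pi> F else 0))"
    by (rule sum_distrib_left[symmetric])
  also have "\<dots> = ?c ^ Suc (length w) * (\<Sum>u<?n. \<Sum>y\<in>T. \<Sum>z\<in>T. \<Sum>F\<in>?V \<rightarrow>\<^sub>E T.
      if u div d2 = ?u1 y z \<and> u mod d2 = ?u2 y z then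
        (if ?A y z \<and> ?ch (?u1 y z) (?u2 y z) ?t1 ?t2 F then ?f y z * ?\<Pi> F else 0) else 0)"
  proof (intro arg_cong2[where f = "(*)"] refl sum.cong)
    fix u y z F
    show "(if ?A y z \<and> u div d2 = ?u1 y z \<and> u mod d2 = ?u2 y z then ?f y z else 0) *
        (if ?ch (u div d2) (u mod d2) ?t1 ?t2 F then ?\<Pi> F else 0) =
      (if u div d2 = ?u1 y z \<and> u mod d2 = ?u2 y z then
        (if ?A y z \<and> ?ch (?u1 y z) (?u2 y z) ?t1 ?t2 F then ?f y z * ?\<Pi> F else 0) else 0)"
    proof (cases "u div d2 = ?u1 y z \<and> u mod d2 = ?u2 y z")
      case True
      then show ?thesis unfolding conjunct1[OF True] conjunct2[OF True] by simp
    next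
      case False
      then show ?thesis by (simp only: False simp_thms if_False mult_zero_left)
    qed
  qed
  \<comment> \<open>The intermediate matrix index \<open>u\<close> is summed innermost, where its
    two legs are prescribed and exactly one value remains.\<close>
  also have "(\<Sum>u<?n. \<Sum>y\<in>T. \<Sum>z\<in>T. \<Sum>F\<in>?V \<rightarrow>\<^sub>E T.
      if u div d2 = ?u1 y z \<and> u mod d2 = ?u2 y z then
        (if ?A y z \<and> ?ch (?u1 y z) (?u2 y z) ?t1 ?t2 F then ?f y z * ?\<Pi> F else 0) else 0) =
     (\<Sum>y\<in>T. \<Sum>z\<in>T. \<Sum>F\<in>?V \<rightarrow>\<^sub>E T. \<Sum>u<?n.
      if u div d2 = ?u1 y z \<and> u mod d2 = ?u2 y z then
        (if ?A y z \<and> ?ch (?u1 y z) (?u2 y z) ?t1 ?t2 F then ?f y z * ?\<Pi> F else 0) else 0)"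
    by (simp only: sum.swap[of _ _ "{..<?n}"])
  also have "\<dots> = (\<Sum>y\<in>T. \<Sum>z\<in>T. \<Sum>F\<in>?V \<rightarrow>\<^sub>E T.
      if ?A y z \<and> ?ch (?u1 y z) (?u2 y z) ?t1 ?t2 F then ?f y z * ?\<Pi> F else 0)"
  proof (intro sum.cong refl)
    fix y z :: "nat \<times> nat \<times> nat" and F
    assume yz: "y \<in> T" "z \<in> T"
    let ?a = "?u1 y z" and ?b = "?u2 y z"
    let ?B = "if ?A y z \<and> ?ch ?a ?b ?t1 ?t2 F then ?f y z * ?\<Pi> F else 0"
    have ab: "?a < d1" "?b < d2" using yz by (auto simp: T_def)
    have "u div d2 = ?a \<and> u mod d2 = ?b \<longleftrightarrow> u = ?a * d2 + ?b" for u
    proof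
      assume "u div d2 = ?a \<and> u mod d2 = ?b"
      then show "u = ?a * d2 + ?b" using div_mult_mod_eq[of u d2] by simp
    next
      assume "u = ?a * d2 + ?b"
      then show "u div d2 = ?a \<and> u mod d2 = ?b" using ab(2) by simp
    qed
    moreover have "?a * d2 + ?b < ?n"
    proof -
      have "?a * d2 + ?b < Suc ?a * d2" using ab(2) by simp
      also have "\<dots> \<le> d1 * d2" using ab(1) by (intro mult_right_mono) auto
      finally show ?thesis .
    qed
    ultimately show "(\<Sum>u<?n. if u div d2 = ?a \<and> u mod d2 = ?b then ?B else 0) = ?B" by simp
  qed
  also have "\<dots> = (\<Sum>y\<in>T. \<Sum>z\<in>T. \<Sum>F\<in>?V \<rightarrow>\<^sub>E T.
      if index_chain e1 e2 s (i # w) (r div d2) (r mod d2) ?t1 ?t2 (F((s, False) := z, (s, True) := y))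
      then \<Prod>x\<in>insert (s, True) (insert (s, False) ?V). entry_factor g (snd x) ((F((s, False) := z, (s, True) := y)) x) else 0)"
  proof (intro sum.cong refl)
    fix y z :: "nat \<times> nat \<times> nat" and F :: "nat \<times> bool \<Rightarrow> nat \<times> nat \<times> nat"
    let ?F = "F((s, False) := z, (s, True) := y)"
    have "(\<Prod>x\<in>?V. entry_factor g (snd x) (?F x)) = ?\<Pi> F" by (rule prod.cong) auto
    then have "(\<Prod>x\<in>insert (s, True) (insert (s, False) ?V). entry_factor g (snd x) (?F x)) = ?f y z * ?\<Pi> F"
      by simp
    then show "(if ?A y z \<and> ?ch (?u1 y z) (?u2 y z) ?t1 ?t2 F then ?f y z * ?\<Pi> F else 0) =
      (if index_chain e1 e2 s (i # w) (r div d2) (r mod d2) ?t1 ?t2 ?F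
       then \<Prod>x\<in>insert (s, True) (insert (s, False) ?V). entry_factor g (snd x) (?F x) else 0)"
      by (simp only: index_chain_Cons conj_assoc)
  qed
  also have "\<dots> = (\<Sum>F\<in>insert (s, True) (insert (s, False) ?V) \<rightarrow>\<^sub>E T.
      if index_chain e1 e2 s (i # w) (r div d2) (r mod d2) ?t1 ?t2 F
      then \<Prod>x\<in>insert (s, True) (insert (s, False) ?V). entry_factor g (snd x) (F x) else 0)"
    by (simp only: sum_PiE_insert[of "(s, True)"] sum_PiE_insert[of "(s, False)"] atLeastLessThan_iff
        mem_Sigma_iff insert_iff prod.inject Suc_n_not_le_n simp_thms)
  also have "insert (s, True) (insert (s, False) ?V) = {s..<s + length (i # w)} \<times> UNIV"
  proof -
    have "{s..<s + length (i # w)} = insert s {Suc s..<Suc s + length w}" by auto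
    then show ?thesis by (auto simp: UNIV_bool)
  qed
  finally show ?case by simp
qed

section \<open>Counting the index assignments of a pairing\<close>

lemma const_on_alternate_graph:
  assumes "\<And>x. x \<in> V \<Longrightarrow> f x = h x" "\<pi> \<in> pairings V"
  shows "const_on_edges (alt_edges zs \<union> graph_of \<pi> V) f \<longleftrightarrow>
    pairwise_equal (map f zs) \<and> (\<forall>x\<in>V. h (\<pi> x) = h x)"
proof -
  have "(\<forall>x\<in>V. f x = f (\<pi> x)) \<longleftrightarrow> (\<forall>x\<in>V. h (\<pi> x) = h x)"
  proof (rule ball_cong)
    fix x assume "x \<in> V"
    then show "(f x = f (\<pi> x)) = (h (\<pi> x) = h x)"
      using assms(1)[of x] assms(1)[of "\<pi> x"] pairingsD(1)[OF assms(2)] by auto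
  qed simp
  then show ?thesis
    unfolding const_on_edges_Un const_on_alt_edges const_on_graph_of by (simp only:)
qed

lemma const_on_blocks:
  assumes "\<And>x. x \<in> V \<Longrightarrow> f x = h x" "\<pi> \<in> pairings V" "set zs \<subseteq> V"
  shows "const_on_edges (alt_edges zs \<union> graph_of \<pi> V) f \<longleftrightarrow>
    pairwise_equal (map h zs) \<and> (\<forall>x\<in>V. h (\<pi> x) = h x)"
proof -
  have m: "map f zs = map h zs" using assms(1,3) by auto
  show ?thesis
    using const_on_alternate_graph[of V f h \<pi> zs, OF assms(1,2)] unfolding m .
qed

lemma const_on_face:
  assumes "f z = r" "\<And>x. x \<in> V \<Longrightarrow> f x = h x" "\<pi> \<in> pairings V" "set zs \<subseteq> V"
  shows "const_on_edges (alt_edges (z # zs @ [z]) \<union> graph_of \<pi> V) f \<longleftrightarrow>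
    pairwise_equal (r # map h zs @ [r]) \<and> (\<forall>x\<in>V. h (\<pi> x) = h x)"
proof -
  have m: "map f (z # zs @ [z]) = r # map h zs @ [r]" using assms(1,2,4) by auto
  show ?thesis
    using const_on_alternate_graph[of V f h \<pi> "z # zs @ [z]", OF assms(2,3)] unfolding m .
qed

text \<open>The trace puts the same \<open>r\<close> at both ends of the chain; it becomes the label
  of the cut vertex.\<close>

definition index_assignments ::
    "('i \<Rightarrow> bool) \<Rightarrow> ('i \<Rightarrow> bool) \<Rightarrow> nat \<Rightarrow> nat \<Rightarrow> nat \<Rightarrow> 'i list \<Rightarrow> (nat \<times> bool \<Rightarrow> nat \<times> bool) \<Rightarrow>
      (nat \<times> (nat \<times> bool \<Rightarrow> nat \<times> nat \<times> nat)) set" where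
  "index_assignments e1 e2 d1 d2 p w \<pi> =
     {(r, F) \<in> {..<d1 * d2} \<times> ({0..<length w} \<times> UNIV \<rightarrow>\<^sub>E {..<d1} \<times> {..<d2} \<times> {..<p}).
       index_chain e1 e2 0 w (r div d2) (r mod d2) (r div d2) (r mod d2) F \<and>
       (\<forall>x\<in>{0..<length w} \<times> UNIV. F (\<pi> x) = F x)}"

text \<open>The coordinates of the triples decouple: each is a labelling constant along the edges of
  its own graph. The two legs of \<open>r\<close> label the cut vertex in the first two graphs; the
  inner indices are not linked across letters and need no cut vertex.\<close>

lemma card_index_assignments:
  assumes "\<pi> \<in> pairings ({0..<length w} \<times> UNIV)"
  defines "z \<equiv> (length w, True)"
  shows "card (index_assignments e1 e2 d1 d2 p w \<pi>) =
    d1 ^ face_count z (factor_points e1 0 w) \<pi> * d2 ^ face_count z (factor_points e2 0 w) \<pi> *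
    p ^ block_count (factor_points e1 0 w) \<pi>"
proof -
  define V where "V = {0..<length w} \<times> (UNIV :: bool set)"
  let ?E = "\<lambda>e. alt_edges (z # factor_points e 0 w @ [z]) \<union> graph_of \<pi> V"
  let ?D = "alt_edges (factor_points e1 0 w) \<union> graph_of \<pi> V"
  have V: "set (factor_points e 0 w) = V" for e by (simp add: set_factor_points V_def)
  have \<pi>: "\<pi> \<in> pairings V" using assms(1) by (simp add: V_def)
  note assignments = index_assignments_def[of e1 e2 d1 d2 p w \<pi>, folded V_def]
  from V have sub: "set (factor_points e 0 w) \<subseteq> V" for e by simp
  have z: "z \<notin> V" by (simp add: z_def V_def)
  then have xz: "x \<noteq> z" if "x \<in> V" for x using that by blast
  let ?S = "edge_funs d1 (insert z V) (?E e1) \<times> edge_funs d2 (insert z V) (?E e2) \<times> edge_funs p V ?D"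
  let ?to = "\<lambda>(r, F). (\<lambda>x\<in>insert z V. if x = z then r div d2 else fst3 (F x),
    \<lambda>x\<in>insert z V. if x = z then r mod d2 else snd3 (F x), \<lambda>x\<in>V. trd3 (F x))"
  let ?from = "\<lambda>(f1, f2, f3). (f1 z * d2 + f2 z, \<lambda>x\<in>V. (f1 x, f2 x, f3 x))"
  have bij: "bij_betw ?to (index_assignments e1 e2 d1 d2 p w \<pi>) ?S"
  proof (rule bij_betw_byWitness[where f' = ?from])
    show "\<forall>rF\<in>index_assignments e1 e2 d1 d2 p w \<pi>. ?from (?to rF) = rF"
    proof (rule ballI)
      fix rF assume rF: "rF \<in> index_assignments e1 e2 d1 d2 p w \<pi>"
      obtain r F where rF_eq: "rF = (r, F)" by (cases rF)
      have F: "F \<in> V \<rightarrow>\<^sub>E {..<d1} \<times> {..<d2} \<times> {..<p}" using rF by (simp add: assignments rF_eq)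
      have "fst (?from (?to (r, F))) = fst (r, F)" by simp
      have "snd (?from (?to (r, F))) x = F x" for x
        using xz[of x] PiE_arb[OF F, of x] by (cases "x \<in> V") simp_all
      then have "snd (?from (?to (r, F))) = snd (r, F)" by (simp add: fun_eq_iff)
      with \<open>fst (?from (?to (r, F))) = fst (r, F)\<close> show "?from (?to rF) = rF"
        unfolding rF_eq by (rule prod_eqI)
    qed
    show "\<forall>f\<in>?S. ?to (?from f) = f"
    proof (rule ballI)
      fix f assume "f \<in> ?S"
      moreover obtain f1 f2 f3 where f_eq: "f = (f1, f2, f3)" by (cases f)
      ultimately have f: "f1 \<in> edge_funs d1 (insert z V) (?E e1)" "f2 \<in> edge_funs d2 (insert z V) (?E e2)" "f3 \<in> edge_funs p V ?D"
        by simp_all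
      then have ext: "f1 \<in> insert z V \<rightarrow>\<^sub>E {..<d1}" "f2 \<in> insert z V \<rightarrow>\<^sub>E {..<d2}" "f3 \<in> V \<rightarrow>\<^sub>E {..<p}"
        by (simp_all add: edge_funs_def)
      have f2z: "f2 z < d2" using PiE_mem[OF ext(2), of z] by simp
      then have dm: "(f1 z * d2 + f2 z) div d2 = f1 z" "(f1 z * d2 + f2 z) mod d2 = f2 z" by auto
      have "fst (?to (?from (f1, f2, f3))) x = f1 x" for x
        using PiE_arb[OF ext(1), of x] dm z by (cases "x = z"; cases "x \<in> V") simp_all
      then have 1: "fst (?to (?from (f1, f2, f3))) = fst (f1, f2, f3)" by (simp add: fun_eq_iff)
      have "fst (snd (?to (?from (f1, f2, f3)))) x = f2 x" for x
        using PiE_arb[OF ext(2), of x] dm z by (cases "x = z"; cases "x \<in> V") simp_all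
      then have 2: "fst (snd (?to (?from (f1, f2, f3)))) = fst (snd (f1, f2, f3))" by (simp add: fun_eq_iff)
      have "snd (snd (?to (?from (f1, f2, f3)))) x = f3 x" for x
        using PiE_arb[OF ext(3), of x] by (cases "x \<in> V") simp_all
      then have 3: "snd (snd (?to (?from (f1, f2, f3)))) = snd (snd (f1, f2, f3))" by (simp add: fun_eq_iff)
      show "?to (?from f) = f" unfolding f_eq by (intro prod_eqI 1 2 3)
    qed
    show "?to ` index_assignments e1 e2 d1 d2 p w \<pi> \<subseteq> ?S"
    proof (rule image_subsetI)
      fix rF assume rF: "rF \<in> index_assignments e1 e2 d1 d2 p w \<pi>"
      obtain r F where rF_eq: "rF = (r, F)" by (cases rF)
      have r: "r < d1 * d2" and F: "F \<in> V \<rightarrow>\<^sub>E {..<d1} \<times> {..<d2} \<times> {..<p}"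
        and ch: "index_chain e1 e2 0 w (r div d2) (r mod d2) (r div d2) (r mod d2) F"
        and s: "\<forall>x\<in>V. F (\<pi> x) = F x"
        using rF by (simp_all add: assignments rF_eq)
      note r' = div_mod_less[OF r]
      have F': "fst3 (F x) < d1 \<and> snd3 (F x) < d2 \<and> trd3 (F x) < p" if "x \<in> V" for x
        using PiE_mem[OF F that] by (auto simp: mem_Times_iff)
      let ?f1 = "\<lambda>x\<in>insert z V. if x = z then r div d2 else fst3 (F x)"
      let ?f2 = "\<lambda>x\<in>insert z V. if x = z then r mod d2 else snd3 (F x)"
      let ?f3 = "\<lambda>x\<in>V. trd3 (F x)"
      have "const_on_edges (?E e1) ?f1"
        using const_on_face[of ?f1 z "r div d2" V "\<lambda>x. fst3 (F x)", OF _ _ \<pi> sub[of e1]] xz ch s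
        by (auto simp: index_chain_def)
      then have 1: "?f1 \<in> edge_funs d1 (insert z V) (?E e1)"
        using r' F' by (auto simp: edge_funs_def)
      have "const_on_edges (?E e2) ?f2"
        using const_on_face[of ?f2 z "r mod d2" V "\<lambda>x. snd3 (F x)", OF _ _ \<pi> sub[of e2]] xz ch s
        by (auto simp: index_chain_def)
      then have 2: "?f2 \<in> edge_funs d2 (insert z V) (?E e2)"
        using r' F' by (auto simp: edge_funs_def)
      have "const_on_edges ?D ?f3"
        using const_on_blocks[of V ?f3 "\<lambda>x. trd3 (F x)", OF _ \<pi> sub[of e1]] ch s
        by (auto simp: index_chain_def)
      then have 3: "?f3 \<in> edge_funs p V ?D"
        using F' by (auto simp: edge_funs_def)
      show "?to rF \<in> ?S" using 1 2 3 by (simp add: rF_eq)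
    qed
    show "?from ` ?S \<subseteq> index_assignments e1 e2 d1 d2 p w \<pi>"
    proof (rule image_subsetI)
      fix f assume f: "f \<in> ?S"
      obtain f1 f2 f3 where f_eq: "f = (f1, f2, f3)" by (cases f)
      have f1: "f1 \<in> insert z V \<rightarrow>\<^sub>E {..<d1}" "const_on_edges (?E e1) f1"
        and f2: "f2 \<in> insert z V \<rightarrow>\<^sub>E {..<d2}" "const_on_edges (?E e2) f2"
        and f3: "f3 \<in> V \<rightarrow>\<^sub>E {..<p}" "const_on_edges ?D f3"
        using f by (simp_all add: f_eq edge_funs_def)
      let ?F = "\<lambda>x\<in>V. (f1 x, f2 x, f3 x)" and ?r = "f1 z * d2 + f2 z"
      have lt: "f1 x < d1" "f2 x < d2" if "x \<in> insert z V" for x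
        using PiE_mem[OF f1(1) that] PiE_mem[OF f2(1) that] by auto
      have dm: "?r div d2 = f1 z" "?r mod d2 = f2 z" using lt(2)[of z] by auto
      have "?r < Suc (f1 z) * d2" using lt(2)[of z] by simp
      also have "\<dots> \<le> d1 * d2" using lt(1)[of z] by (intro mult_right_mono) auto
      finally have r: "?r < d1 * d2" .
      have F: "?F \<in> V \<rightarrow>\<^sub>E {..<d1} \<times> {..<d2} \<times> {..<p}"
        using lt PiE_mem[OF f3(1)] by auto
      have 1: "pairwise_equal (f1 z # map (\<lambda>x. fst3 (?F x)) (factor_points e1 0 w) @ [f1 z]) \<and>
          (\<forall>x\<in>V. fst3 (?F (\<pi> x)) = fst3 (?F x))"
        by (rule const_on_face[THEN iffD1, OF _ _ \<pi> sub[of e1] f1(2)]) auto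
      have 2: "pairwise_equal (f2 z # map (\<lambda>x. snd3 (?F x)) (factor_points e2 0 w) @ [f2 z]) \<and>
          (\<forall>x\<in>V. snd3 (?F (\<pi> x)) = snd3 (?F x))"
        by (rule const_on_face[THEN iffD1, OF _ _ \<pi> sub[of e2] f2(2)]) auto
      have 3: "pairwise_equal (map (\<lambda>x. trd3 (?F x)) (factor_points e1 0 w)) \<and>
          (\<forall>x\<in>V. trd3 (?F (\<pi> x)) = trd3 (?F x))"
        by (rule const_on_blocks[THEN iffD1, OF _ \<pi> sub[of e1] f3(2)]) auto
      have "index_chain e1 e2 0 w (f1 z) (f2 z) (f1 z) (f2 z) ?F"
        unfolding index_chain_def using 1 2 3 by blast
      moreover have "\<forall>x\<in>V. ?F (\<pi> x) = ?F x"
      proof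
        fix x assume "x \<in> V"
        then show "?F (\<pi> x) = ?F x" using 1 2 3 by (intro prod_eqI) blast+
      qed
      ultimately show "?from f \<in> index_assignments e1 e2 d1 d2 p w \<pi>"
        unfolding assignments f_eq using r F by (simp only: dm case_prod_conv mem_Collect_eq mem_Sigma_iff lessThan_iff simp_thms)
    qed
  qed
  have fin: "finite (insert z V)" "finite V" by (simp_all add: V_def)
  have E: "?E e \<subseteq> insert z V \<times> insert z V" for e
    by (rule edges_subset[OF _ _ \<pi>]) (auto simp: V)
  have D: "?D \<subseteq> V \<times> V"
    by (rule edges_subset[OF _ _ \<pi>]) (auto simp: V)
  have "card (index_assignments e1 e2 d1 d2 p w \<pi>) = card ?S"
    by (rule bij_betw_same_card[OF bij])
  also have "\<dots> = card (edge_funs d1 (insert z V) (?E e1)) * card (edge_funs d2 (insert z V) (?E e2)) * card (edge_funs p V ?D)"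
    by (simp only: card_cartesian_product mult.assoc)
  finally show ?thesis
    unfolding card_edge_funs[OF fin(1) E] card_edge_funs[OF fin(2) D] face_count_def block_count_def V .
qed

text \<open>Wick's formula counts pairings for each index assignment; exchanging the sums counts
  assignments for each pairing. The trace contributes the additional power of the
  normalization.\<close>

lemma (in prob_space) expected_trace:
  fixes G :: "nat \<times> nat \<times> nat \<Rightarrow> 'a \<Rightarrow> complex" and d1 d2 p :: nat and e1 e2 :: "'i \<Rightarrow> bool"
  defines "T \<equiv> {..<d1} \<times> {..<d2} \<times> {..<p}"
  assumes indep: "indep_vars (\<lambda>_. borel) G T"
    and int: "\<And>v a b. v \<in> T \<Longrightarrow> integrable M (\<lambda>\<omega>. G v \<omega> ^ a * cnj (G v \<omega>) ^ b)"
    and mom: "\<And>v. v \<in> T \<Longrightarrow> wick_moments r (\<lambda>a b. expectation (\<lambda>\<omega>. G v \<omega> ^ a * cnj (G v \<omega>) ^ b))"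
  defines "X \<equiv> \<lambda>w \<omega>. normalized_trace (mat_prod_list (d1 * d2)
      (map (\<lambda>i. flagged_wishart (e1 i) (e2 i) d1 d2 p (\<lambda>i j k. G (i, j, k) \<omega>)) w))"
  shows "integrable M (X w)"
    and "expectation (X w) = (1 / of_nat (d1 * d2)) ^ Suc (length w) *
      (\<Sum>\<pi> | \<pi> \<in> pairings ({0..<length w} \<times> UNIV) \<and> admissible r ({0..<length w} \<times> UNIV) \<pi>.
        of_nat (card (index_assignments e1 e2 d1 d2 p w \<pi>)))"
proof -
  let ?V = "{0..<length w} \<times> (UNIV :: bool set)" and ?n = "d1 * d2"
  let ?c = "1 / of_nat ?n :: complex"
  let ?Fs = "?V \<rightarrow>\<^sub>E T"
  let ?ch = "\<lambda>r F. index_chain e1 e2 0 w (r div d2) (r mod d2) (r div d2) (r mod d2) F"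
  let ?\<Pi> = "\<lambda>F \<omega>. \<Prod>x\<in>?V. if snd x then G (F x) \<omega> else cnj (G (F x) \<omega>)"
  let ?P = "{\<pi>. \<pi> \<in> pairings ?V \<and> admissible r ?V \<pi>}"
  have finT: "finite T" by (simp add: T_def)
  have finFs: "finite ?Fs" using finT by (intro finite_PiE) auto
  have X: "X w = (\<lambda>\<omega>. ?c ^ Suc (length w) * (\<Sum>r<?n. \<Sum>F\<in>?Fs. if ?ch r F then ?\<Pi> F \<omega> else 0))"
  proof
    fix \<omega>
    let ?A = "mat_prod_list ?n (map (\<lambda>i. flagged_wishart (e1 i) (e2 i) d1 d2 p (\<lambda>i j k. G (i, j, k) \<omega>)) w)"
    have "?A \<in> carrier_mat ?n ?n"
      by (rule mat_prod_list_carrier) (auto simp: flagged_wishart_def)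
    then have "X w \<omega> = ?c * (\<Sum>r<?n. ?A $$ (r, r))"
      by (simp add: X_def normalized_trace_def)
    also have "(\<Sum>r<?n. ?A $$ (r, r)) = (\<Sum>r<?n. ?c ^ length w * (\<Sum>F\<in>?Fs. if ?ch r F then ?\<Pi> F \<omega> else 0))"
    proof (rule sum.cong)
      fix r assume "r \<in> {..<?n}"
      then have r: "r < ?n" by simp
      have e: "entry_factor (\<lambda>i j k. G (i, j, k) \<omega>) b v = (if b then G v \<omega> else cnj (G v \<omega>))" for b v
        by (cases v) (simp add: entry_factor_def)
      show "?A $$ (r, r) = ?c ^ length w * (\<Sum>F\<in>?Fs. if ?ch r F then ?\<Pi> F \<omega> else 0)"
        using mat_prod_list_flagged[OF r r, of e1 e2 p "\<lambda>i j k. G (i, j, k) \<omega>" w 0]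
        unfolding e T_def add_0 .
    qed simp
    finally show "X w \<omega> = ?c ^ Suc (length w) * (\<Sum>r<?n. \<Sum>F\<in>?Fs. if ?ch r F then ?\<Pi> F \<omega> else 0)"
      by (simp only: sum_distrib_left[symmetric] power_Suc mult.assoc)
  qed
  have wick: "integrable M (?\<Pi> F)" "expectation (?\<Pi> F) = of_nat (card (compatible_pairings (wick_rel r F) ?V))"
    if "F \<in> ?Fs" for F
    by (rule wick_expectation[OF indep _ finT _ int mom]; use PiE_mem[OF that] in simp)+
  have int_if: "integrable M (\<lambda>\<omega>. if ?ch r F then ?\<Pi> F \<omega> else 0)" if "F \<in> ?Fs" for r F
    by (cases "?ch r F") (simp_all only: if_True if_False wick(1)[OF that], simp)
  show "integrable M (X w)"
    unfolding X by (intro integrable_mult_right Bochner_Integration.integrable_sum int_if)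
  have finP: "finite ?P" using finite_pairings[of ?V] by simp
  have "expectation (X w) = ?c ^ Suc (length w) * (\<Sum>r<?n. \<Sum>F\<in>?Fs. expectation (\<lambda>\<omega>. if ?ch r F then ?\<Pi> F \<omega> else 0))"
    unfolding X integral_mult_right_zero
    by (intro arg_cong2[where f = "(*)"] refl)
      (subst Bochner_Integration.integral_sum, intro Bochner_Integration.integrable_sum int_if, assumption,
       intro sum.cong refl Bochner_Integration.integral_sum int_if)
  also have "(\<Sum>r<?n. \<Sum>F\<in>?Fs. expectation (\<lambda>\<omega>. if ?ch r F then ?\<Pi> F \<omega> else 0)) =
    (\<Sum>q<?n. \<Sum>F\<in>?Fs. \<Sum>\<pi>\<in>?P. if ?ch q F \<and> (\<forall>x\<in>?V. F (\<pi> x) = F x) then 1 else 0)"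
  proof (intro sum.cong refl)
    fix q F assume F: "F \<in> ?Fs"
    \<comment> \<open>The Wick condition splits into one on the pairing alone and one on the labels,
      which is what permits the exchange of sums.\<close>
    have "compatible_pairings (wick_rel r F) ?V = {\<pi> \<in> ?P. \<forall>x\<in>?V. F (\<pi> x) = F x}"
      unfolding compatible_pairings_def wick_rel_def admissible_def by (auto 4 3)
    then have "of_nat (card (compatible_pairings (wick_rel r F) ?V)) =
        (\<Sum>\<pi>\<in>?P. if \<forall>x\<in>?V. F (\<pi> x) = F x then 1 else (0::complex))"
      using finP by (simp add: sum.If_cases Int_def conj_ac)
    with wick(2)[OF F] have E: "expectation (?\<Pi> F) = (\<Sum>\<pi>\<in>?P. if \<forall>x\<in>?V. F (\<pi> x) = F x then 1 else 0)"
      by (rule trans)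
    show "expectation (\<lambda>\<omega>. if ?ch q F then ?\<Pi> F \<omega> else 0) =
        (\<Sum>\<pi>\<in>?P. if ?ch q F \<and> (\<forall>x\<in>?V. F (\<pi> x) = F x) then 1 else 0)"
    proof (cases "?ch q F")
      case True
      show ?thesis by (simp only: True simp_thms if_True E)
    next
      case False
      show ?thesis by (simp only: False simp_thms if_False) simp
    qed
  qed
  also have "\<dots> = (\<Sum>\<pi>\<in>?P. \<Sum>q<?n. \<Sum>F\<in>?Fs. if ?ch q F \<and> (\<forall>x\<in>?V. F (\<pi> x) = F x) then 1 else 0)"
    by (simp only: sum.swap[of _ ?P])
  also have "\<dots> = (\<Sum>\<pi>\<in>?P. of_nat (card (index_assignments e1 e2 d1 d2 p w \<pi>)))"
  proof (intro sum.cong refl)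
    fix \<pi>
    have "(\<Sum>q<?n. \<Sum>F\<in>?Fs. if ?ch q F \<and> (\<forall>x\<in>?V. F (\<pi> x) = F x) then 1 else (0::complex)) =
        (\<Sum>qF\<in>{..<?n} \<times> ?Fs. if ?ch (fst qF) (snd qF) \<and> (\<forall>x\<in>?V. snd qF (\<pi> x) = snd qF x) then 1 else 0)"
      by (simp only: sum.cartesian_product case_prod_unfold)
    also have "\<dots> = (\<Sum>qF\<in>{qF \<in> {..<?n} \<times> ?Fs. ?ch (fst qF) (snd qF) \<and> (\<forall>x\<in>?V. snd qF (\<pi> x) = snd qF x)}. 1)"
      by (rule sum.inter_filter[symmetric]) (intro finite_cartesian_product finFs finite_lessThan)
    also have "{qF \<in> {..<?n} \<times> ?Fs. ?ch (fst qF) (snd qF) \<and> (\<forall>x\<in>?V. snd qF (\<pi> x) = snd qF x)} =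
        index_assignments e1 e2 d1 d2 p w \<pi>"
      unfolding index_assignments_def T_def by (simp only: case_prod_unfold prod.collapse)
    finally show "(\<Sum>q<?n. \<Sum>F\<in>?Fs. if ?ch q F \<and> (\<forall>x\<in>?V. F (\<pi> x) = F x) then 1 else (0::complex)) =
        of_nat (card (index_assignments e1 e2 d1 d2 p w \<pi>))" by simp
  qed
  finally show "expectation (X w) = ?c ^ Suc (length w) *
      (\<Sum>\<pi>\<in>?P. of_nat (card (index_assignments e1 e2 d1 d2 p w \<pi>)))" .
qed

section \<open>Asymptotic freeness\<close>

text \<open>The edges inside letters do not see the flags, so both legs have the same number of
  blocks.\<close>

lemma const_on_factor_points:
  "const_on_edges (alt_edges (factor_points e s w)) f \<longleftrightarrow>
    (\<forall>t\<in>{s..<s + length w}. f (t, True) = f (t, False))"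
proof (induction w arbitrary: s)
  case Nil
  show ?case by (simp add: const_on_edges_def)
next
  case (Cons i w)
  have "{s..<s + length (i # w)} = insert s {Suc s..<Suc s + length w}" by auto
  then show ?case
    using Cons[of "Suc s"] by (cases "e i") (auto simp: const_on_edges_insert)
qed

context transpose_flags
begin

text \<open>The Euler bound applies to each leg with a common block count; equality in both is
  planarity for both orders, starting from the empty stack.\<close>

lemma sum_genus_zero_pairings:
  assumes "set w \<subseteq> \<Lambda>"
  defines "V \<equiv> {0..<length w} \<times> (UNIV :: bool set)" and "z \<equiv> (length w, True)"
  shows "(\<Sum>\<pi> | \<pi> \<in> pairings V \<and> admissible r V \<pi>.
      if face_count z (factor_points e1 0 w) \<pi> + block_count (factor_points e1 0 w) \<pi> = Suc (length w) \<and>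
        face_count z (factor_points e2 0 w) \<pi> + block_count (factor_points e1 0 w) \<pi> = Suc (length w)
      then c ^ block_count (factor_points e1 0 w) \<pi> else 0) = path_weight c q [] w"
    and "\<pi> \<in> pairings V \<Longrightarrow>
      face_count z (factor_points e1 0 w) \<pi> + block_count (factor_points e1 0 w) \<pi> \<le> Suc (length w) \<and>
      face_count z (factor_points e2 0 w) \<pi> + block_count (factor_points e1 0 w) \<pi> \<le> Suc (length w)"
proof -
  let ?fp = "\<lambda>e. factor_points e 0 w"
  have V: "set (?fp e) = V" for e by (simp add: set_factor_points V_def)
  have z: "z \<notin> V" by (simp add: z_def V_def)
  have block: "block_count (?fp e2) \<pi> = block_count (?fp e1) \<pi>" if "\<pi> \<in> pairings V" for \<pi>
    by (rule block_count_cong) (simp_all add: V that const_on_factor_points)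
  have genus: "face_count z (?fp e) \<pi> + block_count (?fp e) \<pi> \<le> Suc (length w) \<and>
      (face_count z (?fp e) \<pi> + block_count (?fp e) \<pi> = Suc (length w) \<longleftrightarrow> noncrossing \<pi> [] (?fp e))"
    if "\<pi> \<in> pairings V" for \<pi> e
    using noncrossing_iff_genus_zero[of \<pi> "[]" "?fp e" z] that z
    by (simp add: V distinct_factor_points length_factor_points)
  show "\<pi> \<in> pairings V \<Longrightarrow>
      face_count z (?fp e1) \<pi> + block_count (?fp e1) \<pi> \<le> Suc (length w) \<and>
      face_count z (?fp e2) \<pi> + block_count (?fp e1) \<pi> \<le> Suc (length w)"
    using genus[of \<pi> e1] genus[of \<pi> e2] block[of \<pi>] by simp
  have finV: "finite {\<pi>. \<pi> \<in> pairings V \<and> admissible r V \<pi>}"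
    using finite_pairings[of V] by (simp add: V_def)
  have "(\<Sum>\<pi> | \<pi> \<in> pairings V \<and> admissible r V \<pi>.
      if face_count z (?fp e1) \<pi> + block_count (?fp e1) \<pi> = Suc (length w) \<and>
        face_count z (?fp e2) \<pi> + block_count (?fp e1) \<pi> = Suc (length w)
      then c ^ block_count (?fp e1) \<pi> else 0) =
    (\<Sum>\<pi> | \<pi> \<in> pairings V \<and> admissible r V \<pi>.
      if noncrossing \<pi> [] (?fp e1) \<and> noncrossing \<pi> [] (?fp e2) then c ^ block_count (?fp e1) \<pi> else 0)"
  proof (rule sum.cong[OF refl])
    fix \<pi> assume "\<pi> \<in> {\<pi>. \<pi> \<in> pairings V \<and> admissible r V \<pi>}"
    then have \<pi>: "\<pi> \<in> pairings V" by simp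
    show "(if face_count z (?fp e1) \<pi> + block_count (?fp e1) \<pi> = Suc (length w) \<and>
        face_count z (?fp e2) \<pi> + block_count (?fp e1) \<pi> = Suc (length w)
      then c ^ block_count (?fp e1) \<pi> else 0) =
      (if noncrossing \<pi> [] (?fp e1) \<and> noncrossing \<pi> [] (?fp e2) then c ^ block_count (?fp e1) \<pi> else 0)"
      using genus[OF \<pi>, of e1] genus[OF \<pi>, of e2] block[OF \<pi>] by simp
  qed
  also have "\<dots> = (\<Sum>\<pi>\<in>{\<pi> \<in> {\<pi>. \<pi> \<in> pairings V \<and> admissible r V \<pi>}.
      noncrossing \<pi> [] (?fp e1) \<and> noncrossing \<pi> [] (?fp e2)}. c ^ block_count (?fp e1) \<pi>)"
    by (rule sum.inter_filter[OF finV, symmetric])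
  also have "{\<pi> \<in> {\<pi>. \<pi> \<in> pairings V \<and> admissible r V \<pi>}. noncrossing \<pi> [] (?fp e1) \<and> noncrossing \<pi> [] (?fp e2)} =
      planar_pairings 0 [] w"
    by (simp add: planar_pairings_def state_points_def V conj_assoc)
  also have "(\<Sum>\<pi>\<in>planar_pairings 0 [] w. c ^ block_count (?fp e1) \<pi>) = path_weight c q [] w"
    using sum_planar_pairings[of 0 "[]" w c] assms(1) by (simp add: weight_def state_points_def valid_blocks_def)
  finally show "(\<Sum>\<pi> | \<pi> \<in> pairings V \<and> admissible r V \<pi>.
      if face_count z (?fp e1) \<pi> + block_count (?fp e1) \<pi> = Suc (length w) \<and>
        face_count z (?fp e2) \<pi> + block_count (?fp e1) \<pi> = Suc (length w)
      then c ^ block_count (?fp e1) \<pi> else 0) = path_weight c q [] w" .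
qed

end

text \<open>With the defects \<open>a\<close> and \<open>b\<close> of the two Euler bounds, the
  monomial is a power of the convergent ratio times inverse powers of \<open>d1\<close> and
  \<open>d2\<close>, so any positive defect kills it.\<close>

lemma tendsto_monomial_ratio:
  fixes c :: real and p :: "nat \<Rightarrow> nat \<Rightarrow> nat"
  assumes lim: "((\<lambda>(d1, d2). real (p d1 d2) / (real d1 * real d2)) \<longlongrightarrow> c) (sequentially \<times>\<^sub>F sequentially)"
    and le: "A + P \<le> K" "B + P \<le> K"
  shows "((\<lambda>(d1, d2). (1 / of_nat (d1 * d2)) ^ K * of_nat (d1 ^ A * d2 ^ B * p d1 d2 ^ P))
    \<longlongrightarrow> (if A + P = K \<and> B + P = K then complex_of_real c ^ P else 0)) (sequentially \<times>\<^sub>F sequentially)"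
proof -
  let ?F = "sequentially \<times>\<^sub>F sequentially :: (nat \<times> nat) filter"
  obtain a b where ab: "K = A + P + a" "K = B + P + b" using le by (metis nat_le_iff_add)
  let ?g = "\<lambda>d :: nat \<times> nat. (real (p (fst d) (snd d)) / (real (fst d) * real (snd d))) ^ P *
      (1 / real (fst d)) ^ a * (1 / real (snd d)) ^ b"
  have "((\<lambda>d. 1 / real (fst d)) \<longlongrightarrow> 0) ?F" "((\<lambda>d. 1 / real (snd d)) \<longlongrightarrow> 0) ?F"
    using filterlim_compose[OF lim_1_over_n filterlim_fst] filterlim_compose[OF lim_1_over_n filterlim_snd]
    by blast+
  then have "(?g \<longlongrightarrow> c ^ P * 0 ^ a * 0 ^ b) ?F"
    using lim by (intro tendsto_mult tendsto_power) (simp_all add: case_prod_unfold)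
  then have g: "((\<lambda>d. complex_of_real (?g d)) \<longlongrightarrow> complex_of_real (c ^ P * 0 ^ a * 0 ^ b)) ?F"
    by (rule tendsto_of_real)
  \<comment> \<open>The convention that a zeroth power of 0 is 1 selects the terms without
    defect.\<close>
  have l: "complex_of_real (c ^ P * 0 ^ a * 0 ^ b) = (if A + P = K \<and> B + P = K then complex_of_real c ^ P else 0)"
    using ab by (cases "a = 0"; cases "b = 0") auto
  have "\<forall>\<^sub>F d in ?F. complex_of_real (?g d) =
      (case d of (d1, d2) \<Rightarrow> (1 / of_nat (d1 * d2)) ^ K * of_nat (d1 ^ A * d2 ^ B * p d1 d2 ^ P))"
    unfolding eventually_prod_sequentially
  proof (intro exI[of _ 1] allI impI)
    fix d2 d1 :: nat assume d: "1 \<le> d2" "1 \<le> d1"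
    define x where "x = complex_of_nat d1"
    define y where "y = complex_of_nat d2"
    have xy: "x \<noteq> 0" "y \<noteq> 0" using d by (auto simp: x_def y_def)
    have "(1 / x) ^ K * x ^ A = (1 / x) ^ P * (1 / x) ^ a"
      using xy by (simp add: ab(1) power_add power_divide)
    moreover have "(1 / y) ^ K * y ^ B = (1 / y) ^ P * (1 / y) ^ b"
      using xy by (simp add: ab(2) power_add power_divide)
    moreover have "(1 / (x * y)) ^ K * (x ^ A * y ^ B) = ((1 / x) ^ K * x ^ A) * ((1 / y) ^ K * y ^ B)"
      by (simp add: power_divide power_mult_distrib)
    ultimately have "(1 / (x * y)) ^ K * (x ^ A * y ^ B) = (1 / (x * y)) ^ P * (1 / x) ^ a * (1 / y) ^ b"
      by (simp add: power_divide power_mult_distrib)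
    then have "(1 / (x * y)) ^ K * (x ^ A * y ^ B) * of_nat (p d1 d2) ^ P =
        (of_nat (p d1 d2) / (x * y)) ^ P * (1 / x) ^ a * (1 / y) ^ b"
      by (simp add: power_divide)
    then show "complex_of_real (?g (d1, d2)) =
      (case (d1, d2) of (d1, d2) \<Rightarrow> (1 / of_nat (d1 * d2)) ^ K * of_nat (d1 ^ A * d2 ^ B * p d1 d2 ^ P))"
      by (simp add: x_def y_def mult.assoc)
  qed
  then show ?thesis by (rule Lim_transform_eventually[OF g[unfolded l]])
qed

text \<open>Common to the complex and real case: the Gaussian law enters only through independence,
  integrability and the Wick recursion selected by \<open>r\<close>.\<close>

lemma asymptotically_free_flagged_wishart:
  fixes c :: real and p :: "nat \<Rightarrow> nat \<Rightarrow> nat" and M :: "nat \<Rightarrow> nat \<Rightarrow> 'a measure"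
    and G :: "nat \<Rightarrow> nat \<Rightarrow> nat \<times> nat \<times> nat \<Rightarrow> 'a \<Rightarrow> complex"
  assumes lim: "((\<lambda>(d1, d2). real (p d1 d2) / (real d1 * real d2)) \<longlongrightarrow> c) (sequentially \<times>\<^sub>F sequentially)"
    and M: "\<And>d1 d2. prob_space (M d1 d2)"
    and flags: "transpose_flags e1 e2 {..<length Xs} r (\<lambda>i. if e1 i = e2 i then 1 else 0)"
    and indep: "\<And>d1 d2. prob_space.indep_vars (M d1 d2) (\<lambda>_. borel) (G d1 d2) ({..<d1} \<times> {..<d2} \<times> {..<p d1 d2})"
    and int: "\<And>d1 d2 v a b. v \<in> {..<d1} \<times> {..<d2} \<times> {..<p d1 d2} \<Longrightarrow>
      integrable (M d1 d2) (\<lambda>\<omega>. G d1 d2 v \<omega> ^ a * cnj (G d1 d2 v \<omega>) ^ b)"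
    and mom: "\<And>d1 d2 v. v \<in> {..<d1} \<times> {..<d2} \<times> {..<p d1 d2} \<Longrightarrow>
      wick_moments r (\<lambda>a b. \<integral>\<omega>. G d1 d2 v \<omega> ^ a * cnj (G d1 d2 v \<omega>) ^ b \<partial>M d1 d2)"
    and Xs: "\<And>i d1 d2 \<omega>. i < length Xs \<Longrightarrow> (Xs ! i) (d1, d2) \<omega> =
      flagged_wishart (e1 i) (e2 i) d1 d2 (p d1 d2) (\<lambda>i j k. G d1 d2 (i, j, k) \<omega>)"
  shows "asymptotically_free (sequentially \<times>\<^sub>F sequentially) (\<lambda>(d1, d2). M d1 d2) (\<lambda>(d1, d2). d1 * d2) Xs"
proof (rule asymptotically_free_pathI[where c = "complex_of_real c" and q = "\<lambda>i. if e1 i = e2 i then 1 else 0"])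
  fix w assume w: "set w \<subseteq> {..<length Xs}"
  interpret transpose_flags e1 e2 "{..<length Xs}" r "\<lambda>i. if e1 i = e2 i then 1 else 0" by (rule flags)
  let ?F = "sequentially \<times>\<^sub>F sequentially :: (nat \<times> nat) filter"
  let ?V = "{0..<length w} \<times> (UNIV :: bool set)" and ?z = "(length w, True)"
  let ?P = "{\<pi>. \<pi> \<in> pairings ?V \<and> admissible r ?V \<pi>}"
  let ?fp = "\<lambda>e. factor_points e 0 w"
  have map: "map (\<lambda>i. (Xs ! i) (d1, d2) \<omega>) w =
      map (\<lambda>i. flagged_wishart (e1 i) (e2 i) d1 d2 (p d1 d2) (\<lambda>i j k. G d1 d2 (i, j, k) \<omega>)) w" for d1 d2 \<omega>
    using w by (intro map_cong Xs) auto
  have tr: "integrable (M d1 d2) (\<lambda>\<omega>. normalized_trace (mat_prod_list (d1 * d2)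
      (map (\<lambda>i. flagged_wishart (e1 i) (e2 i) d1 d2 (p d1 d2) (\<lambda>i j k. G d1 d2 (i, j, k) \<omega>)) w)))"
    "(\<integral>\<omega>. normalized_trace (mat_prod_list (d1 * d2)
      (map (\<lambda>i. flagged_wishart (e1 i) (e2 i) d1 d2 (p d1 d2) (\<lambda>i j k. G d1 d2 (i, j, k) \<omega>)) w)) \<partial>M d1 d2) =
      (1 / of_nat (d1 * d2)) ^ Suc (length w) *
      (\<Sum>\<pi>\<in>?P. of_nat (card (index_assignments e1 e2 d1 d2 (p d1 d2) w \<pi>)))" for d1 d2
    by (rule prob_space.expected_trace[OF M indep int mom]; assumption)+
  have e: "(\<integral>\<omega>. normalized_trace (mat_prod_list (case d of (d1, d2) \<Rightarrow> d1 * d2) (map (\<lambda>i. (Xs ! i) d \<omega>) w))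
      \<partial>(case d of (d1, d2) \<Rightarrow> M d1 d2)) =
    (\<Sum>\<pi>\<in>?P. case d of (d1, d2) \<Rightarrow> (1 / of_nat (d1 * d2)) ^ Suc (length w) *
      of_nat (d1 ^ face_count ?z (?fp e1) \<pi> * d2 ^ face_count ?z (?fp e2) \<pi> * p d1 d2 ^ block_count (?fp e1) \<pi>))" for d
  proof (cases d)
    case (Pair d1 d2)
    have "(\<Sum>\<pi>\<in>?P. of_nat (card (index_assignments e1 e2 d1 d2 (p d1 d2) w \<pi>)) :: complex) =
      (\<Sum>\<pi>\<in>?P. of_nat (d1 ^ face_count ?z (?fp e1) \<pi> * d2 ^ face_count ?z (?fp e2) \<pi> * p d1 d2 ^ block_count (?fp e1) \<pi>))"
    proof (rule sum.cong[OF refl])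
      fix \<pi> assume "\<pi> \<in> ?P"
      then show "(of_nat (card (index_assignments e1 e2 d1 d2 (p d1 d2) w \<pi>)) :: complex) =
        of_nat (d1 ^ face_count ?z (?fp e1) \<pi> * d2 ^ face_count ?z (?fp e2) \<pi> * p d1 d2 ^ block_count (?fp e1) \<pi>)"
        by (subst card_index_assignments) simp_all
    qed
    then show ?thesis
      unfolding Pair prod.case map using tr(2)[of d1 d2] by (simp only: sum_distrib_left)
  qed
  show "(\<forall>\<^sub>F N in ?F. integrable (case N of (d1, d2) \<Rightarrow> M d1 d2)
      (\<lambda>\<omega>. normalized_trace (mat_prod_list (case N of (d1, d2) \<Rightarrow> d1 * d2) (map (\<lambda>i. (Xs ! i) N \<omega>) w)))) \<and>
    ((\<lambda>N. \<integral>\<omega>. normalized_trace (mat_prod_list (case N of (d1, d2) \<Rightarrow> d1 * d2) (map (\<lambda>i. (Xs ! i) N \<omega>) w))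
      \<partial>(case N of (d1, d2) \<Rightarrow> M d1 d2)) \<longlongrightarrow>
      path_weight (complex_of_real c) (\<lambda>i. if e1 i = e2 i then 1 else 0) [] w) ?F"
  proof
    show "\<forall>\<^sub>F N in ?F. integrable (case N of (d1, d2) \<Rightarrow> M d1 d2)
      (\<lambda>\<omega>. normalized_trace (mat_prod_list (case N of (d1, d2) \<Rightarrow> d1 * d2) (map (\<lambda>i. (Xs ! i) N \<omega>) w)))"
    proof (rule always_eventually, rule allI)
      fix N :: "nat \<times> nat"
      obtain d1 d2 where N: "N = (d1, d2)" by (cases N)
      show "integrable (case N of (d1, d2) \<Rightarrow> M d1 d2)
        (\<lambda>\<omega>. normalized_trace (mat_prod_list (case N of (d1, d2) \<Rightarrow> d1 * d2) (map (\<lambda>i. (Xs ! i) N \<omega>) w)))"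
        unfolding N prod.case map by (rule tr(1))
    qed
    show "((\<lambda>N. \<integral>\<omega>. normalized_trace (mat_prod_list (case N of (d1, d2) \<Rightarrow> d1 * d2) (map (\<lambda>i. (Xs ! i) N \<omega>) w))
      \<partial>(case N of (d1, d2) \<Rightarrow> M d1 d2)) \<longlongrightarrow>
      path_weight (complex_of_real c) (\<lambda>i. if e1 i = e2 i then 1 else 0) [] w) ?F"
      unfolding e sum_genus_zero_pairings(1)[OF w, symmetric]
    proof (rule tendsto_sum)
      fix \<pi> assume "\<pi> \<in> ?P"
      then have "\<pi> \<in> pairings ?V" by simp
      note le = sum_genus_zero_pairings(2)[OF w this]
      show "((\<lambda>N. case N of (d1, d2) \<Rightarrow> (1 / of_nat (d1 * d2)) ^ Suc (length w) *
          of_nat (d1 ^ face_count ?z (?fp e1) \<pi> * d2 ^ face_count ?z (?fp e2) \<pi> * p d1 d2 ^ block_count (?fp e1) \<pi>)) \<longlongrightarrow>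
        (if face_count ?z (?fp e1) \<pi> + block_count (?fp e1) \<pi> = Suc (length w) \<and>
          face_count ?z (?fp e2) \<pi> + block_count (?fp e1) \<pi> = Suc (length w)
          then complex_of_real c ^ block_count (?fp e1) \<pi> else 0)) ?F"
        using le by (intro tendsto_monomial_ratio[OF lim]) simp_all
    qed
  qed
qed

theorem theorem1:
  fixes c :: real and p :: "nat \<Rightarrow> nat \<Rightarrow> nat" and M :: "nat \<Rightarrow> nat \<Rightarrow> 'a measure"
  assumes "0 < c"
    and "((\<lambda>(d1, d2). real (p d1 d2) / (real d1 * real d2)) \<longlongrightarrow> c) (sequentially \<times>\<^sub>F sequentially)"
    and "\<And>d1 d2. prob_space (M d1 d2)"
  shows
    "(\<forall>g :: nat \<Rightarrow> nat \<Rightarrow> nat \<Rightarrow> nat \<Rightarrow> nat \<Rightarrow> 'a \<Rightarrow> complex.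
        (\<forall>d1 d2. complex_gaussian_array (M d1 d2) d1 d2 (p d1 d2) (g d1 d2)) \<longrightarrow>
        asymptotically_free (sequentially \<times>\<^sub>F sequentially) (\<lambda>(d1, d2). M d1 d2) (\<lambda>(d1, d2). d1 * d2)
          [\<lambda>(d1, d2) \<omega>. wishart d1 d2 (p d1 d2) (\<lambda>i j k. g d1 d2 i j k \<omega>),
           \<lambda>(d1, d2) \<omega>. wishart_left d1 d2 (p d1 d2) (\<lambda>i j k. g d1 d2 i j k \<omega>),
           \<lambda>(d1, d2) \<omega>. wishart_right d1 d2 (p d1 d2) (\<lambda>i j k. g d1 d2 i j k \<omega>),
           \<lambda>(d1, d2) \<omega>. wishart_transpose d1 d2 (p d1 d2) (\<lambda>i j k. g d1 d2 i j k \<omega>)]) \<and>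
     (\<forall>g :: nat \<Rightarrow> nat \<Rightarrow> nat \<Rightarrow> nat \<Rightarrow> nat \<Rightarrow> 'a \<Rightarrow> real.
        (\<forall>d1 d2. real_gaussian_array (M d1 d2) d1 d2 (p d1 d2) (g d1 d2)) \<longrightarrow>
        asymptotically_free (sequentially \<times>\<^sub>F sequentially) (\<lambda>(d1, d2). M d1 d2) (\<lambda>(d1, d2). d1 * d2)
          [\<lambda>(d1, d2) \<omega>. wishart d1 d2 (p d1 d2) (\<lambda>i j k. complex_of_real (g d1 d2 i j k \<omega>)),
           \<lambda>(d1, d2) \<omega>. wishart_right d1 d2 (p d1 d2) (\<lambda>i j k. complex_of_real (g d1 d2 i j k \<omega>))])"
proof (intro conjI allI impI)
  fix g :: "nat \<Rightarrow> nat \<Rightarrow> nat \<Rightarrow> nat \<Rightarrow> nat \<Rightarrow> 'a \<Rightarrow> complex"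
  assume g: "\<forall>d1 d2. complex_gaussian_array (M d1 d2) d1 d2 (p d1 d2) (g d1 d2)"
  let ?Xs = "[\<lambda>(d1, d2) \<omega>. wishart d1 d2 (p d1 d2) (\<lambda>i j k. g d1 d2 i j k \<omega>),
           \<lambda>(d1, d2) \<omega>. wishart_left d1 d2 (p d1 d2) (\<lambda>i j k. g d1 d2 i j k \<omega>),
           \<lambda>(d1, d2) \<omega>. wishart_right d1 d2 (p d1 d2) (\<lambda>i j k. g d1 d2 i j k \<omega>),
           \<lambda>(d1, d2) \<omega>. wishart_transpose d1 d2 (p d1 d2) (\<lambda>i j k. g d1 d2 i j k \<omega>)]"
  let ?G = "\<lambda>d1 d2 (i, j, k). g d1 d2 i j k"
  \<comment> \<open>Positions 0 to 3 are \<open>W\<close> and its left, right and full transposes; a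
    flag is true where the leg is left alone.\<close>
  let ?e1 = "\<lambda>i :: nat. i = 0 \<or> i = 2" and ?e2 = "\<lambda>i :: nat. i = 0 \<or> i = 1"
  have normal: "complex_normal (M d1 d2) (?G d1 d2 v) 0 1" if "v \<in> {..<d1} \<times> {..<d2} \<times> {..<p d1 d2}" for d1 d2 v
    using g that by (auto simp: complex_gaussian_array_def)
  show "asymptotically_free (sequentially \<times>\<^sub>F sequentially) (\<lambda>(d1, d2). M d1 d2) (\<lambda>(d1, d2). d1 * d2) ?Xs"
  proof (rule asymptotically_free_flagged_wishart[OF assms(2,3), where G = ?G and ?e1.0 = ?e1 and ?e2.0 = ?e2 and r = False])
    show "transpose_flags ?e1 ?e2 {..<length ?Xs} False (\<lambda>i. if ?e1 i = ?e2 i then 1 else 0)"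
      by unfold_locales (auto simp: less_Suc_eq numeral_eq_Suc)
    show "prob_space.indep_vars (M d1 d2) (\<lambda>_. borel) (?G d1 d2) ({..<d1} \<times> {..<d2} \<times> {..<p d1 d2})" for d1 d2
      using g by (simp add: complex_gaussian_array_def)
    fix i d1 d2 \<omega> assume "i < length ?Xs"
    then consider "i = 0" | "i = 1" | "i = 2" | "i = 3" by (auto simp: less_Suc_eq numeral_eq_Suc)
    then show "(?Xs ! i) (d1, d2) \<omega> =
        flagged_wishart (?e1 i) (?e2 i) d1 d2 (p d1 d2) (\<lambda>i j k. ?G d1 d2 (i, j, k) \<omega>)"
      by cases (simp_all add: wishart_flags numeral_eq_Suc)
  next
    fix d1 d2 v assume "v \<in> {..<d1} \<times> {..<d2} \<times> {..<p d1 d2}"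
    note moments = prob_space.wick_moments_complex_normal[OF assms(3) normal[OF this]]
    show "integrable (M d1 d2) (\<lambda>\<omega>. ?G d1 d2 v \<omega> ^ a * cnj (?G d1 d2 v \<omega>) ^ b)" for a b
      by (rule moments(1))
    show "wick_moments False (\<lambda>a b. \<integral>\<omega>. ?G d1 d2 v \<omega> ^ a * cnj (?G d1 d2 v \<omega>) ^ b \<partial>M d1 d2)"
      by (rule moments(2))
  qed
next
  fix g :: "nat \<Rightarrow> nat \<Rightarrow> nat \<Rightarrow> nat \<Rightarrow> nat \<Rightarrow> 'a \<Rightarrow> real"
  assume g: "\<forall>d1 d2. real_gaussian_array (M d1 d2) d1 d2 (p d1 d2) (g d1 d2)"
  let ?Xs = "[\<lambda>(d1, d2) \<omega>. wishart d1 d2 (p d1 d2) (\<lambda>i j k. complex_of_real (g d1 d2 i j k \<omega>)),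
           \<lambda>(d1, d2) \<omega>. wishart_right d1 d2 (p d1 d2) (\<lambda>i j k. complex_of_real (g d1 d2 i j k \<omega>))]"
  let ?R = "\<lambda>d1 d2 (i, j, k). g d1 d2 i j k"
  let ?G = "\<lambda>d1 d2 v \<omega>. complex_of_real (?R d1 d2 v \<omega>)"
  \<comment> \<open>Here the second leg alone distinguishes the two matrices, as required when
    contractions ignore the kind of a factor.\<close>
  let ?e1 = "\<lambda>i :: nat. True" and ?e2 = "\<lambda>i :: nat. i = 0"
  have normal: "distributed (M d1 d2) lborel (?R d1 d2 v) (normal_density 0 1)"
    if "v \<in> {..<d1} \<times> {..<d2} \<times> {..<p d1 d2}" for d1 d2 v
    using g that by (auto simp: real_gaussian_array_def)
  show "asymptotically_free (sequentially \<times>\<^sub>F sequentially) (\<lambda>(d1, d2). M d1 d2) (\<lambda>(d1, d2). d1 * d2) ?Xs"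
  proof (rule asymptotically_free_flagged_wishart[OF assms(2,3), where G = ?G and ?e1.0 = ?e1 and ?e2.0 = ?e2 and r = True])
    show "transpose_flags ?e1 ?e2 {..<length ?Xs} True (\<lambda>i. if ?e1 i = ?e2 i then 1 else 0)"
      by unfold_locales (auto simp: less_Suc_eq)
    show "prob_space.indep_vars (M d1 d2) (\<lambda>_. borel) (?G d1 d2) ({..<d1} \<times> {..<d2} \<times> {..<p d1 d2})" for d1 d2
      by (rule prob_space.indep_vars_compose2[OF assms(3), where M' = "\<lambda>_. borel"])
        (use g in \<open>simp_all add: real_gaussian_array_def\<close>)
    fix i d1 d2 \<omega> assume "i < length ?Xs"
    then consider "i = 0" | "i = 1" by (auto simp: less_Suc_eq)
    then show "(?Xs ! i) (d1, d2) \<omega> =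
        flagged_wishart (?e1 i) (?e2 i) d1 d2 (p d1 d2) (\<lambda>i j k. ?G d1 d2 (i, j, k) \<omega>)"
      by cases (simp_all add: wishart_flags)
  next
    fix d1 d2 v assume "v \<in> {..<d1} \<times> {..<d2} \<times> {..<p d1 d2}"
    note moments = prob_space.wick_moments_real_normal[OF assms(3) normal[OF this]]
    show "integrable (M d1 d2) (\<lambda>\<omega>. ?G d1 d2 v \<omega> ^ a * cnj (?G d1 d2 v \<omega>) ^ b)" for a b
      by (rule moments(1))
    show "wick_moments True (\<lambda>a b. \<integral>\<omega>. ?G d1 d2 v \<omega> ^ a * cnj (?G d1 d2 v \<omega>) ^ b \<partial>M d1 d2)"
      by (rule moments(2))
  qed
qed

end
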